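(* Consider the linear interconnected multi-agent system $$x_i^+=Ax_i+A_p\sum_{j\in\mathcal{N}_i^p}a_{ij}(x_j-x_i)+Bu_i,\qquad u_i=K\sum_{j\in\mathcal{N}_i^c}b_{ij}(x_i-x_j),\qquad i=1,\dots,N,$$ with $A,A_p\in\mathbb{R}^{n\times n}$, $B\in\mathbb{R}^n$, $K\in\mathbb{R}^{1\times n}$, as set up in the context. Suppose that the Laplacians $\mathcal{L}_p$ and $\mathcal{L}_c$ commute, that the pairs $(A-\lambda_{p,i}A_p,B)$ are controllable for all $i\in\{2,\dots,N\}$, and that $A_p=\alpha A$ for some $\alpha\in\mathbb{R}$. Let $\alpha_i=1-\alpha\lambda_{p,i}$, $\alpha_{\max}=\max_i|\alpha_i|$, $\alpha_{\min}=\min_i|\alpha_i|$ (all indices $i,j$ range over $\{2,\dots,N\}$), $\bar A=\alpha_{\max}A$, and $$\sigma_c=1-\frac{1}{\prod_k|\lambda_k^u(\bar A)|^2},$$ where $\lambda_1^u(\bar A),\lambda_2^u(\bar A),\dots$ are the unstable eigenvalues of $\bar A$. If $\bar A$ is Schur stable, the system is consensusable by using the control gain $K=0$. If $\bar A$ is not Schur stable and $$\left(\frac{\max_{i,j}\frac{\alpha_i}{\lambda_{c,j}}-\min_{i,j}\frac{\alpha_i}{\lambda_{c,j}}}{2}\right)^2<\frac{\alpha_{\min}^2-\alpha_{\max}^2\sigma_c}{\lambda_{c,\max}^2},$$ then the system is consensusable by using the control gain $K=-k^*(B^\top PB)^{-1}B^\top PA$, where $$k^*=\frac{\min_{i,j}\frac{\alpha_i}{\lambda_{c,j}}+\max_{i,j}\frac{\alpha_i}{\lambda_{c,j}}}{2}$$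 and $P=P^\top\succ0$ is a solution of $$\bar A^\top P\bar A-\sigma\bar A^\top PB(B^\top PB)^{-1}B^\top P\bar A-P\prec0\quad\text{with}\quad \sigma=\min_{i,j}\frac{2\alpha_i\lambda_{c,j}k^*-\lambda_{c,j}^2(k^* )^2}{\alpha_{\max}^2}.$$
   Context: Let $N\ge2$. The physical graph $\mathcal{G}_p$ and the communication graph $\mathcal{G}_c$ are undirected weighted graphs on the node set $\{1,\dots,N\}$, with symmetric positive edge weights $a_{ij}=a_{ji}$ and $b_{ij}=b_{ji}$, neighbor sets $\mathcal{N}_i^p,\mathcal{N}_i^c$, and Laplacians (degree matrix minus weighted adjacency matrix) $\mathcal{L}_p,\mathcal{L}_c$. $\mathcal{G}_c$ is connected; $\mathcal{G}_p$ may be disconnected. The system is in discrete time ($x^+$ is the next value of $x$), and its closed loop is $x^+=(I_N\otimes A-\mathcal{L}_p\otimes A_p+\mathcal{L}_c\otimes BK)x$, $x=[x_1^\top,\dots,x_N^\top]^\top\in\mathbb{R}^{Nn}$. A gain $K$ achieves consensus if the states of all subsystems converge to a global consensus vector, i.e. $\lim_{t\to\infty}|x_i(t)-\bar v|=0$ (componentwise absolute value) for all $i\in\{1,\dots,N\}$, for some $\bar v\in\mathbb{R}^n$. The system is consensusable (by using $K$) if some gain (the gain $K$) achieves consensus. Since $\mathcal{L}_p,\mathcal{L}_c$ commute, there is an orthogonal matrix $\Phi$ with first column $\mathbf{1}_N/\sqrt N$ ($\mathbf{1}_N$ the all-ones vector) such that $\Phi^\top\mathcal{L}_p\Phi=\mathrm{diag}(0,\lambda_{p,2},\dots,\lambda_{p,N})$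 and $\Phi^\top\mathcal{L}_c\Phi=\mathrm{diag}(0,\lambda_{c,2},\dots,\lambda_{c,N})$; all $\lambda_{c,i}>0$. Let $\lambda_{c,\max}=\max_{i\in\{2,\dots,N\}}\lambda_{c,i}$. A matrix is Schur stable if all its eigenvalues lie in the open unit disk; unstable eigenvalues are those (counted with multiplicity) of modulus at least $1$. $\succ0$ / $\prec0$ denote positive / negative definiteness.
   Formalization: Consensus is taken toward a common vector v(t) that may vary with time instead of a constant vector: the average state obeys avg⁺ = A·avg for every gain K, so with unstable A no constant limit need exist; when the average converges, all agents converge to its limit. *)

theory Defs
  imports
    "HOL-Computational_Algebra.Fundamental_Theorem_Algebra"
    "Jordan_Normal_Form.Char_Poly"
    "Jordan_Normal_Form.DL_Rank"
begin

(* The nodes are 0, ..., N - 1, so the distinguished index is 0 and the nontrivial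
   Laplacian eigenvalues carry the indices {1..<N}.  Edges are ordered pairs of a symmetric
   relation; the weight function is only meaningful on edges. *)

definition weighted_graph :: "nat \<Rightarrow> (nat \<times> nat) set \<Rightarrow> (nat \<Rightarrow> nat \<Rightarrow> real) \<Rightarrow> bool" where
  "weighted_graph N E w \<longleftrightarrow>
     E \<subseteq> {..<N} \<times> {..<N} \<and> sym E \<and> irrefl E \<and>
     (\<forall>(i, j) \<in> E. w i j > 0 \<and> w i j = w j i)"

definition connected_graph :: "nat \<Rightarrow> (nat \<times> nat) set \<Rightarrow> bool" where
  "connected_graph N E \<longleftrightarrow> (\<forall>i<N. \<forall>j<N. (i, j) \<in> E\<^sup>*)"

definition neighbors :: "(nat \<times> nat) set \<Rightarrow> nat \<Rightarrow> nat set" where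
  "neighbors E i = E `` {i}"

definition adjacency :: "nat \<Rightarrow> (nat \<times> nat) set \<Rightarrow> (nat \<Rightarrow> nat \<Rightarrow> real) \<Rightarrow> real mat" where
  "adjacency N E w = mat N N (\<lambda>(i, j). if (i, j) \<in> E then w i j else 0)"

definition laplacian :: "nat \<Rightarrow> (nat \<times> nat) set \<Rightarrow> (nat \<Rightarrow> nat \<Rightarrow> real) \<Rightarrow> real mat" where
  "laplacian N E w = mat_diag N (\<lambda>i. \<Sum>j\<in>neighbors E i. w i j) - adjacency N E w"

(* Column 0 of Phi is the normalised all-ones vector; lp 0 = lc 0 = 0 are its eigenvalues.
   orthogonal_mat is not used because it only asks for pairwise orthogonal nonzero columns. *)
definition diagonalizes_laplacians ::
  "nat \<Rightarrow> real mat \<Rightarrow> real mat \<Rightarrow> real mat \<Rightarrow> (nat \<Rightarrow> real) \<Rightarrow> (nat \<Rightarrow> real) \<Rightarrow> bool" where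
  "diagonalizes_laplacians N \<Phi> Lp Lc lp lc \<longleftrightarrow>
     \<Phi> \<in> carrier_mat N N \<and> \<Phi>\<^sup>T * \<Phi> = 1\<^sub>m N \<and>
     col \<Phi> 0 = vec N (\<lambda>_. 1 / sqrt (real N)) \<and>
     lp 0 = 0 \<and> lc 0 = 0 \<and>
     \<Phi>\<^sup>T * Lp * \<Phi> = mat_diag N lp \<and>
     \<Phi>\<^sup>T * Lc * \<Phi> = mat_diag N lc"

(* Kalman rank condition for a single-input pair. *)
definition controllable :: "nat \<Rightarrow> real mat \<Rightarrow> real mat \<Rightarrow> bool" where
  "controllable n A B \<longleftrightarrow>
     vec_space.rank n (mat_of_cols n (map (\<lambda>k. col (A ^\<^sub>m k * B) 0) [0..<n])) = n"

definition schur_stable :: "real mat \<Rightarrow> bool" where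
  "schur_stable M \<longleftrightarrow> (\<forall>z. eigenvalue (map_mat complex_of_real M) z \<longrightarrow> cmod z < 1)"

definition unstable_eigenvalues :: "real mat \<Rightarrow> complex multiset" where
  "unstable_eigenvalues M =
     {# z \<in># proots (char_poly (map_mat complex_of_real M)). 1 \<le> cmod z #}"

definition positive_definite :: "nat \<Rightarrow> real mat \<Rightarrow> bool" where
  "positive_definite n M \<longleftrightarrow>
     M \<in> carrier_mat n n \<and> M\<^sup>T = M \<and>
     (\<forall>v \<in> carrier_vec n. v \<noteq> 0\<^sub>v n \<longrightarrow> v \<bullet> (M *\<^sub>v v) > 0)"

definition negative_definite :: "nat \<Rightarrow> real mat \<Rightarrow> bool" where
  "negative_definite n M \<longleftrightarrow>
     M \<in> carrier_mat n n \<and> M\<^sup>T = M \<and>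
     (\<forall>v \<in> carrier_vec n. v \<noteq> 0\<^sub>v n \<longrightarrow> v \<bullet> (M *\<^sub>v v) < 0)"

definition input_vec ::
  "nat \<Rightarrow> real mat \<Rightarrow> (nat \<times> nat) set \<Rightarrow> (nat \<Rightarrow> nat \<Rightarrow> real) \<Rightarrow> (nat \<Rightarrow> real vec) \<Rightarrow> nat \<Rightarrow> real vec" where
  "input_vec n K Ec b x i =
     K *\<^sub>v finsum_vec TYPE(real) n (\<lambda>j. b i j \<cdot>\<^sub>v (x i - x j)) (neighbors Ec i)"

definition trajectory ::
  "nat \<Rightarrow> nat \<Rightarrow> (nat \<times> nat) set \<Rightarrow> (nat \<Rightarrow> nat \<Rightarrow> real) \<Rightarrow> (nat \<times> nat) set \<Rightarrow> (nat \<Rightarrow> nat \<Rightarrow> real) \<Rightarrow>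
   real mat \<Rightarrow> real mat \<Rightarrow> real mat \<Rightarrow> real mat \<Rightarrow> (nat \<Rightarrow> nat \<Rightarrow> real vec) \<Rightarrow> bool" where
  "trajectory N n Ep a Ec b A Ap B K x \<longleftrightarrow>
     (\<forall>t. \<forall>i<N. x t i \<in> carrier_vec n) \<and>
     (\<forall>t. \<forall>i<N. x (Suc t) i =
        A *\<^sub>v x t i
        + Ap *\<^sub>v finsum_vec TYPE(real) n (\<lambda>j. a i j \<cdot>\<^sub>v (x t j - x t i)) (neighbors Ep i)
        + B *\<^sub>v input_vec n K Ec b (x t) i)"

(* The quantification over trajectories ranges over all initial states.  The common vector v
   is allowed to move with time: the network average obeys the uncontrolled recursion with
   matrix A whatever K is, so it need not settle at a fixed vector.  Whenever the average
   does converge, all agents converge to its limit. *)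
definition achieves_consensus ::
  "nat \<Rightarrow> nat \<Rightarrow> (nat \<times> nat) set \<Rightarrow> (nat \<Rightarrow> nat \<Rightarrow> real) \<Rightarrow> (nat \<times> nat) set \<Rightarrow> (nat \<Rightarrow> nat \<Rightarrow> real) \<Rightarrow>
   real mat \<Rightarrow> real mat \<Rightarrow> real mat \<Rightarrow> real mat \<Rightarrow> bool" where
  "achieves_consensus N n Ep a Ec b A Ap B K \<longleftrightarrow>
     K \<in> carrier_mat 1 n \<and>
     (\<forall>x. trajectory N n Ep a Ec b A Ap B K x \<longrightarrow>
        (\<exists>v. (\<forall>t. v t \<in> carrier_vec n) \<and>
           (\<forall>i<N. \<forall>k<n. (\<lambda>t. \<bar>x t i $ k - v t $ k\<bar>) \<longlonglongrightarrow> 0)))"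

(* Inverse of a 1 x 1 matrix such as B^T P B. *)
definition inv_1x1 :: "real mat \<Rightarrow> real mat" where
  "inv_1x1 M = mat 1 1 (\<lambda>_. inverse (M $$ (0, 0)))"

definition riccati_solution :: "nat \<Rightarrow> real mat \<Rightarrow> real mat \<Rightarrow> real \<Rightarrow> real mat \<Rightarrow> bool" where
  "riccati_solution n M B \<sigma> P \<longleftrightarrow>
     positive_definite n P \<and>
     negative_definite n
       (M\<^sup>T * P * M - \<sigma> \<cdot>\<^sub>m (M\<^sup>T * P * B * inv_1x1 (B\<^sup>T * P * B) * B\<^sup>T * P * M) - P)"

definition riccati_gain :: "real \<Rightarrow> real mat \<Rightarrow> real mat \<Rightarrow> real mat \<Rightarrow> real mat" where
  "riccati_gain k A B P = (- k) \<cdot>\<^sub>m (inv_1x1 (B\<^sup>T * P * B) * B\<^sup>T * P * A)"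

end

theory Submission
  imports Defs "Jordan_Normal_Form.Spectral_Radius" "HOL-Analysis.Convex"
begin

text \<open>
  In the orthonormal coordinates \<open>\<Phi>\<close> the closed loop splits into the modes
  \<open>z\<^sub>i\<^sup>+ = (\<alpha>\<^sub>i A + \<lambda>\<^sub>c\<^sub>,\<^sub>i B K) z\<^sub>i\<close>, and consensus follows once the modes \<open>i \<noteq> 0\<close> are Schur stable.
  For the Riccati gain, \<open>v\<^sup>T P v\<close> is a Lyapunov function of each of these modes; the bound on the spread of
  \<open>\<alpha>\<^sub>i / \<lambda>\<^sub>c\<^sub>,\<^sub>j\<close> ensures \<open>\<sigma> > \<sigma>\<^sub>c\<close>.

  That \<open>\<sigma> > \<sigma>\<^sub>c\<close> suffices for solvability of the Riccati inequality is shown by reflecting the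
  unstable eigenvalues \<open>\<lambda>\<close> of (a slightly enlarged) \<open>M\<close> to \<open>1 / cnj \<lambda>\<close>, one at a time. If \<open>w M = \<lambda> w\<close> and \<open>w B = 1\<close>,
  the feedback \<open>K = (1 / cnj \<lambda> - \<lambda>) w\<close> and \<open>P = (|\<lambda>|\<^sup>2 - 1) w\<^sup>H w\<close> satisfy, with \<open>F = M + B K\<close>, the relations
  \<open>F\<^sup>H P F + K\<^sup>H K = P\<close>, \<open>F\<^sup>H P B + K\<^sup>H = 0\<close> and \<open>1 + B\<^sup>H P B = |\<lambda>|\<^sup>2\<close>. These relations survive cascading, the
  last one multiplicatively, so that in the end \<open>1 + B\<^sup>H P B\<close> is the product of the \<open>|\<lambda>|\<^sup>2\<close> and
  \<open>\<sigma>\<^sub>c\<close> appears as \<open>B\<^sup>H P B / (1 + B\<^sup>H P B)\<close>.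
\<close>

section \<open>Matrix preliminaries\<close>

text \<open>The constant \<open>\<sigma>\<^sub>c\<close> is a product over single eigenvalues, but a
  real matrix cannot be changed in one non-real eigenvalue alone. The reflections therefore run over
  the complex numbers, and uniqueness of the stabilising solution leads back to real matrices. The
  enlargement of \<open>M\<close> clears the unit circle, where reflection does nothing, and
  provides strictness. Write q, g and \<beta> for the P-products of M v with itself, of M v with b,
  and of b with itself. Minimising the form of M v + u b plus u^2 over the scalar u gives q - g^2 /
  (1 + \<beta>). The Riccati inequality subtracts \<sigma> g^2 / \<beta> instead, so \<beta> / (1 +
  \<beta>) is the threshold for \<sigma>. The spread condition comes from 2 a l k - l^2 k^2 = a^2 -
  l^2 (a / l - k)^2. The midpoint \<open>k_star\<close> of the range of the ratios a / l makes the
  largest deviation as small as possible, namely half the spread; then a^2 is bounded below by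
  \<open>al_min\<close> squared and l^2 above by \<open>lc_max\<close> squared.\<close>

lemma smult_pow_mat:
  fixes A :: "'a :: comm_ring_1 mat"
  assumes A: "A \<in> carrier_mat n n"
  shows "(c \<cdot>\<^sub>m A) ^\<^sub>m k = c ^ k \<cdot>\<^sub>m (A ^\<^sub>m k)"
proof (induction k)
  case 0
  show ?case using A by auto
next
  case (Suc k)
  have Ak: "A ^\<^sub>m k \<in> carrier_mat n n" using A by simp
  have "(c \<cdot>\<^sub>m A) ^\<^sub>m Suc k = (c ^ k \<cdot>\<^sub>m A ^\<^sub>m k) * (c \<cdot>\<^sub>m A)" using Suc by simp
  also have "\<dots> = c ^ k \<cdot>\<^sub>m (c \<cdot>\<^sub>m (A ^\<^sub>m k * A))"
    by (rule eq_matI) (use A Ak in \<open>auto simp: mult.left_commute\<close>)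
  finally show ?case using A by (auto intro!: eq_matI simp: mult.assoc mult.left_commute)
qed

lemma eigenvalue_smult_mat:
  fixes A :: "complex mat"
  assumes A: "A \<in> carrier_mat n n" and c: "c \<noteq> 0" and ev: "eigenvalue (c \<cdot>\<^sub>m A) z"
  shows "eigenvalue A (z / c)"
proof -
  obtain v where v: "v \<in> carrier_vec n" "v \<noteq> 0\<^sub>v n" "(c \<cdot>\<^sub>m A) *\<^sub>v v = z \<cdot>\<^sub>v v"
    using ev A unfolding eigenvalue_def eigenvector_def by auto
  have "(c \<cdot>\<^sub>m A) *\<^sub>v v = c \<cdot>\<^sub>v (A *\<^sub>v v)" by (rule eq_vecI) (use v(1) A in auto)
  then have "c \<cdot>\<^sub>v (A *\<^sub>v v) = z \<cdot>\<^sub>v v" using v by simp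
  then have "(1 / c) \<cdot>\<^sub>v (c \<cdot>\<^sub>v (A *\<^sub>v v)) = (1 / c) \<cdot>\<^sub>v (z \<cdot>\<^sub>v v)" by simp
  then have "A *\<^sub>v v = (z / c) \<cdot>\<^sub>v v" using c by (simp add: smult_smult_assoc)
  then show ?thesis using v A unfolding eigenvalue_def eigenvector_def by auto
qed

text \<open>Powers of a matrix of spectral radius below 1 are bounded. Applied to
  \<open>A / r\<close>, with \<open>r\<close> strictly between the spectral radius of
  \<open>A\<close> and 1, this becomes the geometric bound \<open>c * r ^ k\<close> for
  \<open>A\<close> itself.\<close>

lemma schur_pow_tendsto_0:
  fixes A :: "complex mat"
  assumes A: "A \<in> carrier_mat n n" and ev: "\<And>z. eigenvalue A z \<Longrightarrow> cmod z < 1"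
    and ij: "i < n" "j < n"
  shows "(\<lambda>k. (A ^\<^sub>m k) $$ (i, j)) \<longlonglongrightarrow> 0"
proof -
  have n: "n > 0" using ij by simp
  define s where "s = spectral_radius A"
  have s1: "s < 1" using spectral_radius_mem_max(1)[OF A n] ev
    unfolding s_def spectrum_def by auto
  have s0: "0 \<le> s" using spectral_radius_mem_max(1)[OF A n] unfolding s_def by auto
  define r where "r = (1 + s) / 2"
  have r: "0 < r" "r < 1" "s < r" using s0 s1 unfolding r_def by auto
  let ?A = "complex_of_real (1 / r) \<cdot>\<^sub>m A"
  have A': "?A \<in> carrier_mat n n" using A by simp
  obtain z where z: "eigenvalue ?A z" and srz: "spectral_radius ?A = cmod z"
    using spectral_radius_mem_max(1)[OF A' n] unfolding spectrum_def by auto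
  have "eigenvalue A (z / complex_of_real (1 / r))"
    by (rule eigenvalue_smult_mat[OF A _ z]) (use r in simp)
  then have "cmod (z / complex_of_real (1 / r)) \<le> s"
    using spectral_radius_mem_max(2)[OF A n] unfolding s_def spectrum_def by auto
  then have "cmod z * r \<le> s" using r by (simp add: norm_mult norm_divide)
  then have "spectral_radius ?A < 1" using r srz s1
    by (metis dual_order.strict_trans2 less_eq_real_def mult_le_cancel_right1 not_le)
  from spectral_radius_jnf_norm_bound_less_1_upper_triangular[OF A' this]
  obtain c where c: "\<And>k. norm_bound (?A ^\<^sub>m k) c" by auto
  have bound: "cmod ((A ^\<^sub>m k) $$ (i, j)) \<le> c * r ^ k" for k
  proof -
    have Ak: "A ^\<^sub>m k \<in> carrier_mat n n" using A by simp
    have "cmod ((?A ^\<^sub>m k) $$ (i, j)) \<le> c"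
      using c[of k] ij A unfolding norm_bound_def by (auto simp: pow_mat_dim_square[OF A'])
    then have "(1 / r) ^ k * cmod ((A ^\<^sub>m k) $$ (i, j)) \<le> c"
      unfolding smult_pow_mat[OF A] using ij r carrier_matD[OF Ak] by (simp add: norm_mult norm_power norm_divide)
    then show ?thesis using r by (simp add: power_one_over field_simps)
  qed
  have "(\<lambda>k. c * r ^ k) \<longlonglongrightarrow> 0" using r
    by (auto intro!: tendsto_eq_intros LIMSEQ_realpow_zero)
  then show ?thesis
    by (rule tendsto_0_le[where K = 1]) (use order_trans[OF bound abs_ge_self] in simp)
qed

lemma schur_stable_pow_tendsto_0:
  assumes A: "A \<in> carrier_mat n n" and st: "schur_stable A" and ij: "i < n" "j < n"
  shows "(\<lambda>k. (A ^\<^sub>m k) $$ (i, j)) \<longlonglongrightarrow> 0"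
proof -
  have cA: "map_mat complex_of_real A \<in> carrier_mat n n" using A by simp
  have "(\<lambda>k. (map_mat complex_of_real A ^\<^sub>m k) $$ (i, j)) \<longlonglongrightarrow> 0"
    by (rule schur_pow_tendsto_0[OF cA _ ij]) (use st in \<open>auto simp: schur_stable_def\<close>)
  also have "(\<lambda>k. (map_mat complex_of_real A ^\<^sub>m k) $$ (i, j)) =
      (\<lambda>k. complex_of_real ((A ^\<^sub>m k) $$ (i, j)))"
    using ij A by (auto simp flip: of_real_hom.mat_hom_pow[OF A] simp: pow_mat_dim_square[OF A])
  finally show ?thesis by (metis tendsto_of_real_iff of_real_0)
qed

text \<open>Unlike the library versions these laws are conditional rewrite rules without extra
  variables, so that the simplifier can normalise products of rectangular matrices.\<close>

lemma mult_mat_assoc_dim: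
  "dim_col A = dim_row B \<Longrightarrow> dim_col B = dim_row C \<Longrightarrow> A * B * C = A * (B * C)"
  for A :: "'a :: comm_ring_1 mat"
  by (rule assoc_mult_mat[of _ "dim_row A" "dim_col A" _ "dim_col B" _ "dim_col C"]) auto

lemma add_mult_distrib_dim:
  "dim_row A = dim_row B \<Longrightarrow> dim_col A = dim_col B \<Longrightarrow> dim_col B = dim_row C \<Longrightarrow>
    (A + B) * C = A * C + B * C"
  for A :: "'a :: comm_ring_1 mat"
  by (rule add_mult_distrib_mat[of _ "dim_row A" "dim_col A" _ _ "dim_col C"]) auto

lemma mult_add_distrib_dim:
  "dim_row B = dim_row C \<Longrightarrow> dim_col B = dim_col C \<Longrightarrow> dim_col A = dim_row B \<Longrightarrow>
    A * (B + C) = A * B + A * C"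
  for A :: "'a :: comm_ring_1 mat"
  by (rule mult_add_distrib_mat[of _ "dim_row A" "dim_col A" _ "dim_col B"]) auto

lemma minus_mult_distrib_dim:
  "dim_row A = dim_row B \<Longrightarrow> dim_col A = dim_col B \<Longrightarrow> dim_col B = dim_row C \<Longrightarrow>
    (A - B) * C = A * C - B * C"
  for A :: "'a :: comm_ring_1 mat"
  by (rule minus_mult_distrib_mat[of _ "dim_row A" "dim_col A" _ _ "dim_col C"]) auto

lemma mult_minus_distrib_dim:
  "dim_row B = dim_row C \<Longrightarrow> dim_col B = dim_col C \<Longrightarrow> dim_col A = dim_row B \<Longrightarrow>
    A * (B - C) = A * B - A * C"
  for A :: "'a :: comm_ring_1 mat"
  by (rule mult_minus_distrib_mat[of _ "dim_row A" "dim_col A" _ "dim_col B"]) auto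

lemma smult_mult_dim:
  "dim_col A = dim_row B \<Longrightarrow> (k \<cdot>\<^sub>m A) * B = k \<cdot>\<^sub>m (A * B)"
  for A :: "'a :: comm_ring_1 mat"
  by (rule mult_smult_assoc_mat[of _ "dim_row A" "dim_col A" _ "dim_col B"]) auto

lemma mult_smult_dim:
  "dim_col A = dim_row B \<Longrightarrow> A * (k \<cdot>\<^sub>m B) = k \<cdot>\<^sub>m (A * B)"
  for A :: "'a :: comm_ring_1 mat"
  by (rule mult_smult_distrib[of _ "dim_row A" "dim_col A" _ "dim_col B"]) auto

lemmas mat_dim_simps = mult_mat_assoc_dim add_mult_distrib_dim mult_add_distrib_dim
  minus_mult_distrib_dim mult_minus_distrib_dim smult_mult_dim mult_smult_dim

lemma index_outer_prod_mat:
  fixes X Y :: "'a :: comm_ring_1 mat"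
  assumes "X \<in> carrier_mat n 1" "Y \<in> carrier_mat 1 m" "i < n" "j < m"
  shows "(X * Y) $$ (i, j) = X $$ (i, 0) * Y $$ (0, j)"
  using assms by (auto simp: scalar_prod_def)

section \<open>Conjugate transposes of complex matrices\<close>

lemma mat_adjoint_index [simp]:
  fixes A :: "complex mat"
  shows "dim_row (mat_adjoint A) = dim_col A" "dim_col (mat_adjoint A) = dim_row A"
    "i < dim_col A \<Longrightarrow> j < dim_row A \<Longrightarrow> mat_adjoint A $$ (i, j) = cnj (A $$ (j, i))"
  unfolding mat_adjoint_def by (auto simp: mat_of_rows_def)

lemma mat_adjoint_carrier [simp]:
  fixes A :: "complex mat"
  shows "A \<in> carrier_mat n m \<Longrightarrow> mat_adjoint A \<in> carrier_mat m n"
  by auto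

lemma mat_adjoint_mult:
  fixes A B :: "complex mat"
  shows "dim_col A = dim_row B \<Longrightarrow> mat_adjoint (A * B) = mat_adjoint B * mat_adjoint A"
  by (rule eq_matI) (auto simp: scalar_prod_def mult.commute intro!: sum.cong)

lemma mat_adjoint_add:
  fixes A B :: "complex mat"
  shows "dim_row A = dim_row B \<Longrightarrow> dim_col A = dim_col B \<Longrightarrow>
    mat_adjoint (A + B) = mat_adjoint A + mat_adjoint B"
  by (rule eq_matI) auto

lemma mat_adjoint_smult:
  fixes A :: "complex mat"
  shows "mat_adjoint (c \<cdot>\<^sub>m A) = cnj c \<cdot>\<^sub>m mat_adjoint A"
  by (rule eq_matI) auto

lemma mat_adjoint_adjoint [simp]:
  fixes A :: "complex mat"
  shows "mat_adjoint (mat_adjoint A) = A"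
  by (rule eq_matI) auto

lemmas mat_adjoint_simps = mat_adjoint_mult mat_adjoint_add mat_adjoint_smult

section \<open>Reflecting unstable eigenvalues by feedback\<close>

text \<open>The Popov-Belevitch-Hautus form of controllability. It passes easily through feedback
  and rescaling, the two operations that the construction performs on a pair. Row vectors are
  \<open>1 x n\<close> matrices so that every expression stays a matrix product.\<close>

definition hautus :: "nat \<Rightarrow> complex mat \<Rightarrow> complex mat \<Rightarrow> bool" where
  "hautus n M B \<longleftrightarrow>
     (\<forall>w \<in> carrier_mat 1 n. \<forall>z. w * M = z \<cdot>\<^sub>m w \<and> w * B = 0\<^sub>m 1 1 \<longrightarrow> w = 0\<^sub>m 1 n)"

text \<open>On row vectors annihilated by \<open>B\<close> the matrices \<open>M\<close> and
  \<open>M + B * K\<close> act alike.\<close>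

lemma hautus_feedback:
  assumes "hautus n M B" "M \<in> carrier_mat n n" "B \<in> carrier_mat n 1" "K \<in> carrier_mat 1 n"
  shows "hautus n (M + B * K) B"
  unfolding hautus_def
proof (intro ballI allI impI, elim conjE)
  fix w z assume w: "w \<in> carrier_mat 1 n" and ev: "w * (M + B * K) = z \<cdot>\<^sub>m w"
    and wB: "w * B = 0\<^sub>m 1 1"
  have "w * (M + B * K) = w * M + (w * B) * K"
    using assms w by (simp add: mult_add_distrib_mat[of _ 1 n])
  also have "\<dots> = w * M" using assms w unfolding wB by simp
  finally show "w = 0\<^sub>m 1 n" using assms(1) w wB ev unfolding hautus_def by metis
qed

text \<open>In a Schur form with \<open>l\<close> placed last, the last row of the triangular factor
  is \<open>l\<close> times a unit row; transported back, that row is a left eigenvector of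
  \<open>M\<close>. In the same coordinates \<open>B * w\<close> has entries only in the last
  column, so adding a multiple of it keeps the matrix triangular and changes the last diagonal entry
  only.\<close>

lemma left_eigenvector_shift:
  fixes M B :: "complex mat"
  assumes M: "M \<in> carrier_mat n n" and B: "B \<in> carrier_mat n 1"
    and cp: "char_poly M = (\<Prod>e\<leftarrow>es @ [l]. [:-e, 1:])" and pbh: "hautus n M B"
  obtains w where "w \<in> carrier_mat 1 n" "w * M = l \<cdot>\<^sub>m w" "w * B = 1\<^sub>m 1"
    "\<And>k. char_poly (M + k \<cdot>\<^sub>m (B * w)) = (\<Prod>e\<leftarrow>es @ [l + k]. [:-e, 1:])"
proof -
  obtain T P Q where "schur_decomposition M (es @ [l]) = (T, P, Q)" by (metis prod_cases3)
  from schur_decomposition[OF M cp this]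
  have sim: "similar_mat_wit M T P Q" and ut: "upper_triangular T" and dg: "diag_mat T = es @ [l]"
    by auto
  note D = similar_mat_witD2[OF M sim]
  have T: "T \<in> carrier_mat n n" and P: "P \<in> carrier_mat n n" and Q: "Q \<in> carrier_mat n n"
    using D by auto
  have n: "n = Suc (length es)" using arg_cong[OF dg, of length] T by (simp add: diag_mat_def)
  have Tdiag: "T $$ (i, i) = (es @ [l]) ! i" if "i < n" for i
    using arg_cong[OF dg, of "\<lambda>xs. xs ! i"] that T by (simp add: diag_mat_def)
  define e :: "complex mat" where "e = mat 1 n (\<lambda>(_, j). if j = n - 1 then 1 else 0)"
  have e: "e \<in> carrier_mat 1 n" unfolding e_def by simp
  have e_mult: "(e * X) $$ (0, j) = X $$ (n - 1, j)"
    if X: "X \<in> carrier_mat n m" and j: "j < m" for X m j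
  proof -
    have "(e * X) $$ (0, j) = (\<Sum>i = 0..<n. (if i = n - 1 then 1 else 0) * X $$ (i, j))"
      using X j by (auto simp: e_def scalar_prod_def)
    also have "\<dots> = (\<Sum>i = 0..<n. if i = n - 1 then X $$ (i, j) else 0)"
      by (rule sum.cong) auto
    also have "\<dots> = X $$ (n - 1, j)" using n by (simp add: sum.delta)
    finally show ?thesis .
  qed
  have eT: "e * T = l \<cdot>\<^sub>m e"
  proof (rule eq_matI)
    fix i j assume ij: "i < dim_row (l \<cdot>\<^sub>m e)" "j < dim_col (l \<cdot>\<^sub>m e)"
    then have ij: "i = 0" "j < n" using e by auto
    have "T $$ (n - 1, j) = (if j = n - 1 then l else 0)"
    proof (cases "j = n - 1")
      case True
      then show ?thesis using Tdiag[of "n - 1"] n by (simp add: nth_append)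
    next
      case False
      then show ?thesis using ut ij n T unfolding upper_triangular_def by auto
    qed
    then show "(e * T) $$ (i, j) = (l \<cdot>\<^sub>m e) $$ (i, j)"
      using e_mult[OF T] ij e by (simp add: e_def)
  qed (use e T in auto)
  define w0 where "w0 = e * Q"
  have w0: "w0 \<in> carrier_mat 1 n" unfolding w0_def using e Q by simp
  have QM: "Q * M = T * Q"
  proof -
    have "Q * M = (Q * P) * (T * Q)" using D(3) T P Q by (simp add: mat_dim_simps)
    then show ?thesis using D(2) T Q by simp
  qed
  have w0M: "w0 * M = l \<cdot>\<^sub>m w0"
  proof -
    have "w0 * M = (e * T) * Q" unfolding w0_def using QM e Q M T by simp
    also have "\<dots> = l \<cdot>\<^sub>m w0" unfolding eT w0_def using e Q by (simp add: mat_dim_simps)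
    finally show ?thesis .
  qed
  have "w0 * P = e" unfolding w0_def using D(2) e Q P by simp
  moreover have "e $$ (0, n - 1) = 1" using n by (simp add: e_def)
  ultimately have w0_nz: "w0 \<noteq> 0\<^sub>m 1 n" using P n by auto
  define \<beta> where "\<beta> = (w0 * B) $$ (0, 0)"
  have w0B: "w0 * B = \<beta> \<cdot>\<^sub>m 1\<^sub>m 1"
    by (rule eq_matI) (use w0 B in \<open>auto simp: \<beta>_def simp del: index_mult_mat(1)\<close>)
  \<comment> \<open>Controllability is what permits the normalisation
    \<open>w * B = 1\<close>.\<close>
  have \<beta>: "\<beta> \<noteq> 0"
  proof
    assume "\<beta> = 0"
    then have "w0 * B = 0\<^sub>m 1 1" unfolding w0B by auto
    then show False using pbh w0 w0M w0_nz unfolding hautus_def by blast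
  qed
  define w where "w = (1 / \<beta>) \<cdot>\<^sub>m w0"
  have w: "w \<in> carrier_mat 1 n" unfolding w_def using w0 by simp
  have wM: "w * M = l \<cdot>\<^sub>m w"
    unfolding w_def using w0 M w0M by (auto simp: mat_dim_simps mult.commute intro!: eq_matI)
  have wB: "w * B = 1\<^sub>m 1"
    unfolding w_def using w0 B w0B \<beta> by (auto simp: mat_dim_simps intro!: eq_matI)
  have "char_poly (M + k \<cdot>\<^sub>m (B * w)) = (\<Prod>e\<leftarrow>es @ [l + k]. [:-e, 1:])" for k
  proof -
    define R where "R = Q * B * e"
    have R: "R \<in> carrier_mat n n" unfolding R_def using Q B e by auto
    have QB: "Q * B \<in> carrier_mat n 1" using Q B by simp
    have R_ij: "R $$ (i, j) = (if j = n - 1 then (Q * B) $$ (i, 0) else 0)"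
      if "i < n" "j < n" for i j
    proof -
      have "R $$ (i, j) = (Q * B) $$ (i, 0) * e $$ (0, j)"
        unfolding R_def by (rule index_outer_prod_mat[OF QB e that])
      then show ?thesis using that by (simp add: e_def del: index_mult_mat(1))
    qed
    have QBn: "(Q * B) $$ (n - 1, 0) = \<beta>"
      using e_mult[OF QB, of 0] e Q B unfolding \<beta>_def w0_def by (simp del: index_mult_mat(1))
    define T' where "T' = T + (k / \<beta>) \<cdot>\<^sub>m R"
    have T': "T' \<in> carrier_mat n n" unfolding T'_def using T R by simp
    have "P * R * Q = B * w0"
    proof -
      have "P * R * Q = (P * Q) * (B * w0)"
        unfolding R_def w0_def using P Q B e by (simp add: mat_dim_simps)
      then show ?thesis using D(1) B w0 by simp
    qed
    then have "M + k \<cdot>\<^sub>m (B * w) = P * T' * Q"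
      unfolding T'_def w_def using D(3) P Q T R B w0
      by (auto simp: mat_dim_simps simp del: index_mult_mat(1) intro!: eq_matI)
    moreover have "M + k \<cdot>\<^sub>m (B * w) \<in> carrier_mat n n" using M B w by auto
    ultimately have "similar_mat_wit (M + k \<cdot>\<^sub>m (B * w)) T' P Q"
      using D(1,2) P Q T' by (auto intro: similar_mat_witI)
    then have "char_poly (M + k \<cdot>\<^sub>m (B * w)) = char_poly T'"
      by (intro char_poly_similar) (auto simp: similar_mat_def)
    also have "\<dots> = (\<Prod>e\<leftarrow>diag_mat T'. [:-e, 1:])"
    proof (rule char_poly_upper_triangular[OF T'])
      show "upper_triangular T'"
        using ut T R R_ij unfolding upper_triangular_def T'_def by auto
    qed
    also have "diag_mat T' = es @ [l + k]"
    proof (rule nth_equalityI)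
      show "length (diag_mat T') = length (es @ [l + k])" using T' n by (simp add: diag_mat_def)
      fix i assume "i < length (diag_mat T')"
      then have i: "i < n" using T' by (simp add: diag_mat_def)
      have "diag_mat T' ! i = (es @ [l]) ! i + (k / \<beta>) * (if i = n - 1 then (Q * B) $$ (i, 0) else 0)"
        using i T T' R R_ij Tdiag unfolding diag_mat_def T'_def by (simp del: index_mult_mat(1))
      then show "diag_mat T' ! i = (es @ [l + k]) ! i"
        using i n \<beta> QBn by (auto simp: nth_append less_Suc_eq simp del: index_mult_mat(1) split: if_splits)
    qed
    finally show ?thesis .
  qed
  then show ?thesis using that[OF w wM wB] by blast
qed

text \<open>With \<open>F = M + B * K\<close> the three equations are the energy balance
  \<open>|y|^2 + x'^H P x' = x^H P x + (1 + \<beta>) |u|^2\<close> of the system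
  \<open>x' = F x + B u\<close>, \<open>y = K x + u\<close>: it is all-pass with squared gain
  \<open>1 + \<beta>\<close>. Eliminating \<open>K\<close> yields the Riccati equation of
  minimum-energy stabilisation, with input weight 1 and state weight 0.\<close>

definition inner_pair ::
  "nat \<Rightarrow> complex mat \<Rightarrow> complex mat \<Rightarrow> complex mat \<Rightarrow> complex mat \<Rightarrow> real \<Rightarrow> bool" where
  "inner_pair n M B K P \<beta> \<longleftrightarrow>
     K \<in> carrier_mat 1 n \<and> P \<in> carrier_mat n n \<and> mat_adjoint P = P \<and>
     (\<forall>v \<in> carrier_mat n 1. 0 \<le> Re ((mat_adjoint v * P * v) $$ (0, 0))) \<and>
     mat_adjoint (M + B * K) * P * (M + B * K) + mat_adjoint K * K = P \<and>
     mat_adjoint (M + B * K) * P * B + mat_adjoint K = 0\<^sub>m n 1 \<and>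
     mat_adjoint B * P * B = complex_of_real \<beta> \<cdot>\<^sub>m 1\<^sub>m 1"

text \<open>In the energy balances, the output \<open>K\<^sub>2 x + u\<close> of the second system
  is the input of the first. Multiplying the second balance by \<open>1 + \<beta>\<^sub>1\<close>
  and adding the first eliminates this signal; hence the weight of \<open>P\<^sub>2\<close> and the
  product of the gains.\<close>

lemma inner_pair_cascade:
  assumes M: "M \<in> carrier_mat n n" and B: "B \<in> carrier_mat n 1"
    and 1: "inner_pair n M B K\<^sub>1 P\<^sub>1 \<beta>\<^sub>1" and \<beta>\<^sub>1: "\<beta>\<^sub>1 \<ge> 0"
    and 2: "inner_pair n (M + B * K\<^sub>1) B K\<^sub>2 P\<^sub>2 \<beta>\<^sub>2"
  shows "inner_pair n M B (K\<^sub>1 + K\<^sub>2) (P\<^sub>1 + complex_of_real (1 + \<beta>\<^sub>1) \<cdot>\<^sub>m P\<^sub>2) ((1 + \<beta>\<^sub>1) * (1 + \<beta>\<^sub>2) - 1)"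
proof -
  have K1: "K\<^sub>1 \<in> carrier_mat 1 n" and P1: "P\<^sub>1 \<in> carrier_mat n n" and H1: "mat_adjoint P\<^sub>1 = P\<^sub>1"
    and K2: "K\<^sub>2 \<in> carrier_mat 1 n" and P2: "P\<^sub>2 \<in> carrier_mat n n" and H2: "mat_adjoint P\<^sub>2 = P\<^sub>2"
    using 1 2 unfolding inner_pair_def by auto
  define F1 where "F1 = M + B * K\<^sub>1"
  define F2 where "F2 = F1 + B * K\<^sub>2"
  define P where "P = P\<^sub>1 + complex_of_real (1 + \<beta>\<^sub>1) \<cdot>\<^sub>m P\<^sub>2"
  have F1: "F1 \<in> carrier_mat n n" unfolding F1_def using M B K1 by auto
  have F2: "F2 \<in> carrier_mat n n" unfolding F2_def using F1 B K2 by auto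
  have P: "P \<in> carrier_mat n n" unfolding P_def using P1 P2 by auto
  have "F2 = M + B * (K\<^sub>1 + K\<^sub>2)" unfolding F2_def F1_def
    using M B K1 K2 by (auto simp: mat_dim_simps simp del: index_mult_mat(1) intro!: eq_matI)
  have eq1: "mat_adjoint F1 * (P\<^sub>1 * F1) + mat_adjoint K\<^sub>1 * K\<^sub>1 = P\<^sub>1"
    and eq2: "mat_adjoint F2 * (P\<^sub>2 * F2) + mat_adjoint K\<^sub>2 * K\<^sub>2 = P\<^sub>2"
    and ort1: "mat_adjoint F1 * (P\<^sub>1 * B) + mat_adjoint K\<^sub>1 = 0\<^sub>m n 1"
    and ort2: "mat_adjoint F2 * (P\<^sub>2 * B) + mat_adjoint K\<^sub>2 = 0\<^sub>m n 1"
    and g1: "mat_adjoint B * (P\<^sub>1 * B) = complex_of_real \<beta>\<^sub>1 \<cdot>\<^sub>m 1\<^sub>m 1"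
    and g2: "mat_adjoint B * (P\<^sub>2 * B) = complex_of_real \<beta>\<^sub>2 \<cdot>\<^sub>m 1\<^sub>m 1"
    using 1 2 F1 F2 P1 P2 B unfolding inner_pair_def F1_def[symmetric] F2_def[symmetric]
    by (simp_all add: mat_dim_simps)
  have neg: "X = (-1) \<cdot>\<^sub>m Y"
    if "X + Y = 0\<^sub>m n m" "X \<in> carrier_mat n m" "Y \<in> carrier_mat n m" for X Y :: "complex mat" and m
  proof (rule eq_matI)
    fix i j assume "i < dim_row ((-1) \<cdot>\<^sub>m Y)" "j < dim_col ((-1) \<cdot>\<^sub>m Y)"
    then have ij: "i < n" "j < m" using that(3) by auto
    then have "X $$ (i, j) + Y $$ (i, j) = (X + Y) $$ (i, j)" using that(2,3) by simp
    also have "\<dots> = 0" unfolding that(1) using ij by simp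
    finally show "X $$ (i, j) = ((-1) \<cdot>\<^sub>m Y) $$ (i, j)"
      using ij that(3) by (simp add: eq_neg_iff_add_eq_0)
  qed (use that in auto)
  have ort1': "mat_adjoint F1 * (P\<^sub>1 * B) = (-1) \<cdot>\<^sub>m mat_adjoint K\<^sub>1"
    by (rule neg[OF ort1]) (use F1 P1 B K1 in auto)
  have ort1'': "mat_adjoint B * (P\<^sub>1 * F1) = (-1) \<cdot>\<^sub>m K\<^sub>1"
    using arg_cong[OF ort1', of mat_adjoint] F1 P1 B H1 by (simp add: mat_adjoint_simps mat_dim_simps)
  have ort2': "mat_adjoint F2 * (P\<^sub>2 * B) = (-1) \<cdot>\<^sub>m mat_adjoint K\<^sub>2"
    by (rule neg[OF ort2]) (use F2 P2 B K2 in auto)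
  have "mat_adjoint F2 * (P\<^sub>1 * F2) = mat_adjoint F1 * (P\<^sub>1 * F1)
      + (mat_adjoint F1 * (P\<^sub>1 * B)) * K\<^sub>2 + mat_adjoint K\<^sub>2 * (mat_adjoint B * (P\<^sub>1 * F1))
      + mat_adjoint K\<^sub>2 * ((mat_adjoint B * (P\<^sub>1 * B)) * K\<^sub>2)"
    unfolding F2_def using F1 P1 B K2
    by (auto simp: mat_adjoint_simps mat_dim_simps simp del: index_mult_mat(1) intro!: eq_matI)
  also have "\<dots> = mat_adjoint F1 * (P\<^sub>1 * F1) + (-1) \<cdot>\<^sub>m (mat_adjoint K\<^sub>1 * K\<^sub>2)
      + (-1) \<cdot>\<^sub>m (mat_adjoint K\<^sub>2 * K\<^sub>1) + complex_of_real \<beta>\<^sub>1 \<cdot>\<^sub>m (mat_adjoint K\<^sub>2 * K\<^sub>2)"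
    unfolding ort1' ort1'' g1 using K1 K2 by (simp add: mat_dim_simps)
  finally have F2P1: "mat_adjoint F2 * (P\<^sub>1 * F2) = \<dots>" .
  have K: "mat_adjoint (K\<^sub>1 + K\<^sub>2) * (K\<^sub>1 + K\<^sub>2) = mat_adjoint K\<^sub>1 * K\<^sub>1 + mat_adjoint K\<^sub>1 * K\<^sub>2
      + mat_adjoint K\<^sub>2 * K\<^sub>1 + mat_adjoint K\<^sub>2 * K\<^sub>2"
    using K1 K2
    by (auto simp: mat_adjoint_simps mat_dim_simps simp del: index_mult_mat(1) intro!: eq_matI)
  have stein: "mat_adjoint F2 * P * F2 + mat_adjoint (K\<^sub>1 + K\<^sub>2) * (K\<^sub>1 + K\<^sub>2) = P"
  proof -
    have "mat_adjoint F2 * P * F2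
        = mat_adjoint F2 * (P\<^sub>1 * F2) + complex_of_real (1 + \<beta>\<^sub>1) \<cdot>\<^sub>m (mat_adjoint F2 * (P\<^sub>2 * F2))"
      unfolding P_def using F2 P1 P2 by (simp add: mat_dim_simps)
    \<comment> \<open>The mixed products of \<open>K\<^sub>1\<close> and \<open>K\<^sub>2\<close>
      cancel, and \<open>1 + \<beta>\<^sub>1\<close> copies of the square of
      \<open>K\<^sub>2\<close> remain.\<close>
    also have "\<dots> + mat_adjoint (K\<^sub>1 + K\<^sub>2) * (K\<^sub>1 + K\<^sub>2)
        = (mat_adjoint F1 * (P\<^sub>1 * F1) + mat_adjoint K\<^sub>1 * K\<^sub>1) + complex_of_real (1 + \<beta>\<^sub>1) \<cdot>\<^sub>m
          (mat_adjoint F2 * (P\<^sub>2 * F2) + mat_adjoint K\<^sub>2 * K\<^sub>2)"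
      unfolding F2P1 K using F1 F2 P1 P2 K1 K2
      by (intro eq_matI) (auto simp: algebra_simps simp del: index_mult_mat(1))
    finally show ?thesis unfolding eq1 eq2 P_def .
  qed
  have orth: "mat_adjoint F2 * P * B + mat_adjoint (K\<^sub>1 + K\<^sub>2) = 0\<^sub>m n 1"
  proof -
    have "mat_adjoint F2 * P * B = mat_adjoint F1 * (P\<^sub>1 * B) + mat_adjoint K\<^sub>2 * (mat_adjoint B * (P\<^sub>1 * B))
       + complex_of_real (1 + \<beta>\<^sub>1) \<cdot>\<^sub>m (mat_adjoint F2 * (P\<^sub>2 * B))"
      unfolding P_def using F1 F2 P1 P2 B K2
      by (simp add: mat_dim_simps F2_def[THEN arg_cong, of "\<lambda>X. mat_adjoint X * (P\<^sub>1 * B)"] mat_adjoint_simps)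
    then show ?thesis unfolding ort1' ort2' g1 using K1 K2
      by (intro eq_matI) (auto simp: mat_dim_simps mat_adjoint_simps algebra_simps simp del: index_mult_mat(1))
  qed
  have gram: "mat_adjoint B * P * B = complex_of_real ((1 + \<beta>\<^sub>1) * (1 + \<beta>\<^sub>2) - 1) \<cdot>\<^sub>m 1\<^sub>m 1"
  proof -
    have "mat_adjoint B * P * B = mat_adjoint B * (P\<^sub>1 * B) + complex_of_real (1 + \<beta>\<^sub>1) \<cdot>\<^sub>m (mat_adjoint B * (P\<^sub>2 * B))"
      unfolding P_def using P1 P2 B by (simp add: mat_dim_simps)
    then show ?thesis unfolding g1 g2 by (intro eq_matI) (auto simp: algebra_simps)
  qed
  have psd: "0 \<le> Re ((mat_adjoint v * P * v) $$ (0, 0))" if v: "v \<in> carrier_mat n 1" for v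
  proof -
    have "mat_adjoint v * P * v = mat_adjoint v * P\<^sub>1 * v + complex_of_real (1 + \<beta>\<^sub>1) \<cdot>\<^sub>m (mat_adjoint v * P\<^sub>2 * v)"
      unfolding P_def using P1 P2 v by (simp add: mat_dim_simps)
    then have "Re ((mat_adjoint v * P * v) $$ (0, 0)) = Re ((mat_adjoint v * P\<^sub>1 * v) $$ (0, 0))
        + (1 + \<beta>\<^sub>1) * Re ((mat_adjoint v * P\<^sub>2 * v) $$ (0, 0))"
      using v by (simp del: index_mult_mat(1))
    moreover have "0 \<le> Re ((mat_adjoint v * P\<^sub>1 * v) $$ (0, 0))" "0 \<le> Re ((mat_adjoint v * P\<^sub>2 * v) $$ (0, 0))"
      using 1 2 v unfolding inner_pair_def by auto
    ultimately show ?thesis using \<beta>\<^sub>1 by (simp del: index_mult_mat(1))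
  qed
  have "mat_adjoint P = P" unfolding P_def using P1 P2 H1 H2 by (simp add: mat_adjoint_simps)
  then show ?thesis
    unfolding inner_pair_def P_def[symmetric] \<open>F2 = M + B * (K\<^sub>1 + K\<^sub>2)\<close>[symmetric]
    using K1 K2 P stein orth gram psd by auto
qed

text \<open>Because \<open>w * B = 1\<close>, the closed loop has \<open>w\<close> as left
  eigenvector for \<open>1 / cnj l\<close>, and every relation collapses to a scalar one. The weight
  \<rho> of \<open>P\<close> is dictated by the orthogonality relation
  \<open>\<rho> / l + cnj k = 0\<close>; it is nonnegative since \<open>l\<close> lies outside the
  unit disk.\<close>

lemma inner_pair_single:
  assumes w: "w \<in> carrier_mat 1 n" and M: "M \<in> carrier_mat n n" and B: "B \<in> carrier_mat n 1"
    and wM: "w * M = l \<cdot>\<^sub>m w" and wB: "w * B = 1\<^sub>m 1" and l: "1 < cmod l"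
  shows "inner_pair n M B ((1 / cnj l - l) \<cdot>\<^sub>m w)
    (complex_of_real ((cmod l)\<^sup>2 - 1) \<cdot>\<^sub>m (mat_adjoint w * w)) ((cmod l)\<^sup>2 - 1)"
proof -
  define k where "k = 1 / cnj l - l"
  define \<rho> where "\<rho> = (cmod l)\<^sup>2 - 1"
  define F where "F = M + B * (k \<cdot>\<^sub>m w)"
  define P where "P = complex_of_real \<rho> \<cdot>\<^sub>m (mat_adjoint w * w)"
  have l0: "l \<noteq> 0" using l by auto
  have \<rho>: "0 \<le> \<rho>" unfolding \<rho>_def using l by (simp add: one_le_power)
  have \<rho>_eq: "complex_of_real \<rho> = l * cnj l - 1" unfolding \<rho>_def by (simp flip: complex_norm_square)
  have F: "F \<in> carrier_mat n n" unfolding F_def using M B w by auto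
  have P: "P \<in> carrier_mat n n" unfolding P_def using w by auto
  have "w * F = w * M + k \<cdot>\<^sub>m ((w * B) * w)" unfolding F_def using w M B by (simp add: mat_dim_simps)
  also have "\<dots> = (1 / cnj l) \<cdot>\<^sub>m w" unfolding wM wB k_def using w
    by (intro eq_matI) (auto simp: algebra_simps)
  finally have wF: "w * F = (1 / cnj l) \<cdot>\<^sub>m w" .
  have Fw: "mat_adjoint F * mat_adjoint w = (1 / l) \<cdot>\<^sub>m mat_adjoint w"
    using arg_cong[OF wF, of mat_adjoint] w F by (simp add: mat_adjoint_simps)
  have Bw: "mat_adjoint B * mat_adjoint w = 1\<^sub>m 1"
    using arg_cong[OF wB, of mat_adjoint] w B by (auto simp: mat_adjoint_simps intro!: eq_matI)
  have "mat_adjoint F * P * F = complex_of_real \<rho> \<cdot>\<^sub>m ((mat_adjoint F * mat_adjoint w) * (w * F))"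
    unfolding P_def using w F by (simp add: mat_dim_simps)
  also have "\<dots> = (complex_of_real \<rho> * (1 / l) * (1 / cnj l)) \<cdot>\<^sub>m (mat_adjoint w * w)"
    unfolding Fw wF using w by (intro eq_matI) (auto simp: mat_dim_simps simp del: index_mult_mat(1))
  finally have FPF: "mat_adjoint F * P * F = \<dots>" .
  have "mat_adjoint F * P * F + mat_adjoint (k \<cdot>\<^sub>m w) * (k \<cdot>\<^sub>m w)
     = (complex_of_real \<rho> * (1 / l) * (1 / cnj l) + k * cnj k) \<cdot>\<^sub>m (mat_adjoint w * w)"
    unfolding FPF using w
    by (intro eq_matI) (auto simp: mat_adjoint_simps mat_dim_simps algebra_simps simp del: index_mult_mat(1))
  also have "complex_of_real \<rho> * (1 / l) * (1 / cnj l) + k * cnj k = complex_of_real \<rho>"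
    unfolding \<rho>_eq k_def using l0 by (simp add: field_simps)
  finally have stein: "mat_adjoint F * P * F + mat_adjoint (k \<cdot>\<^sub>m w) * (k \<cdot>\<^sub>m w) = P"
    unfolding P_def .
  have "mat_adjoint F * P * B = complex_of_real \<rho> \<cdot>\<^sub>m ((mat_adjoint F * mat_adjoint w) * (w * B))"
    unfolding P_def using w F B by (simp add: mat_dim_simps)
  also have "\<dots> = (complex_of_real \<rho> * (1 / l)) \<cdot>\<^sub>m mat_adjoint w"
    unfolding Fw wB using w by (intro eq_matI) (auto simp: mat_dim_simps)
  also have "\<dots> + mat_adjoint (k \<cdot>\<^sub>m w) = (complex_of_real \<rho> * (1 / l) + cnj k) \<cdot>\<^sub>m mat_adjoint w"
    using w by (intro eq_matI) (auto simp: mat_adjoint_simps algebra_simps)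
  also have "complex_of_real \<rho> * (1 / l) + cnj k = 0" unfolding \<rho>_eq k_def using l0 by (simp add: field_simps)
  finally have orth: "mat_adjoint F * P * B + mat_adjoint (k \<cdot>\<^sub>m w) = 0\<^sub>m n 1"
    using w by (auto intro!: eq_matI)
  have "mat_adjoint B * P * B = complex_of_real \<rho> \<cdot>\<^sub>m ((mat_adjoint B * mat_adjoint w) * (w * B))"
    unfolding P_def using w B by (simp add: mat_dim_simps)
  then have gram: "mat_adjoint B * P * B = complex_of_real \<rho> \<cdot>\<^sub>m 1\<^sub>m 1" unfolding Bw wB by simp
  have psd: "0 \<le> Re ((mat_adjoint v * P * v) $$ (0, 0))" if v: "v \<in> carrier_mat n 1" for v
  proof -
    have wv: "w * v \<in> carrier_mat 1 1" using w v by auto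
    have "mat_adjoint v * P * v = complex_of_real \<rho> \<cdot>\<^sub>m (mat_adjoint (w * v) * (w * v))"
      unfolding P_def using w v by (simp add: mat_dim_simps mat_adjoint_simps)
    also have "(\<dots>) $$ (0, 0) = complex_of_real \<rho> * (cnj ((w * v) $$ (0, 0)) * (w * v) $$ (0, 0))"
      using wv index_outer_prod_mat[OF mat_adjoint_carrier[OF wv] wv, of 0 0] v w
      by (simp del: index_mult_mat(1))
    also have "\<dots> = complex_of_real (\<rho> * (cmod ((w * v) $$ (0, 0)))\<^sup>2)"
      unfolding of_real_mult complex_norm_square by (simp add: mult.commute)
    finally have "Re ((mat_adjoint v * P * v) $$ (0, 0)) = \<rho> * (cmod ((w * v) $$ (0, 0)))\<^sup>2"
      by (simp only: Re_complex_of_real)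
    then show ?thesis using \<rho> by (simp del: index_mult_mat(1))
  qed
  have "mat_adjoint P = P" unfolding P_def using w by (simp add: mat_adjoint_simps)
  then show ?thesis
    unfolding inner_pair_def \<rho>_def[symmetric] k_def[symmetric] P_def[symmetric] F_def[symmetric]
    using w P stein orth gram psd by auto
qed

text \<open>Each reflected eigenvalue leaves \<open>us\<close> and joins the list \<open>ss\<close>
  of the next closed loop, so the induction generalises over \<open>ss\<close> along with
  \<open>M\<close>. The characteristic polynomial is carried along because the next eigenvalue must
  belong to the current closed loop, and because it later certifies stability.\<close>

lemma inner_pair_exists:
  assumes "M \<in> carrier_mat n n" and B: "B \<in> carrier_mat n 1" and "hautus n M B"
    and "char_poly M = (\<Prod>e\<leftarrow>ss @ us. [:-e, 1:])" and "\<forall>l \<in> set us. 1 < cmod l"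
  shows "\<exists>K P. inner_pair n M B K P ((\<Prod>l\<leftarrow>us. (cmod l)\<^sup>2) - 1) \<and>
    char_poly (M + B * K) = (\<Prod>e\<leftarrow>ss @ map (\<lambda>l. 1 / cnj l) us. [:-e, 1:])"
  using assms
proof (induction us arbitrary: M ss)
  case Nil
  have "inner_pair n M B (0\<^sub>m 1 n) (0\<^sub>m n n) 0"
    unfolding inner_pair_def using Nil(1,2)
    by (auto intro!: eq_matI)
  moreover have "M + B * 0\<^sub>m 1 n = M" using Nil(1,2) by auto
  ultimately show ?case using Nil by (intro exI[of _ "0\<^sub>m 1 n"] exI[of _ "0\<^sub>m n n"]) auto
next
  case (Cons l us)
  note M = Cons.prems(1)
  have l: "1 < cmod l" using Cons.prems by simp
  have cp: "char_poly M = (\<Prod>e\<leftarrow>(ss @ us) @ [l]. [:-e, 1:])"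
    unfolding Cons.prems(4) by (simp add: mult_ac)
  obtain w where w: "w \<in> carrier_mat 1 n" "w * M = l \<cdot>\<^sub>m w" "w * B = 1\<^sub>m 1"
    and cpk: "\<And>k. char_poly (M + k \<cdot>\<^sub>m (B * w)) = (\<Prod>e\<leftarrow>(ss @ us) @ [l + k]. [:-e, 1:])"
    using left_eigenvector_shift[OF M B cp Cons.prems(3)] by blast
  define K\<^sub>1 where "K\<^sub>1 = (1 / cnj l - l) \<cdot>\<^sub>m w"
  have K1: "K\<^sub>1 \<in> carrier_mat 1 n" unfolding K\<^sub>1_def using w by simp
  have F1: "M + B * K\<^sub>1 \<in> carrier_mat n n" using M B K1 by auto
  have BK: "B * K\<^sub>1 = (1 / cnj l - l) \<cdot>\<^sub>m (B * w)" unfolding K\<^sub>1_def using B w by (simp add: mat_dim_simps)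
  have "char_poly (M + B * K\<^sub>1) = (\<Prod>e\<leftarrow>(ss @ [1 / cnj l]) @ us. [:-e, 1:])"
    unfolding BK cpk by (simp add: mult_ac)
  from Cons.IH[OF F1 B hautus_feedback[OF Cons.prems(3) M B K1] this] Cons.prems(5)
  obtain K\<^sub>2 P\<^sub>2 where 2: "inner_pair n (M + B * K\<^sub>1) B K\<^sub>2 P\<^sub>2 ((\<Prod>l\<leftarrow>us. (cmod l)\<^sup>2) - 1)"
    and cp2: "char_poly (M + B * K\<^sub>1 + B * K\<^sub>2)
      = (\<Prod>e\<leftarrow>(ss @ [1 / cnj l]) @ map (\<lambda>l. 1 / cnj l) us. [:-e, 1:])"
    by auto
  have K2: "K\<^sub>2 \<in> carrier_mat 1 n" using 2 unfolding inner_pair_def by simp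
  have "M + B * (K\<^sub>1 + K\<^sub>2) = M + B * K\<^sub>1 + B * K\<^sub>2"
    using M B K1 K2 by (auto simp: mat_dim_simps simp del: index_mult_mat(1) intro!: eq_matI)
  with cp2 have cp': "char_poly (M + B * (K\<^sub>1 + K\<^sub>2))
      = (\<Prod>e\<leftarrow>ss @ map (\<lambda>l. 1 / cnj l) (l # us). [:-e, 1:])"
    by simp
  have "0 \<le> (cmod l)\<^sup>2 - 1" using l by (simp add: one_le_power)
  from inner_pair_cascade[OF M B inner_pair_single[OF w(1) M B w(2,3) l, folded K\<^sub>1_def] this 2] cp'
  show ?case by fastforce
qed

section \<open>Uniqueness of the stabilising solution\<close>

text \<open>Iterating the equation gives \<open>D = (F^k)^H D G^k\<close> for every
  \<open>k\<close>, and the right side tends to 0 entrywise.\<close>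

lemma stein_fixpoint_eq_0:
  fixes D F G :: "complex mat"
  assumes D: "D \<in> carrier_mat n n" and F: "F \<in> carrier_mat n n" and G: "G \<in> carrier_mat n n"
    and stein: "mat_adjoint F * (D * G) = D"
    and F0: "\<And>i j. i < n \<Longrightarrow> j < n \<Longrightarrow> (\<lambda>k. (F ^\<^sub>m k) $$ (i, j)) \<longlonglongrightarrow> 0"
    and G0: "\<And>i j. i < n \<Longrightarrow> j < n \<Longrightarrow> (\<lambda>k. (G ^\<^sub>m k) $$ (i, j)) \<longlonglongrightarrow> 0"
  shows "D = 0\<^sub>m n n"
proof (rule eq_matI)
  fix i j assume "i < dim_row (0\<^sub>m n n :: complex mat)" "j < dim_col (0\<^sub>m n n :: complex mat)"
  then have ij: "i < n" "j < n" by auto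
  have Fk: "F ^\<^sub>m k \<in> carrier_mat n n" and Gk: "G ^\<^sub>m k \<in> carrier_mat n n" for k
    using F G by auto
  have iter: "mat_adjoint (F ^\<^sub>m k) * (D * G ^\<^sub>m k) = D" for k
  proof (induction k)
    case 0
    have "mat_adjoint (1\<^sub>m n :: complex mat) = 1\<^sub>m n" by (rule eq_matI) auto
    then show ?case using D F G by simp
  next
    case (Suc k)
    have "mat_adjoint (F ^\<^sub>m Suc k) * (D * G ^\<^sub>m Suc k)
        = mat_adjoint F * ((mat_adjoint (F ^\<^sub>m k) * (D * G ^\<^sub>m k)) * G)"
      using D F G carrier_matD[OF Fk[of k]] carrier_matD[OF Gk[of k]]
      by (simp add: mat_adjoint_simps mat_dim_simps)
    then show ?case unfolding Suc stein .
  qed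
  have "D $$ (i, j) = (\<Sum>p<n. cnj ((F ^\<^sub>m k) $$ (p, i)) * (\<Sum>q<n. D $$ (p, q) * (G ^\<^sub>m k) $$ (q, j)))" for k
  proof -
    have "D $$ (i, j) = (mat_adjoint (F ^\<^sub>m k) * (D * G ^\<^sub>m k)) $$ (i, j)" unfolding iter ..
    also have "\<dots> = (\<Sum>p<n. cnj ((F ^\<^sub>m k) $$ (p, i)) * (\<Sum>q<n. D $$ (p, q) * (G ^\<^sub>m k) $$ (q, j)))"
      using ij D carrier_matD[OF Fk[of k]] carrier_matD[OF Gk[of k]]
      by (auto simp: scalar_prod_def lessThan_atLeast0 intro!: sum.cong)
    finally show ?thesis .
  qed
  moreover have "(\<lambda>k. \<Sum>p<n. cnj ((F ^\<^sub>m k) $$ (p, i)) * (\<Sum>q<n. D $$ (p, q) * (G ^\<^sub>m k) $$ (q, j)))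
      \<longlonglongrightarrow> (\<Sum>p<n. cnj 0 * (\<Sum>q<n. D $$ (p, q) * 0))"
    by (intro tendsto_intros F0 G0) (use ij in auto)
  ultimately have "(\<lambda>k. D $$ (i, j)) \<longlonglongrightarrow> 0" by simp
  then show "D $$ (i, j) = 0\<^sub>m n n $$ (i, j)" using ij by (simp add: LIMSEQ_const_iff)
qed (use D in auto)

text \<open>Exchanging the right closed loop adds \<open>B * (K\<^sub>2 - K\<^sub>1)\<close>, which
  by orthogonality contributes \<open>- K\<^sub>1^H (K\<^sub>2 - K\<^sub>1)\<close>; the square of
  \<open>K\<^sub>1\<close> then cancels against the Stein equation.\<close>

lemma inner_pair_cross:
  assumes M: "M \<in> carrier_mat n n" and B: "B \<in> carrier_mat n 1"
    and 1: "inner_pair n M B K\<^sub>1 P\<^sub>1 \<beta>\<^sub>1" and K2: "K\<^sub>2 \<in> carrier_mat 1 n"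
  shows "mat_adjoint (M + B * K\<^sub>1) * (P\<^sub>1 * (M + B * K\<^sub>2)) = P\<^sub>1 - mat_adjoint K\<^sub>1 * K\<^sub>2"
proof -
  define F where "F = M + B * K\<^sub>1"
  have K1: "K\<^sub>1 \<in> carrier_mat 1 n" and P1: "P\<^sub>1 \<in> carrier_mat n n"
    using 1 unfolding inner_pair_def by auto
  have F: "F \<in> carrier_mat n n" unfolding F_def using M B K1 by auto
  have stein: "mat_adjoint F * (P\<^sub>1 * F) + mat_adjoint K\<^sub>1 * K\<^sub>1 = P\<^sub>1"
    and orth: "mat_adjoint F * (P\<^sub>1 * B) + mat_adjoint K\<^sub>1 = 0\<^sub>m n 1"
    using 1 F P1 B unfolding inner_pair_def F_def[symmetric] by (simp_all add: mat_dim_simps)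
  have orth': "(mat_adjoint F * (P\<^sub>1 * B) + mat_adjoint K\<^sub>1) * X = 0\<^sub>m n n"
    if "X \<in> carrier_mat 1 n" for X unfolding orth using that by auto
  \<comment> \<open>The summands containing the orthogonality expression are zero. Including them
    makes this a formal identity that can be checked entrywise.\<close>
  have "mat_adjoint F * (P\<^sub>1 * (M + B * K\<^sub>2)) + (mat_adjoint F * (P\<^sub>1 * B) + mat_adjoint K\<^sub>1) * K\<^sub>1
     = (mat_adjoint F * (P\<^sub>1 * F) + mat_adjoint K\<^sub>1 * K\<^sub>1) - mat_adjoint K\<^sub>1 * K\<^sub>2
       + (mat_adjoint F * (P\<^sub>1 * B) + mat_adjoint K\<^sub>1) * K\<^sub>2"
    using F_def[THEN arg_cong, of "\<lambda>X. mat_adjoint F * (P\<^sub>1 * X)"] M B K1 K2 P1 F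
    by (intro eq_matI) (auto simp: mat_dim_simps simp del: index_mult_mat(1))
  moreover have "mat_adjoint F * (P\<^sub>1 * (M + B * K\<^sub>2)) \<in> carrier_mat n n"
    "P\<^sub>1 - mat_adjoint K\<^sub>1 * K\<^sub>2 \<in> carrier_mat n n"
    using M B K1 K2 P1 F by (auto intro!: mult_carrier_mat minus_carrier_mat)
  ultimately show ?thesis
    unfolding F_def[symmetric] orth'[OF K1] orth'[OF K2] stein by simp
qed

text \<open>The cross equation of the first pair and the adjoint of that of the second contain the
  same term \<open>K\<^sub>1^H K\<^sub>2\<close>. Their difference is a homogeneous Stein equation
  for \<open>P\<^sub>1 - P\<^sub>2\<close> between two stable closed loops.\<close>

lemma inner_pair_unique:
  assumes M: "M \<in> carrier_mat n n" and B: "B \<in> carrier_mat n 1"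
    and 1: "inner_pair n M B K\<^sub>1 P\<^sub>1 \<beta>\<^sub>1" and 2: "inner_pair n M B K\<^sub>2 P\<^sub>2 \<beta>\<^sub>2"
    and F1: "\<And>i j. i < n \<Longrightarrow> j < n \<Longrightarrow> (\<lambda>k. ((M + B * K\<^sub>1) ^\<^sub>m k) $$ (i, j)) \<longlonglongrightarrow> 0"
    and F2: "\<And>i j. i < n \<Longrightarrow> j < n \<Longrightarrow> (\<lambda>k. ((M + B * K\<^sub>2) ^\<^sub>m k) $$ (i, j)) \<longlonglongrightarrow> 0"
  shows "P\<^sub>1 = P\<^sub>2"
proof -
  have K1: "K\<^sub>1 \<in> carrier_mat 1 n" and P1: "P\<^sub>1 \<in> carrier_mat n n"
    and K2: "K\<^sub>2 \<in> carrier_mat 1 n" and P2: "P\<^sub>2 \<in> carrier_mat n n" and H2: "mat_adjoint P\<^sub>2 = P\<^sub>2"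
    using 1 2 unfolding inner_pair_def by auto
  define F where "F = M + B * K\<^sub>1"
  define G where "G = M + B * K\<^sub>2"
  have F: "F \<in> carrier_mat n n" and G: "G \<in> carrier_mat n n"
    unfolding F_def G_def using M B K1 K2 by auto
  have eq1: "mat_adjoint F * (P\<^sub>1 * G) = P\<^sub>1 - mat_adjoint K\<^sub>1 * K\<^sub>2"
    unfolding F_def G_def by (rule inner_pair_cross[OF M B 1 K2])
  have "mat_adjoint F * (P\<^sub>2 * G) = mat_adjoint (mat_adjoint G * (P\<^sub>2 * F))"
    using F G P2 H2 by (simp add: mat_adjoint_simps mat_dim_simps)
  also have "mat_adjoint G * (P\<^sub>2 * F) = P\<^sub>2 - mat_adjoint K\<^sub>2 * K\<^sub>1"
    unfolding F_def G_def by (rule inner_pair_cross[OF M B 2 K1])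
  also have "mat_adjoint \<dots> = mat_adjoint P\<^sub>2 - mat_adjoint (mat_adjoint K\<^sub>2 * K\<^sub>1)"
    using P2 K1 K2 by (intro eq_matI) (auto simp del: index_mult_mat(1))
  also have "\<dots> = P\<^sub>2 - mat_adjoint K\<^sub>1 * K\<^sub>2" unfolding H2 using K1 K2 by (simp add: mat_adjoint_simps)
  finally have eq2: "mat_adjoint F * (P\<^sub>2 * G) = \<dots>" .
  have "mat_adjoint F * ((P\<^sub>1 - P\<^sub>2) * G) = mat_adjoint F * (P\<^sub>1 * G) - mat_adjoint F * (P\<^sub>2 * G)"
    using F G P1 P2 by (simp add: mat_dim_simps)
  also have "\<dots> = P\<^sub>1 - P\<^sub>2" unfolding eq1 eq2 using P1 P2 K1 K2
    by (intro eq_matI) (auto simp del: index_mult_mat(1))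
  finally have D_stein: "mat_adjoint F * ((P\<^sub>1 - P\<^sub>2) * G) = P\<^sub>1 - P\<^sub>2" .
  have "P\<^sub>1 - P\<^sub>2 = 0\<^sub>m n n"
    by (rule stein_fixpoint_eq_0[OF _ F G D_stein])
      (use P1 P2 F1 F2 in \<open>auto simp: F_def G_def\<close>)
  then have eq0: "(P\<^sub>1 - P\<^sub>2) $$ (i, j) = 0" if "i < n" "j < n" for i j using that by simp
  show ?thesis by (rule eq_matI) (use eq0 P1 P2 in auto)
qed

section \<open>Complex conjugation and the descent to real matrices\<close>

lemma map_cnj_mult:
  "dim_col A = dim_row B \<Longrightarrow> map_mat cnj (A * B) = map_mat cnj A * map_mat cnj B"
  by (rule eq_matI) (auto simp: scalar_prod_def)

lemma map_cnj_adjoint: "map_mat cnj (mat_adjoint A) = mat_adjoint (map_mat cnj A)"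
  by (rule eq_matI) auto

lemma map_cnj_add:
  "dim_row A = dim_row B \<Longrightarrow> dim_col A = dim_col B \<Longrightarrow>
    map_mat cnj (A + B) = map_mat cnj A + map_mat cnj B"
  by (rule eq_matI) auto

lemma map_cnj_of_real [simp]: "map_mat cnj (map_mat complex_of_real A) = map_mat complex_of_real A"
  by (rule eq_matI) auto

lemma map_cnj_cnj [simp]: "map_mat cnj (map_mat cnj A) = A"
  by (rule eq_matI) auto

lemmas map_cnj_simps = map_cnj_mult map_cnj_adjoint map_cnj_add

lemma map_cnj_pow:
  assumes "A \<in> carrier_mat n n"
  shows "map_mat cnj (A ^\<^sub>m k) = map_mat cnj A ^\<^sub>m k"
proof (induction k)
  case 0
  show ?case using assms by (auto intro!: eq_matI)
next
  case (Suc k)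
  have "A ^\<^sub>m k \<in> carrier_mat n n" using assms by simp
  then show ?case using Suc assms by (simp add: map_cnj_mult)
qed

lemma inner_pair_cnj:
  assumes M: "M \<in> carrier_mat n n" and B: "B \<in> carrier_mat n 1"
    and Mr: "map_mat cnj M = M" and Br: "map_mat cnj B = B"
    and 1: "inner_pair n M B K P \<beta>"
  shows "inner_pair n M B (map_mat cnj K) (map_mat cnj P) \<beta>"
proof -
  have K: "K \<in> carrier_mat 1 n" and P: "P \<in> carrier_mat n n" and H: "mat_adjoint P = P"
    and psd: "\<And>v. v \<in> carrier_mat n 1 \<Longrightarrow> 0 \<le> Re ((mat_adjoint v * P * v) $$ (0, 0))"
    and stein: "mat_adjoint (M + B * K) * P * (M + B * K) + mat_adjoint K * K = P"
    and orth: "mat_adjoint (M + B * K) * P * B + mat_adjoint K = 0\<^sub>m n 1"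
    and gram: "mat_adjoint B * P * B = complex_of_real \<beta> \<cdot>\<^sub>m 1\<^sub>m 1"
    using 1 unfolding inner_pair_def by auto
  have F: "map_mat cnj (M + B * K) = M + B * map_mat cnj K"
    using M B K Mr Br by (simp add: map_cnj_simps)
  have "0 \<le> Re ((mat_adjoint v * map_mat cnj P * v) $$ (0, 0))" if v: "v \<in> carrier_mat n 1" for v
  proof -
    let ?v = "map_mat cnj v"
    have "mat_adjoint v * map_mat cnj P * v = map_mat cnj (mat_adjoint ?v * P * ?v)"
      using v P by (simp add: map_cnj_simps)
    then have "(mat_adjoint v * map_mat cnj P * v) $$ (0, 0) = cnj ((mat_adjoint ?v * P * ?v) $$ (0, 0))"
      using v by (simp del: index_mult_mat(1))
    then show ?thesis using psd[of ?v] v by (simp del: index_mult_mat(1))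
  qed
  moreover have "mat_adjoint (map_mat cnj P) = map_mat cnj P"
    using H by (simp flip: map_cnj_adjoint)
  moreover have "mat_adjoint (M + B * map_mat cnj K) * map_mat cnj P * (M + B * map_mat cnj K)
      + mat_adjoint (map_mat cnj K) * map_mat cnj K = map_mat cnj P"
    using arg_cong[OF stein, of "map_mat cnj"] M B K P unfolding F[symmetric]
    by (simp add: map_cnj_simps)
  moreover have "mat_adjoint (M + B * map_mat cnj K) * map_mat cnj P * B + mat_adjoint (map_mat cnj K) = 0\<^sub>m n 1"
  proof -
    have "map_mat cnj (mat_adjoint (M + B * K) * P * B + mat_adjoint K) = 0\<^sub>m n 1"
      unfolding orth by (rule eq_matI) auto
    then show ?thesis using M B K P Br unfolding F[symmetric] by (simp add: map_cnj_simps)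
  qed
  moreover have "mat_adjoint B * map_mat cnj P * B = complex_of_real \<beta> \<cdot>\<^sub>m 1\<^sub>m 1"
  proof -
    have "map_mat cnj (mat_adjoint B * P * B) = complex_of_real \<beta> \<cdot>\<^sub>m 1\<^sub>m 1"
      unfolding gram by (rule eq_matI) auto
    then show ?thesis using B P Br by (simp add: map_cnj_simps)
  qed
  ultimately show ?thesis unfolding inner_pair_def using K P by simp
qed

lemma mat_adjoint_of_real:
  "mat_adjoint (map_mat complex_of_real A) = map_mat complex_of_real (A\<^sup>T)"
  by (rule eq_matI) auto

lemma map_of_real_mult:
  "dim_col A = dim_row B \<Longrightarrow>
    map_mat complex_of_real (A * B) = map_mat complex_of_real A * map_mat complex_of_real B"
  by (rule eq_matI) (auto simp: scalar_prod_def)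

lemma map_of_real_add:
  "dim_row A = dim_row B \<Longrightarrow> dim_col A = dim_col B \<Longrightarrow>
    map_mat complex_of_real (A + B) = map_mat complex_of_real A + map_mat complex_of_real B"
  by (rule eq_matI) auto

lemma map_of_real_smult:
  "map_mat complex_of_real (c \<cdot>\<^sub>m A) = complex_of_real c \<cdot>\<^sub>m map_mat complex_of_real A"
  by (rule eq_matI) auto

lemmas map_of_real_simps = map_of_real_mult map_of_real_add map_of_real_smult

lemma map_of_real_eq_iff:
  "map_mat complex_of_real A = map_mat complex_of_real B \<longleftrightarrow> A = B"
proof
  assume eq: "map_mat complex_of_real A = map_mat complex_of_real B"
  show "A = B"
  proof (rule eq_matI)
    show "dim_row A = dim_row B" "dim_col A = dim_col B"
      using arg_cong[OF eq, of dim_row] arg_cong[OF eq, of dim_col] by auto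
    fix i j assume "i < dim_row B" "j < dim_col B"
    with \<open>dim_row A = dim_row B\<close> \<open>dim_col A = dim_col B\<close> show "A $$ (i, j) = B $$ (i, j)"
      using arg_cong[OF eq, of "\<lambda>X. X $$ (i, j)"] by simp
  qed
qed simp

text \<open>The complex construction yields a real pair because its stabilising solution is unique,
  hence invariant under conjugation.\<close>

lemma real_inner_pair_exists:
  fixes M B :: "real mat"
  assumes M: "M \<in> carrier_mat n n" and B: "B \<in> carrier_mat n 1"
    and pbh: "hautus n (map_mat complex_of_real M) (map_mat complex_of_real B)"
    and cp: "char_poly (map_mat complex_of_real M) = (\<Prod>e\<leftarrow>ss @ us. [:-e, 1:])"
    and us: "\<forall>l \<in> set us. 1 < cmod l" and ss: "\<forall>l \<in> set ss. cmod l < 1"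
  obtains K P where "K \<in> carrier_mat 1 n" "P \<in> carrier_mat n n" "P\<^sup>T = P"
    "\<And>v. v \<in> carrier_mat n 1 \<Longrightarrow> 0 \<le> (v\<^sup>T * P * v) $$ (0, 0)"
    "(M + B * K)\<^sup>T * P * (M + B * K) + K\<^sup>T * K = P"
    "B\<^sup>T * P * B = ((\<Prod>l\<leftarrow>us. (cmod l)\<^sup>2) - 1) \<cdot>\<^sub>m 1\<^sub>m 1"
    "\<And>i j. i < n \<Longrightarrow> j < n \<Longrightarrow> (\<lambda>k. ((M + B * K) ^\<^sub>m k) $$ (i, j)) \<longlonglongrightarrow> 0"
proof -
  define \<beta> where "\<beta> = (\<Prod>l\<leftarrow>us. (cmod l)\<^sup>2) - 1"
  have "0 < (\<Prod>l\<leftarrow>us. (cmod l)\<^sup>2)" using us by (induction us) (auto intro!: mult_pos_pos)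
  then have \<beta>: "1 + \<beta> > 0" unfolding \<beta>_def by simp
  let ?c = "map_mat complex_of_real"
  have Mc: "?c M \<in> carrier_mat n n" and Bc: "?c B \<in> carrier_mat n 1" using M B by auto
  obtain Kc Pc where ip: "inner_pair n (?c M) (?c B) Kc Pc \<beta>"
    and cpF: "char_poly (?c M + ?c B * Kc) = (\<Prod>e\<leftarrow>ss @ map (\<lambda>l. 1 / cnj l) us. [:-e, 1:])"
    using inner_pair_exists[OF Mc Bc pbh cp us] unfolding \<beta>_def by blast
  have Kc: "Kc \<in> carrier_mat 1 n" and Pc: "Pc \<in> carrier_mat n n" and H: "mat_adjoint Pc = Pc"
    and psd: "\<And>v. v \<in> carrier_mat n 1 \<Longrightarrow> 0 \<le> Re ((mat_adjoint v * Pc * v) $$ (0, 0))"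
    and stein: "mat_adjoint (?c M + ?c B * Kc) * Pc * (?c M + ?c B * Kc) + mat_adjoint Kc * Kc = Pc"
    and orth: "mat_adjoint (?c M + ?c B * Kc) * Pc * ?c B + mat_adjoint Kc = 0\<^sub>m n 1"
    and gram: "mat_adjoint (?c B) * Pc * ?c B = complex_of_real \<beta> \<cdot>\<^sub>m 1\<^sub>m 1"
    using ip unfolding inner_pair_def by auto
  define Fc where "Fc = ?c M + ?c B * Kc"
  have Fc: "Fc \<in> carrier_mat n n" unfolding Fc_def using Mc Bc Kc by auto
  have lim: "(\<lambda>k. (Fc ^\<^sub>m k) $$ (i, j)) \<longlonglongrightarrow> 0" if "i < n" "j < n" for i j
  proof (rule schur_pow_tendsto_0[OF Fc _ that])
    fix z assume "eigenvalue Fc z"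
    then have "poly (\<Prod>e\<leftarrow>ss @ map (\<lambda>l. 1 / cnj l) us. [:-e, 1:]) z = 0"
      using eigenvalue_root_char_poly[OF Fc] cpF unfolding Fc_def by simp
    then have "z \<in> set ss \<union> (\<lambda>l. 1 / cnj l) ` set us"
      by (auto simp: poly_prod_list prod_list_zero_iff)
    moreover have "cmod (1 / cnj l) < 1" if "l \<in> set us" for l
    proof -
      have "1 < cmod l" using us that by blast
      then show ?thesis by (simp add: norm_divide divide_less_eq_1)
    qed
    ultimately show "cmod z < 1" using ss by auto
  qed
  have cnjFc: "?c M + ?c B * map_mat cnj Kc = map_mat cnj Fc"
    unfolding Fc_def using M B Kc by (simp add: map_cnj_simps)
  have lim': "(\<lambda>k. (map_mat cnj Fc ^\<^sub>m k) $$ (i, j)) \<longlonglongrightarrow> 0" if "i < n" "j < n" for i j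
  proof -
    have "(map_mat cnj Fc ^\<^sub>m k) $$ (i, j) = cnj ((Fc ^\<^sub>m k) $$ (i, j))" for k
    proof -
      have "Fc ^\<^sub>m k \<in> carrier_mat n n" using Fc by simp
      then show ?thesis using that unfolding map_cnj_pow[OF Fc, symmetric]
        using carrier_matD[OF Fc] by (simp add: pow_mat_dim_square[OF Fc])
    qed
    then show ?thesis using tendsto_cnj[OF lim[OF that]] by simp
  qed
  have "Pc = map_mat cnj Pc"
  proof (rule inner_pair_unique[OF Mc Bc ip inner_pair_cnj[OF Mc Bc _ _ ip]])
    show "(\<lambda>k. ((?c M + ?c B * Kc) ^\<^sub>m k) $$ (i, j)) \<longlonglongrightarrow> 0" if "i < n" "j < n" for i j
      using lim[OF that] unfolding Fc_def .
    show "(\<lambda>k. ((?c M + ?c B * map_mat cnj Kc) ^\<^sub>m k) $$ (i, j)) \<longlonglongrightarrow> 0" if "i < n" "j < n" for i j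
      using lim'[OF that] unfolding cnjFc .
  qed auto
  then have Pc_real: "cnj (Pc $$ (i, j)) = Pc $$ (i, j)" if "i < n" "j < n" for i j
    using that Pc arg_cong[of _ _ "\<lambda>X. X $$ (i, j)"] by (metis carrier_matD index_map_mat(1))
  define P where "P = map_mat Re Pc"
  have P: "P \<in> carrier_mat n n" unfolding P_def using Pc by simp
  have cP: "?c P = Pc" unfolding P_def
    by (rule eq_matI) (use Pc Pc_real in \<open>auto simp: complex_eq_iff\<close>)
  \<comment> \<open>This is the orthogonality relation solved for the feedback: its adjoint reads
    \<open>B^H P M + (1 + \<beta>) K = 0\<close>. It exhibits \<open>Kc\<close> as real once
    \<open>Pc\<close> is known to be real.\<close>
  define K where "K = (- 1 / (1 + \<beta>)) \<cdot>\<^sub>m (B\<^sup>T * P * M)"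
  have K: "K \<in> carrier_mat 1 n" unfolding K_def using B P M by auto
  have cK: "?c K = Kc"
  proof -
    let ?L = "mat_adjoint (?c B) * Pc * ?c M"
    have L: "?L \<in> carrier_mat 1 n" using Bc Pc Mc by auto
    have "mat_adjoint (mat_adjoint Fc * Pc * ?c B + mat_adjoint Kc) = 0\<^sub>m 1 n"
      using orth unfolding Fc_def by (auto intro!: eq_matI)
    then have "mat_adjoint (?c B) * (Pc * Fc) + Kc = 0\<^sub>m 1 n"
      using Fc Pc Bc Kc H by (simp add: mat_adjoint_simps mat_dim_simps)
    moreover have "mat_adjoint (?c B) * (Pc * Fc) = ?L + (mat_adjoint (?c B) * Pc * ?c B) * Kc"
      unfolding Fc_def using Mc Pc Bc Kc by (simp add: mat_dim_simps)
    moreover have "(mat_adjoint (?c B) * Pc * ?c B) * Kc = complex_of_real \<beta> \<cdot>\<^sub>m Kc"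
      unfolding gram using Kc by (simp add: mat_dim_simps)
    ultimately have eq: "?L + complex_of_real \<beta> \<cdot>\<^sub>m Kc + Kc = 0\<^sub>m 1 n" by simp
    have "Kc = complex_of_real (- 1 / (1 + \<beta>)) \<cdot>\<^sub>m ?L"
    proof (rule eq_matI)
      fix i j assume "i < dim_row (complex_of_real (- 1 / (1 + \<beta>)) \<cdot>\<^sub>m ?L)"
        "j < dim_col (complex_of_real (- 1 / (1 + \<beta>)) \<cdot>\<^sub>m ?L)"
      then have ij: "i < 1" "j < n" using L by auto
      have "(?L + complex_of_real \<beta> \<cdot>\<^sub>m Kc + Kc) $$ (i, j) = 0" unfolding eq using ij by simp
      then have "?L $$ (i, j) + complex_of_real \<beta> * Kc $$ (i, j) + Kc $$ (i, j) = 0"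
        using ij L Kc by (simp del: index_mult_mat(1))
      then have "complex_of_real (1 + \<beta>) * Kc $$ (i, j) = - ?L $$ (i, j)"
        by (simp add: algebra_simps eq_neg_iff_add_eq_0 del: index_mult_mat(1))
      then have "Kc $$ (i, j) = - ?L $$ (i, j) / complex_of_real (1 + \<beta>)"
        using \<beta> by (metis nonzero_mult_div_cancel_left of_real_eq_0_iff less_irrefl)
      then show "Kc $$ (i, j) = (complex_of_real (- 1 / (1 + \<beta>)) \<cdot>\<^sub>m ?L) $$ (i, j)"
        using ij carrier_matD[OF L] by (simp del: index_mult_mat(1))
    qed (use Kc L in auto)
    then show ?thesis unfolding K_def using M B P Pc cP
      by (simp add: map_of_real_simps mat_adjoint_of_real mat_dim_simps)
  qed
  have cF: "?c (M + B * K) = Fc" unfolding Fc_def using M B K cK by (simp add: map_of_real_simps)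
  have F: "M + B * K \<in> carrier_mat n n" using M B K by auto
  show ?thesis
  proof (rule that[OF K P])
    have "?c (P\<^sup>T) = ?c P" using H cP by (simp flip: mat_adjoint_of_real)
    then show "P\<^sup>T = P" unfolding map_of_real_eq_iff .
    show "0 \<le> (v\<^sup>T * P * v) $$ (0, 0)" if v: "v \<in> carrier_mat n 1" for v
    proof -
      have "mat_adjoint (?c v) * Pc * ?c v = ?c (v\<^sup>T * P * v)"
        using v P Pc cP by (simp add: map_of_real_simps mat_adjoint_of_real mat_dim_simps)
      then have "(mat_adjoint (?c v) * Pc * ?c v) $$ (0, 0) = complex_of_real ((v\<^sup>T * P * v) $$ (0, 0))"
        using v by (simp del: index_mult_mat(1))
      then show ?thesis using psd[of "?c v"] v by (simp del: index_mult_mat(1))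
    qed
    have "?c ((M + B * K)\<^sup>T * P * (M + B * K) + K\<^sup>T * K) = ?c P"
    proof -
      have "?c (F\<^sup>T * P * F + K\<^sup>T * K) = mat_adjoint Fc * Pc * Fc + mat_adjoint Kc * Kc"
        if "?c F = Fc" "F \<in> carrier_mat n n" for F
        using that(2) P K unfolding that(1)[symmetric] cP[symmetric] cK[symmetric] mat_adjoint_of_real
        by (simp add: map_of_real_simps mat_dim_simps)
      from this[OF cF F] show ?thesis using stein unfolding Fc_def[symmetric] cP by simp
    qed
    then show "(M + B * K)\<^sup>T * P * (M + B * K) + K\<^sup>T * K = P" unfolding map_of_real_eq_iff .
    have "?c (B\<^sup>T * P * B) = ?c (\<beta> \<cdot>\<^sub>m 1\<^sub>m 1)"
    proof -
      have "?c (1\<^sub>m 1) = 1\<^sub>m 1" by (rule eq_matI) auto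
      moreover have "?c (B\<^sup>T * P * B) = mat_adjoint (?c B) * Pc * ?c B"
        using B P Pc cP by (simp add: map_of_real_simps mat_adjoint_of_real mat_dim_simps)
      ultimately show ?thesis using gram by (simp add: map_of_real_smult)
    qed
    then show "B\<^sup>T * P * B = ((\<Prod>l\<leftarrow>us. (cmod l)\<^sup>2) - 1) \<cdot>\<^sub>m 1\<^sub>m 1"
      unfolding map_of_real_eq_iff \<beta>_def .
    show "(\<lambda>k. ((M + B * K) ^\<^sub>m k) $$ (i, j)) \<longlonglongrightarrow> 0" if "i < n" "j < n" for i j
    proof -
      have "(Fc ^\<^sub>m k) $$ (i, j) = complex_of_real (((M + B * K) ^\<^sub>m k) $$ (i, j))" for k
      proof -
        have "(M + B * K) ^\<^sub>m k \<in> carrier_mat n n" using F by simp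
        from carrier_matD[OF this] show ?thesis
          using that unfolding cF[symmetric] of_real_hom.mat_hom_pow[OF F, symmetric]
          by (intro index_map_mat(1)) auto
      qed
      then have "(\<lambda>k. complex_of_real (((M + B * K) ^\<^sub>m k) $$ (i, j))) \<longlonglongrightarrow> complex_of_real 0"
        using lim[OF that] by simp
      then show ?thesis unfolding tendsto_of_real_iff .
    qed
  qed
qed

section \<open>The modified Riccati inequality\<close>

lemma transpose_smult_mat: "(c \<cdot>\<^sub>m A)\<^sup>T = c \<cdot>\<^sub>m A\<^sup>T"
  by (rule eq_matI) auto

lemma smult_mat_mult_vec:
  "dim_col A = dim_vec v \<Longrightarrow> (c \<cdot>\<^sub>m A) *\<^sub>v v = c \<cdot>\<^sub>v (A *\<^sub>v v)" for A :: "'a :: comm_ring_1 mat"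
  by (rule eq_vecI) auto

lemma sprod_congruence:
  fixes X :: "real mat"
  assumes X: "X \<in> carrier_mat m n" and P: "P \<in> carrier_mat m m" and v: "v \<in> carrier_vec n"
  shows "v \<bullet> ((X\<^sup>T * P * X) *\<^sub>v v) = (X *\<^sub>v v) \<bullet> (P *\<^sub>v (X *\<^sub>v v))"
proof -
  have Xv: "X *\<^sub>v v \<in> carrier_vec m" using X v by simp
  have PXv: "P *\<^sub>v (X *\<^sub>v v) \<in> carrier_vec m" using P Xv by simp
  have "(X\<^sup>T * P * X) *\<^sub>v v = X\<^sup>T *\<^sub>v (P *\<^sub>v (X *\<^sub>v v))"
    using X P v Xv by (simp add: assoc_mult_mat_vec[of _ n m _ n] assoc_mult_mat_vec[of _ n m _ m])
  moreover have "X\<^sup>T *\<^sub>v (P *\<^sub>v (X *\<^sub>v v)) \<in> carrier_vec n" using X PXv by simp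
  ultimately have "v \<bullet> ((X\<^sup>T * P * X) *\<^sub>v v) = (X\<^sup>T *\<^sub>v (P *\<^sub>v (X *\<^sub>v v))) \<bullet> v"
    using v by (simp add: comm_scalar_prod[of v n])
  also have "\<dots> = (P *\<^sub>v (X *\<^sub>v v)) \<bullet> (X *\<^sub>v v)"
    by (rule transpose_vec_mult_scalar[OF X v PXv])
  finally show ?thesis using comm_scalar_prod[OF PXv Xv] by simp
qed

lemma congruence_col_index:
  fixes P :: "real mat"
  assumes P: "P \<in> carrier_mat n n" and X: "X \<in> carrier_mat n 1"
  shows "(X\<^sup>T * P * X) $$ (0, 0) = col X 0 \<bullet> (P *\<^sub>v col X 0)"
proof -
  have "(X\<^sup>T * P * X) $$ (0, 0) = (X\<^sup>T * (P * X)) $$ (0, 0)" using X P by (simp add: mat_dim_simps)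
  also have "\<dots> = col X 0 \<bullet> col (P * X) 0" using X P by simp
  also have "col (P * X) 0 = P *\<^sub>v col X 0" by (rule col_mult2[OF P X]) simp
  finally show ?thesis .
qed

lemma sprod_symmetric:
  fixes P :: "real mat"
  assumes P: "P \<in> carrier_mat n n" "P\<^sup>T = P" and uv: "u \<in> carrier_vec n" "v \<in> carrier_vec n"
  shows "u \<bullet> (P *\<^sub>v v) = v \<bullet> (P *\<^sub>v u)"
  using transpose_vec_mult_scalar[OF P(1) uv] P uv comm_scalar_prod[of u n "P *\<^sub>v v"] by simp

lemma quadratic_form_add_smult:
  fixes P :: "real mat"
  assumes P: "P \<in> carrier_mat n n" "P\<^sup>T = P" and uv: "u \<in> carrier_vec n" "b \<in> carrier_vec n"
  shows "(u + k \<cdot>\<^sub>v b) \<bullet> (P *\<^sub>v (u + k \<cdot>\<^sub>v b))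
    = u \<bullet> (P *\<^sub>v u) + 2 * k * (u \<bullet> (P *\<^sub>v b)) + k\<^sup>2 * (b \<bullet> (P *\<^sub>v b))"
proof -
  have Pu: "P *\<^sub>v u \<in> carrier_vec n" and Pb: "P *\<^sub>v b \<in> carrier_vec n" using P uv by auto
  have "P *\<^sub>v (u + k \<cdot>\<^sub>v b) = P *\<^sub>v u + k \<cdot>\<^sub>v (P *\<^sub>v b)"
    using P uv by (simp add: mult_add_distrib_mat_vec[of _ n n] mult_mat_vec[of _ n n])
  then have "(u + k \<cdot>\<^sub>v b) \<bullet> (P *\<^sub>v (u + k \<cdot>\<^sub>v b))
    = u \<bullet> (P *\<^sub>v u) + k * (u \<bullet> (P *\<^sub>v b)) + (k * (b \<bullet> (P *\<^sub>v u)) + k * k * (b \<bullet> (P *\<^sub>v b)))"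
    using uv Pu Pb by (simp add: scalar_prod_add_distrib[of _ n] add_scalar_prod_distrib[of _ n] algebra_simps)
  then show ?thesis using sprod_symmetric[OF P, of b u] uv by (simp add: power2_eq_square)
qed

lemma rank_one_feedback_mult_vec:
  fixes M B K :: "real mat"
  assumes "M \<in> carrier_mat n n" "B \<in> carrier_mat n 1" "K \<in> carrier_mat 1 n" "v \<in> carrier_vec n"
  shows "(M + B * K) *\<^sub>v v = M *\<^sub>v v + ((K *\<^sub>v v) $ 0) \<cdot>\<^sub>v col B 0"
proof -
  have "(M + B * K) *\<^sub>v v = M *\<^sub>v v + B *\<^sub>v (K *\<^sub>v v)"
    using assms by (simp add: add_mult_distrib_mat_vec[of _ n n] assoc_mult_mat_vec[of _ n 1 _ n])
  also have "B *\<^sub>v (K *\<^sub>v v) = ((K *\<^sub>v v) $ 0) \<cdot>\<^sub>v col B 0"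
  proof (rule eq_vecI)
    fix i assume "i < dim_vec ((K *\<^sub>v v) $ 0 \<cdot>\<^sub>v col B 0)"
    then show "(B *\<^sub>v (K *\<^sub>v v)) $ i = ((K *\<^sub>v v) $ 0 \<cdot>\<^sub>v col B 0) $ i"
      using assms by (simp add: scalar_prod_def[of "row B i"] mult.commute)
  qed (use assms in auto)
  finally show ?thesis .
qed

text \<open>The correction term factors as \<open>L^T J L\<close> with the row
  \<open>L = B^T P M\<close> and a \<open>1 x 1\<close> matrix \<open>J\<close>, so in the quadratic
  form it is the square of a scalar over \<open>b^T P b\<close>. The later estimates thereby become
  scalar inequalities.\<close>

lemma riccati_quadratic_form:
  fixes M B P :: "real mat" and \<sigma> :: real
  assumes M: "M \<in> carrier_mat n n" and B: "B \<in> carrier_mat n 1"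
    and P: "P \<in> carrier_mat n n" "P\<^sup>T = P" and v: "v \<in> carrier_vec n"
  defines "R \<equiv> M\<^sup>T * P * M - \<sigma> \<cdot>\<^sub>m (M\<^sup>T * P * B * inv_1x1 (B\<^sup>T * P * B) * B\<^sup>T * P * M) - P"
  shows "R \<in> carrier_mat n n" "R\<^sup>T = R"
    "v \<bullet> (R *\<^sub>v v) = (M *\<^sub>v v) \<bullet> (P *\<^sub>v (M *\<^sub>v v))
       - \<sigma> * (((M *\<^sub>v v) \<bullet> (P *\<^sub>v col B 0))\<^sup>2 * inverse (col B 0 \<bullet> (P *\<^sub>v col B 0)))
       - v \<bullet> (P *\<^sub>v v)"
proof -
  let ?b = "col B 0"
  define J where "J = inv_1x1 (B\<^sup>T * P * B)"
  define L where "L = B\<^sup>T * P * M"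
  have J: "J \<in> carrier_mat 1 1" unfolding J_def inv_1x1_def by simp
  have Jt: "J\<^sup>T = J" by (rule eq_matI) (use J in auto)
  have L: "L \<in> carrier_mat 1 n" unfolding L_def using M B P by auto
  have b: "?b \<in> carrier_vec n" using B by auto
  have Mv: "M *\<^sub>v v \<in> carrier_vec n" using M v by simp
  have Lt: "L\<^sup>T = M\<^sup>T * P * B"
    unfolding L_def using M B P
    by (simp add: transpose_mult[of _ 1 n _ n] transpose_mult[of _ n n _ n] mat_dim_simps)
  have R: "R = M\<^sup>T * P * M - \<sigma> \<cdot>\<^sub>m (L\<^sup>T * J * L) - P"
    unfolding R_def J_def[symmetric] Lt unfolding L_def using M B P J by (simp add: mat_dim_simps)
  have MPM: "M\<^sup>T * P * M \<in> carrier_mat n n" and LJL: "L\<^sup>T * J * L \<in> carrier_mat n n"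
    using M P L J by (auto intro!: mult_carrier_mat)
  show "R \<in> carrier_mat n n" unfolding R using MPM LJL P by auto
  have "(M\<^sup>T * P * M)\<^sup>T = M\<^sup>T * P * M"
    using M P by (simp add: transpose_mult[of _ n n _ n] mat_dim_simps)
  moreover have "(L\<^sup>T * J * L)\<^sup>T = L\<^sup>T * J * L"
    using L J Jt by (simp add: transpose_mult[of _ n 1 _ n] transpose_mult[of _ 1 1 _ n] transpose_mult[of _ n 1 _ 1] mat_dim_simps)
  moreover have "(X - \<sigma> \<cdot>\<^sub>m Y - P)\<^sup>T = X - \<sigma> \<cdot>\<^sub>m Y - P"
    if "X\<^sup>T = X" "Y\<^sup>T = Y" "X \<in> carrier_mat n n" "Y \<in> carrier_mat n n" for X Y
  proof -
    have Y: "\<sigma> \<cdot>\<^sub>m Y \<in> carrier_mat n n" and XY: "X - \<sigma> \<cdot>\<^sub>m Y \<in> carrier_mat n n" using that by auto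
    show ?thesis
      unfolding transpose_minus[OF XY P(1)] transpose_minus[OF that(3) Y] transpose_smult_mat
        that(1,2) P(2) ..
  qed
  ultimately show "R\<^sup>T = R" unfolding R using MPM LJL by blast
  have Rv: "R *\<^sub>v v = (M\<^sup>T * P * M) *\<^sub>v v - \<sigma> \<cdot>\<^sub>v ((L\<^sup>T * J * L) *\<^sub>v v) - P *\<^sub>v v"
  proof -
    have "(X - \<sigma> \<cdot>\<^sub>m Y - P) *\<^sub>v v = X *\<^sub>v v - \<sigma> \<cdot>\<^sub>v (Y *\<^sub>v v) - P *\<^sub>v v"
      if "X \<in> carrier_mat n n" "Y \<in> carrier_mat n n" for X Y
    proof -
      have Y: "\<sigma> \<cdot>\<^sub>m Y \<in> carrier_mat n n" and XY: "X - \<sigma> \<cdot>\<^sub>m Y \<in> carrier_mat n n" using that by auto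
      show ?thesis
        unfolding minus_mult_distrib_mat_vec[OF XY P(1) v] minus_mult_distrib_mat_vec[OF that(1) Y v]
        using that v by (simp add: smult_mat_mult_vec)
    qed
    from this[OF MPM LJL] show ?thesis unfolding R .
  qed
  have "v \<bullet> (R *\<^sub>v v) = v \<bullet> ((M\<^sup>T * P * M) *\<^sub>v v) - \<sigma> * (v \<bullet> ((L\<^sup>T * J * L) *\<^sub>v v)) - v \<bullet> (P *\<^sub>v v)"
  proof -
    have "v \<bullet> (x - \<sigma> \<cdot>\<^sub>v y - z) = v \<bullet> x - \<sigma> * (v \<bullet> y) - v \<bullet> z"
      if "x \<in> carrier_vec n" "y \<in> carrier_vec n" "z \<in> carrier_vec n" for x y z
    proof -
      have y: "\<sigma> \<cdot>\<^sub>v y \<in> carrier_vec n" and xy: "x - \<sigma> \<cdot>\<^sub>v y \<in> carrier_vec n" using that by auto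
      show ?thesis
        unfolding scalar_prod_minus_distrib[OF v xy that(3)] scalar_prod_minus_distrib[OF v that(1) y]
        using that v by simp
    qed
    from this[OF mult_mat_vec_carrier[OF MPM v] mult_mat_vec_carrier[OF LJL v] mult_mat_vec_carrier[OF P(1) v]]
    show ?thesis unfolding Rv .
  qed
  also have "v \<bullet> ((L\<^sup>T * J * L) *\<^sub>v v) = (L *\<^sub>v v) \<bullet> (J *\<^sub>v (L *\<^sub>v v))"
    by (rule sprod_congruence[OF L J v])
  also have "\<dots> = ((L *\<^sub>v v) $ 0)\<^sup>2 * J $$ (0, 0)"
    using J L v by (simp add: scalar_prod_def[of "L *\<^sub>v v"] scalar_prod_def[of "row J 0"] power2_eq_square)
  also have "(L *\<^sub>v v) $ 0 = (M *\<^sub>v v) \<bullet> (P *\<^sub>v ?b)"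
  proof -
    have "L *\<^sub>v v = B\<^sup>T *\<^sub>v (P *\<^sub>v (M *\<^sub>v v))"
      unfolding L_def using M B P v Mv
      by (simp add: assoc_mult_mat_vec[of _ 1 n _ n])
    then have "(L *\<^sub>v v) $ 0 = ?b \<bullet> (P *\<^sub>v (M *\<^sub>v v))" using B by simp
    then show ?thesis using sprod_symmetric[OF P b Mv] by simp
  qed
  also have "J $$ (0, 0) = inverse (?b \<bullet> (P *\<^sub>v ?b))"
    unfolding J_def inv_1x1_def using congruence_col_index[OF P(1) B] by simp
  finally show "v \<bullet> (R *\<^sub>v v) = (M *\<^sub>v v) \<bullet> (P *\<^sub>v (M *\<^sub>v v))
       - \<sigma> * (((M *\<^sub>v v) \<bullet> (P *\<^sub>v ?b))\<^sup>2 * inverse (?b \<bullet> (P *\<^sub>v ?b))) - v \<bullet> (P *\<^sub>v v)"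
    unfolding sprod_congruence[OF M P(1) v] .
qed

section \<open>A quadratic Lyapunov function for a matrix with vanishing powers\<close>

lemma scalar_prod_self: "v \<in> carrier_vec n \<Longrightarrow> v \<bullet> v = (\<Sum>i<n. (v $ i)\<^sup>2)" for v :: "real vec"
  by (simp add: scalar_prod_def power2_eq_square lessThan_atLeast0)

text \<open>The entry bound gives every row a squared norm of at most \<open>1 / n\<close>, so the
  Frobenius norm of \<open>G\<close> is at most 1; Cauchy-Schwarz is applied row by row.\<close>

lemma mult_vec_norm_le:
  fixes G :: "real mat"
  assumes G: "G \<in> carrier_mat n n" and v: "v \<in> carrier_vec n"
    and small: "\<And>i j. i < n \<Longrightarrow> j < n \<Longrightarrow> \<bar>G $$ (i, j)\<bar> \<le> 1 / n"
  shows "(G *\<^sub>v v) \<bullet> (G *\<^sub>v v) \<le> v \<bullet> v"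
proof (cases "n = 0")
  case True
  then show ?thesis using G v by (simp add: scalar_prod_def)
next
  case False
  have "((G *\<^sub>v v) $ i)\<^sup>2 \<le> (1 / n) * (v \<bullet> v)" if i: "i < n" for i
  proof -
    have "(G *\<^sub>v v) $ i = (\<Sum>j<n. G $$ (i, j) * v $ j)"
      using G v i by (auto simp: scalar_prod_def lessThan_atLeast0 intro!: sum.cong)
    then have "((G *\<^sub>v v) $ i)\<^sup>2 \<le> (\<Sum>j<n. (G $$ (i, j))\<^sup>2) * (\<Sum>j<n. (v $ j)\<^sup>2)"
      using Cauchy_Schwarz_ineq_sum[of "\<lambda>j. G $$ (i, j)" "\<lambda>j. v $ j" "{..<n}"] by simp
    also have "(\<Sum>j<n. (G $$ (i, j))\<^sup>2) \<le> (\<Sum>j<n. (1 / real n)\<^sup>2)"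
      using small[OF i] by (intro sum_mono) (auto simp: abs_le_square_iff[symmetric])
    also have "(\<Sum>j<n. (1 / real n)\<^sup>2) = 1 / n" using False by (simp add: power2_eq_square)
    finally show ?thesis unfolding scalar_prod_self[OF v]
      by (simp add: mult_right_mono sum_nonneg)
  qed
  then have "(\<Sum>i<n. ((G *\<^sub>v v) $ i)\<^sup>2) \<le> (\<Sum>i<n. (1 / n) * (v \<bullet> v))"
    by (intro sum_mono) auto
  also have "\<dots> = v \<bullet> v" using False by simp
  finally show ?thesis using G v by (simp add: scalar_prod_self[of "G *\<^sub>v v" n])
qed

text \<open>\<open>S\<close> is the sum of \<open>(F^l)^T F^l\<close> over \<open>l < N\<close>,
  with \<open>N\<close> so large that \<open>F^N\<close> is nonexpansive: passing from
  \<open>v\<close> to \<open>F v\<close> loses the term \<open>|v|^2\<close> and gains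
  \<open>|F^N v|^2\<close>. A finite sum avoids all convergence questions, at the price of a weak
  decrease; strictness is supplied later by the scaling factor \<open>c\<close>.\<close>

lemma lyapunov_certificate_exists:
  fixes F :: "real mat"
  assumes F: "F \<in> carrier_mat n n"
    and lim: "\<And>i j. i < n \<Longrightarrow> j < n \<Longrightarrow> (\<lambda>k. (F ^\<^sub>m k) $$ (i, j)) \<longlonglongrightarrow> 0"
  obtains S where "S \<in> carrier_mat n n" "S\<^sup>T = S"
    "\<And>v. v \<in> carrier_vec n \<Longrightarrow> v \<bullet> v \<le> v \<bullet> (S *\<^sub>v v)"
    "\<And>v. v \<in> carrier_vec n \<Longrightarrow> (F *\<^sub>v v) \<bullet> (S *\<^sub>v (F *\<^sub>v v)) \<le> v \<bullet> (S *\<^sub>v v)"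
proof -
  define nF where "nF k v = (F ^\<^sub>m k *\<^sub>v v) \<bullet> (F ^\<^sub>m k *\<^sub>v v)" for k v
  have nF_Suc: "nF (Suc k) v = nF k (F *\<^sub>v v)" if "v \<in> carrier_vec n" for k v
    unfolding nF_def using F that by (simp add: assoc_mult_mat_vec[of _ n n _ n])
  have nF_0: "nF 0 v = v \<bullet> v" if "v \<in> carrier_vec n" for v unfolding nF_def using F that by simp
  have ex: "\<exists>S. S \<in> carrier_mat n n \<and> S\<^sup>T = S \<and> (\<forall>v\<in>carrier_vec n. v \<bullet> (S *\<^sub>v v) = (\<Sum>l<k. nF l v))" for k
  proof (induction k)
    case 0
    have "0\<^sub>m n n *\<^sub>v v = 0\<^sub>v n" if "v \<in> carrier_vec n" for v :: "real vec"
      using that by (intro eq_vecI) auto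
    then show ?case by (intro exI[of _ "0\<^sub>m n n"]) auto
  next
    case (Suc k)
    then obtain S where S: "S \<in> carrier_mat n n" "S\<^sup>T = S"
      and Sv: "\<And>v. v \<in> carrier_vec n \<Longrightarrow> v \<bullet> (S *\<^sub>v v) = (\<Sum>l<k. nF l v)" by blast
    have FSF: "F\<^sup>T * S * F \<in> carrier_mat n n" using F S by (auto intro!: mult_carrier_mat)
    have FSFt: "(F\<^sup>T * S * F)\<^sup>T = F\<^sup>T * S * F"
      using F S by (simp add: transpose_mult[of _ n n _ n] mat_dim_simps)
    have "v \<bullet> ((1\<^sub>m n + F\<^sup>T * S * F) *\<^sub>v v) = (\<Sum>l<Suc k. nF l v)" if v: "v \<in> carrier_vec n" for v
    proof -
      have "v \<bullet> ((1\<^sub>m n + F\<^sup>T * S * F) *\<^sub>v v) = v \<bullet> v + v \<bullet> ((F\<^sup>T * S * F) *\<^sub>v v)"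
        using FSF v by (simp add: add_mult_distrib_mat_vec[of _ n n] scalar_prod_add_distrib[of _ n])
      also have "\<dots> = nF 0 v + (\<Sum>l<k. nF (Suc l) v)"
        unfolding sprod_congruence[OF F S(1) v] using Sv F v nF_0 nF_Suc by simp
      also have "\<dots> = (\<Sum>l<Suc k. nF l v)" by (rule sum.lessThan_Suc_shift[symmetric])
      finally show ?thesis .
    qed
    then show ?case using FSF FSFt
      by (intro exI[of _ "1\<^sub>m n + F\<^sup>T * S * F"]) (auto simp: transpose_add[of _ n n])
  qed
  have "\<forall>\<^sub>F k in sequentially. \<bar>(F ^\<^sub>m k) $$ (i, j)\<bar> \<le> 1 / n" if "i < n" "j < n" for i j
  proof -
    have "0 < 1 / real n" using that by simp
    from order_tendstoD(2)[OF tendsto_rabs_zero[OF lim[OF that]] this]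
    show ?thesis by (rule eventually_mono) simp
  qed
  then have "\<forall>\<^sub>F k in sequentially. \<forall>i\<in>{..<n}. \<forall>j\<in>{..<n}. \<bar>(F ^\<^sub>m k) $$ (i, j)\<bar> \<le> 1 / n"
    by (auto simp: eventually_ball_finite_distrib)
  \<comment> \<open>A positive number of summands puts the term \<open>l = 0\<close> into the sum,
    and this term gives the lower bound \<open>v \<bullet> v\<close>.\<close>
  then have "\<forall>\<^sub>F k in sequentially. 0 < k \<and> (\<forall>i\<in>{..<n}. \<forall>j\<in>{..<n}. \<bar>(F ^\<^sub>m k) $$ (i, j)\<bar> \<le> 1 / n)"
    using eventually_gt_at_top[of 0] by eventually_elim auto
  then obtain N where N: "0 < N"
    and small: "\<And>i j. i < n \<Longrightarrow> j < n \<Longrightarrow> \<bar>(F ^\<^sub>m N) $$ (i, j)\<bar> \<le> 1 / n"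
    by (auto dest!: eventually_happens)
  obtain S where S: "S \<in> carrier_mat n n" "S\<^sup>T = S"
    and Sv: "\<And>v. v \<in> carrier_vec n \<Longrightarrow> v \<bullet> (S *\<^sub>v v) = (\<Sum>l<N. nF l v)" using ex by blast
  have nF_nonneg: "0 \<le> nF l v" for l v
    unfolding nF_def scalar_prod_def by (intro sum_nonneg) auto
  show ?thesis
  proof (rule that[OF S])
    fix v :: "real vec" assume v: "v \<in> carrier_vec n"
    have "nF 0 v \<le> (\<Sum>l<N. nF l v)"
      using N nF_nonneg by (intro member_le_sum) auto
    then show "v \<bullet> v \<le> v \<bullet> (S *\<^sub>v v)" using Sv[OF v] nF_0[OF v] by simp
    have Fv: "F *\<^sub>v v \<in> carrier_vec n" using F v by simp
    have "(F *\<^sub>v v) \<bullet> (S *\<^sub>v (F *\<^sub>v v)) = (\<Sum>l<N. nF (Suc l) v)" unfolding Sv[OF Fv] using nF_Suc[OF v] by simp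
    also have "\<dots> = (\<Sum>l<N. nF l v) + nF N v - nF 0 v"
      using sum.lessThan_Suc_shift[of "\<lambda>l. nF l v" N] by simp
    also have "nF N v \<le> nF 0 v"
      unfolding nF_0[OF v] unfolding nF_def
      by (rule mult_vec_norm_le[OF _ v small]) (use F in auto)
    finally show "(F *\<^sub>v v) \<bullet> (S *\<^sub>v (F *\<^sub>v v)) \<le> v \<bullet> (S *\<^sub>v v)" unfolding Sv[OF v] by simp
  qed
qed

lemma positive_definiteD:
  assumes "positive_definite n P"
  shows "P \<in> carrier_mat n n" "P\<^sup>T = P"
    "v \<in> carrier_vec n \<Longrightarrow> v \<noteq> 0\<^sub>v n \<Longrightarrow> 0 < v \<bullet> (P *\<^sub>v v)"
    "v \<in> carrier_vec n \<Longrightarrow> 0 \<le> v \<bullet> (P *\<^sub>v v)"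
proof -
  show P: "P \<in> carrier_mat n n" "P\<^sup>T = P" and
    pos: "v \<in> carrier_vec n \<Longrightarrow> v \<noteq> 0\<^sub>v n \<Longrightarrow> 0 < v \<bullet> (P *\<^sub>v v)"
    using assms unfolding positive_definite_def by auto
  show "v \<in> carrier_vec n \<Longrightarrow> 0 \<le> v \<bullet> (P *\<^sub>v v)"
    using P pos by (cases "v = 0\<^sub>v n") (auto simp: less_imp_le)
qed

lemma riccati_solution_iff:
  assumes M: "M \<in> carrier_mat n n" and B: "B \<in> carrier_mat n 1"
  shows "riccati_solution n M B \<sigma> P \<longleftrightarrow> positive_definite n P \<and>
    (\<forall>v \<in> carrier_vec n. v \<noteq> 0\<^sub>v n \<longrightarrow>
       (M *\<^sub>v v) \<bullet> (P *\<^sub>v (M *\<^sub>v v))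
       - \<sigma> * (((M *\<^sub>v v) \<bullet> (P *\<^sub>v col B 0))\<^sup>2 * inverse (col B 0 \<bullet> (P *\<^sub>v col B 0)))
       < v \<bullet> (P *\<^sub>v v))"
proof (cases "positive_definite n P")
  case True
  note P = positive_definiteD(1,2)[OF True]
  note form = riccati_quadratic_form[OF M B P, of _ \<sigma>]
  show ?thesis
    \<comment> \<open>Dimension and symmetry do not depend on the vector, so the zero vector serves
      to instantiate it.\<close>
    unfolding riccati_solution_def negative_definite_def using True form(1,2)[OF zero_carrier_vec]
    by (auto simp: form(3) simp del: index_mult_mat(1))
qed (auto simp: riccati_solution_def)

text \<open>The slack between \<open>c > 1\<close> and \<open>1\<close> turns the Riccati equation of the scaled pair, whose
  solution \<open>P\<^sub>0\<close> is in general only semidefinite, into a strict inequality; \<open>S\<close> repairs definiteness.\<close>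

lemma riccati_solution_of_scaled_pair:
  fixes M B :: "real mat"
  assumes M: "M \<in> carrier_mat n n" and B: "B \<in> carrier_mat n 1" and B0: "col B 0 \<noteq> 0\<^sub>v n"
    and pbh: "hautus n (map_mat complex_of_real (c \<cdot>\<^sub>m M)) (map_mat complex_of_real B)"
    and c: "1 < c"
    and cp: "char_poly (map_mat complex_of_real (c \<cdot>\<^sub>m M)) = (\<Prod>e\<leftarrow>ss @ us. [:-e, 1:])"
    and us: "\<forall>l \<in> set us. 1 < cmod l" and ss: "\<forall>l \<in> set ss. cmod l < 1"
    and \<sigma>: "(1 - \<sigma>) * (\<Prod>l\<leftarrow>us. (cmod l)\<^sup>2) < 1"
  shows "\<exists>P. riccati_solution n M B \<sigma> P"
proof -
  define \<gamma> where "\<gamma> = (\<Prod>l\<leftarrow>us. (cmod l)\<^sup>2)"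
  let ?b = "col B 0"
  have b: "?b \<in> carrier_vec n" using B by auto
  have cM: "c \<cdot>\<^sub>m M \<in> carrier_mat n n" using M by simp
  obtain K P\<^sub>0 where K: "K \<in> carrier_mat 1 n" and P0: "P\<^sub>0 \<in> carrier_mat n n" "P\<^sub>0\<^sup>T = P\<^sub>0"
    and psd: "\<And>v. v \<in> carrier_mat n 1 \<Longrightarrow> 0 \<le> (v\<^sup>T * P\<^sub>0 * v) $$ (0, 0)"
    and stein: "(c \<cdot>\<^sub>m M + B * K)\<^sup>T * P\<^sub>0 * (c \<cdot>\<^sub>m M + B * K) + K\<^sup>T * K = P\<^sub>0"
    and gram: "B\<^sup>T * P\<^sub>0 * B = (\<gamma> - 1) \<cdot>\<^sub>m 1\<^sub>m 1"
    and lim: "\<And>i j. i < n \<Longrightarrow> j < n \<Longrightarrow> (\<lambda>k. ((c \<cdot>\<^sub>m M + B * K) ^\<^sub>m k) $$ (i, j)) \<longlonglongrightarrow> 0"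
    using real_inner_pair_exists[OF cM B pbh cp us ss] unfolding \<gamma>_def by blast
  define F where "F = c \<cdot>\<^sub>m M + B * K"
  have F: "F \<in> carrier_mat n n" unfolding F_def using M B K by auto
  note col_form = congruence_col_index[OF P0(1)]
  have P0_nonneg: "0 \<le> v \<bullet> (P\<^sub>0 *\<^sub>v v)" if "v \<in> carrier_vec n" for v
  proof -
    have V: "mat_of_cols n [v] \<in> carrier_mat n 1" by (rule carrier_matI) auto
    have "col (mat_of_cols n [v]) 0 = v" using that by simp
    then show ?thesis using psd[OF V] unfolding col_form[OF V] by simp
  qed
  have P0_b: "?b \<bullet> (P\<^sub>0 *\<^sub>v ?b) = \<gamma> - 1" using col_form[OF B] unfolding gram by simp
  have P0_stein: "(F *\<^sub>v v) \<bullet> (P\<^sub>0 *\<^sub>v (F *\<^sub>v v)) + ((K *\<^sub>v v) $ 0)\<^sup>2 = v \<bullet> (P\<^sub>0 *\<^sub>v v)"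
    if v: "v \<in> carrier_vec n" for v
  proof -
    have FPF: "F\<^sup>T * P\<^sub>0 * F \<in> carrier_mat n n" and KK: "K\<^sup>T * 1\<^sub>m 1 * K \<in> carrier_mat n n"
      using F P0 K by (auto intro!: mult_carrier_mat)
    \<comment> \<open>The identity in the middle of \<open>K^T K\<close> brings this term into the
      shape of a congruence.\<close>
    have "P\<^sub>0 = F\<^sup>T * P\<^sub>0 * F + K\<^sup>T * 1\<^sub>m 1 * K" using stein K unfolding F_def by simp
    then have "v \<bullet> (P\<^sub>0 *\<^sub>v v) = v \<bullet> ((F\<^sup>T * P\<^sub>0 * F + K\<^sup>T * 1\<^sub>m 1 * K) *\<^sub>v v)" by metis
    also have "\<dots> = v \<bullet> ((F\<^sup>T * P\<^sub>0 * F) *\<^sub>v v) + v \<bullet> ((K\<^sup>T * 1\<^sub>m 1 * K) *\<^sub>v v)"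
      using FPF KK v by (simp add: add_mult_distrib_mat_vec[of _ n n] scalar_prod_add_distrib[of _ n])
    also have "v \<bullet> ((F\<^sup>T * P\<^sub>0 * F) *\<^sub>v v) = (F *\<^sub>v v) \<bullet> (P\<^sub>0 *\<^sub>v (F *\<^sub>v v))"
      by (rule sprod_congruence[OF F P0(1) v])
    also have "v \<bullet> ((K\<^sup>T * 1\<^sub>m 1 * K) *\<^sub>v v) = (K *\<^sub>v v) \<bullet> (1\<^sub>m 1 *\<^sub>v (K *\<^sub>v v))"
      by (rule sprod_congruence[OF K _ v]) simp
    also have "1\<^sub>m 1 *\<^sub>v (K *\<^sub>v v) = K *\<^sub>v v" using K v by (intro one_mult_mat_vec) auto
    also have "(K *\<^sub>v v) \<bullet> (K *\<^sub>v v) = ((K *\<^sub>v v) $ 0)\<^sup>2"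
      using K by (simp add: scalar_prod_def[of "K *\<^sub>v v"] power2_eq_square)
    finally show ?thesis by simp
  qed
  obtain S where S: "S \<in> carrier_mat n n" "S\<^sup>T = S"
    and S_ge: "\<And>v. v \<in> carrier_vec n \<Longrightarrow> v \<bullet> v \<le> v \<bullet> (S *\<^sub>v v)"
    and S_dec: "\<And>v. v \<in> carrier_vec n \<Longrightarrow> (F *\<^sub>v v) \<bullet> (S *\<^sub>v (F *\<^sub>v v)) \<le> v \<bullet> (S *\<^sub>v v)"
    using lyapunov_certificate_exists[OF F lim[folded F_def]] by blast
  define s where "s = ?b \<bullet> (S *\<^sub>v ?b)"
  \<comment> \<open>Adding \<open>d * S\<close> raises \<open>b^T P b\<close> by
    \<open>d * s\<close>. The hypothesis on \<sigma> is strict, so it survives this for small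
    positive \<open>d\<close>.\<close>
  have "((\<lambda>d. (1 - \<sigma>) * (\<gamma> + d * s)) \<longlongrightarrow> (1 - \<sigma>) * (\<gamma> + 0 * s)) (at_right 0)"
    by (intro tendsto_intros)
  from order_tendstoD(2)[OF this, of 1]
  have "\<forall>\<^sub>F d in at_right 0. (1 - \<sigma>) * (\<gamma> + d * s) < 1" using \<sigma> unfolding \<gamma>_def by simp
  then have "\<forall>\<^sub>F d in at_right (0::real). 0 < d \<and> (1 - \<sigma>) * (\<gamma> + d * s) < 1"
    using eventually_at_right_less[of 0] by eventually_elim auto
  then obtain d where d: "0 < d" and \<sigma>d: "(1 - \<sigma>) * (\<gamma> + d * s) < 1"
    by (auto dest!: eventually_happens)
  define P where "P = P\<^sub>0 + d \<cdot>\<^sub>m S"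
  have P: "P \<in> carrier_mat n n" "P\<^sup>T = P" unfolding P_def using P0 S
    by (auto simp: transpose_add[of _ n n] transpose_smult_mat)
  have P_form: "u \<bullet> (P *\<^sub>v v) = u \<bullet> (P\<^sub>0 *\<^sub>v v) + d * (u \<bullet> (S *\<^sub>v v))"
    if "u \<in> carrier_vec n" "v \<in> carrier_vec n" for u v
    unfolding P_def using P0 S that
    by (simp add: add_mult_distrib_mat_vec[of _ n n] scalar_prod_add_distrib[of _ n] smult_mat_mult_vec)
  have P_pos: "0 < v \<bullet> (P *\<^sub>v v)" if v: "v \<in> carrier_vec n" "v \<noteq> 0\<^sub>v n" for v
  proof -
    have "\<exists>i<n. v $ i \<noteq> 0"
    proof (rule ccontr)
      assume "\<not> (\<exists>i<n. v $ i \<noteq> 0)"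
      then have "v = 0\<^sub>v n" using v(1) by (intro eq_vecI) auto
      then show False using v(2) by simp
    qed
    then obtain i where "i < n" "v $ i \<noteq> 0" by blast
    then have "0 < (\<Sum>i<n. (v $ i)\<^sup>2)" by (intro sum_pos2[of _ i]) auto
    then have "0 < v \<bullet> (S *\<^sub>v v)" using S_ge[OF v(1)] scalar_prod_self[OF v(1)] by simp
    then have "0 < d * (v \<bullet> (S *\<^sub>v v))" using d by simp
    then show ?thesis unfolding P_form[OF v(1) v(1)] using P0_nonneg[OF v(1)] by simp
  qed
  define \<beta> where "\<beta> = ?b \<bullet> (P *\<^sub>v ?b)"
  have \<beta>: "0 < \<beta>" unfolding \<beta>_def by (rule P_pos[OF b B0])
  have "\<beta> = \<gamma> - 1 + d * s" unfolding \<beta>_def s_def P_form[OF b b] P0_b ..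
  then have \<sigma>\<beta>: "(1 - \<sigma>) * (1 + \<beta>) < 1" using \<sigma>d by simp
  have main: "(M *\<^sub>v v) \<bullet> (P *\<^sub>v (M *\<^sub>v v)) - \<sigma> * (((M *\<^sub>v v) \<bullet> (P *\<^sub>v ?b))\<^sup>2 * inverse \<beta>) < v \<bullet> (P *\<^sub>v v)"
    if v: "v \<in> carrier_vec n" "v \<noteq> 0\<^sub>v n" for v
  proof -
    define q where "q = (M *\<^sub>v v) \<bullet> (P *\<^sub>v (M *\<^sub>v v))"
    define g where "g = (M *\<^sub>v v) \<bullet> (P *\<^sub>v ?b)"
    define k where "k = (K *\<^sub>v v) $ 0"
    have Mv: "M *\<^sub>v v \<in> carrier_vec n" using M v by simp
    have Fv: "F *\<^sub>v v \<in> carrier_vec n" using F v by simp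
    have PMv: "P *\<^sub>v (M *\<^sub>v v) \<in> carrier_vec n" and Pb: "P *\<^sub>v ?b \<in> carrier_vec n" using P Mv b by auto
    have "F *\<^sub>v v = c \<cdot>\<^sub>v (M *\<^sub>v v) + k \<cdot>\<^sub>v ?b"
      unfolding F_def k_def rank_one_feedback_mult_vec[OF cM B K v(1)] using M v
      by (simp add: smult_mat_mult_vec)
    then have "(F *\<^sub>v v) \<bullet> (P *\<^sub>v (F *\<^sub>v v)) = c\<^sup>2 * q + 2 * k * (c * g) + k\<^sup>2 * \<beta>"
      using quadratic_form_add_smult[OF P, of "c \<cdot>\<^sub>v (M *\<^sub>v v)" ?b k] Mv b P PMv Pb
      unfolding q_def g_def \<beta>_def by (simp add: mult_mat_vec[of _ n n] power2_eq_square mult.assoc)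
    \<comment> \<open>The part \<open>P\<^sub>0\<close> contributes with equality, by its Stein
      equation, and \<open>S\<close> through its weak decrease.\<close>
    moreover have "(F *\<^sub>v v) \<bullet> (P *\<^sub>v (F *\<^sub>v v)) + k\<^sup>2 \<le> v \<bullet> (P *\<^sub>v v)"
      unfolding P_form[OF Fv Fv] P_form[OF v(1) v(1)] P0_stein[OF v(1), symmetric] k_def
      using S_dec[OF v(1)] d by simp
    ultimately have le: "c\<^sup>2 * q + 2 * k * (c * g) + k\<^sup>2 * (1 + \<beta>) \<le> v \<bullet> (P *\<^sub>v v)"
      by (simp add: algebra_simps)
    \<comment> \<open>Completing the square replaces the actual input \<open>k\<close> by the best
      one and so eliminates the feedback from the inequality.\<close>
    have "0 \<le> (c * g + k * (1 + \<beta>))\<^sup>2 / (1 + \<beta>)" using \<beta> by simp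
    also have "\<dots> = (c * g)\<^sup>2 / (1 + \<beta>) + 2 * k * (c * g) + k\<^sup>2 * (1 + \<beta>)"
      using \<beta> by (simp add: field_simps power2_eq_square)
    finally have "c\<^sup>2 * q - (c * g)\<^sup>2 / (1 + \<beta>) \<le> v \<bullet> (P *\<^sub>v v)" using le by simp
    moreover have "(c * g)\<^sup>2 / (1 + \<beta>) \<le> \<sigma> * ((c * g)\<^sup>2 * inverse \<beta>)"
    proof -
      \<comment> \<open>Here the threshold enters: \<sigma> is at least \<beta> / (1 +
        \<beta>).\<close>
      have "\<beta> \<le> \<sigma> * (1 + \<beta>)" using \<sigma>\<beta> by (simp add: algebra_simps)
      then have "1 / (1 + \<beta>) \<le> \<sigma> * inverse \<beta>" using \<beta> by (simp add: field_simps)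
      from mult_left_mono[OF this, of "(c * g)\<^sup>2"] show ?thesis by (simp add: mult_ac)
    qed
    ultimately have "c\<^sup>2 * (q - \<sigma> * (g\<^sup>2 * inverse \<beta>)) \<le> v \<bullet> (P *\<^sub>v v)"
      by (simp add: power_mult_distrib algebra_simps)
    moreover have "0 < v \<bullet> (P *\<^sub>v v)" by (rule P_pos[OF v])
    moreover have "1 < c\<^sup>2" using c by simp
    \<comment> \<open>If the left side is not positive, positivity of the right side suffices;
      otherwise dividing by \<open>c\<^sup>2 > 1\<close> makes the bound strict.\<close>
    ultimately have "q - \<sigma> * (g\<^sup>2 * inverse \<beta>) < v \<bullet> (P *\<^sub>v v)"
      by (smt (verit) mult_le_cancel_right1 mult_less_cancel_right1)
    then show ?thesis unfolding q_def g_def .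
  qed
  have "positive_definite n P" unfolding positive_definite_def using P P_pos by auto
  then show ?thesis
    unfolding riccati_solution_iff[OF M B] using main unfolding \<beta>_def by blast
qed

section \<open>Scaling the spectrum off the unit circle\<close>

lemma hautus_smult:
  assumes "hautus n M B" "M \<in> carrier_mat n n" "c \<noteq> 0"
  shows "hautus n (c \<cdot>\<^sub>m M) B"
  unfolding hautus_def
proof (intro ballI allI impI, elim conjE)
  fix w z assume w: "w \<in> carrier_mat 1 n" and ev: "w * (c \<cdot>\<^sub>m M) = z \<cdot>\<^sub>m w" and wB: "w * B = 0\<^sub>m 1 1"
  have "c \<cdot>\<^sub>m (w * M) = z \<cdot>\<^sub>m w" using ev w assms(2) by (simp add: mat_dim_simps)
  then have eq: "(c \<cdot>\<^sub>m (w * M)) $$ (i, j) = (z \<cdot>\<^sub>m w) $$ (i, j)" for i j by simp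
  have "w * M = (z / c) \<cdot>\<^sub>m w"
  proof (rule eq_matI)
    fix i j assume "i < dim_row ((z / c) \<cdot>\<^sub>m w)" "j < dim_col ((z / c) \<cdot>\<^sub>m w)"
    then show "(w * M) $$ (i, j) = ((z / c) \<cdot>\<^sub>m w) $$ (i, j)"
      using eq[of i j] assms(2,3) w by (simp add: field_simps del: index_mult_mat(1))
  qed (use w assms(2) in auto)
  then show "w = 0\<^sub>m 1 n" using assms(1) w wB unfolding hautus_def by blast
qed

lemma char_poly_smult_mat:
  fixes M :: "complex mat"
  assumes M: "M \<in> carrier_mat n n" and cp: "char_poly M = (\<Prod>e\<leftarrow>es. [:-e, 1:])"
  shows "char_poly (c \<cdot>\<^sub>m M) = (\<Prod>e\<leftarrow>map ((*) c) es. [:-e, 1:])"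
proof -
  obtain T P Q where "schur_decomposition M es = (T, P, Q)" by (metis prod_cases3)
  from schur_decomposition[OF M cp this]
  have sim: "similar_mat_wit M T P Q" and ut: "upper_triangular T" and dg: "diag_mat T = es"
    by auto
  have T: "T \<in> carrier_mat n n" using similar_mat_witD2[OF M sim] by simp
  have cT: "c \<cdot>\<^sub>m T \<in> carrier_mat n n" using T by simp
  have "char_poly (c \<cdot>\<^sub>m M) = char_poly (c \<cdot>\<^sub>m T)"
    using similar_mat_wit_smult[OF sim] by (intro char_poly_similar) (auto simp: similar_mat_def)
  also have "\<dots> = (\<Prod>e\<leftarrow>diag_mat (c \<cdot>\<^sub>m T). [:-e, 1:])"
    by (rule char_poly_upper_triangular[OF cT]) (use ut T in \<open>auto simp: upper_triangular_def\<close>)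
  also have "diag_mat (c \<cdot>\<^sub>m T) = map ((*) c) (diag_mat T)" using T by (auto simp: diag_mat_def)
  finally show ?thesis unfolding dg .
qed

lemma proots_prod_linear: "proots (\<Prod>e\<leftarrow>es. [:-e, 1:]) = mset es" for es :: "complex list"
proof (induction es)
  case (Cons e es)
  have "(\<Prod>e\<leftarrow>es. [:-e, 1:]) \<noteq> 0" by (auto simp: prod_list_zero_iff)
  then show ?case using Cons by (simp add: proots_mult del: mult_pCons_left)
qed simp

text \<open>Eigenvalues on the unit circle count as unstable, yet they are fixed by the reflection.
  A factor \<open>c\<close> slightly above 1 pushes them outside, keeps the finitely many stable
  eigenvalues inside, and by continuity preserves the strict bound on \<sigma>.\<close>

lemma riccati_solution_exists:
  fixes M B :: "real mat"
  assumes M: "M \<in> carrier_mat n n" and B: "B \<in> carrier_mat n 1" and B0: "col B 0 \<noteq> 0\<^sub>v n"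
    and pbh: "hautus n (map_mat complex_of_real M) (map_mat complex_of_real B)"
    and \<sigma>: "1 - 1 / (\<Prod>z\<in>#unstable_eigenvalues M. (cmod z)\<^sup>2) < \<sigma>"
  shows "\<exists>P. riccati_solution n M B \<sigma> P"
proof -
  let ?c = "map_mat complex_of_real"
  have Mc: "?c M \<in> carrier_mat n n" using M by simp
  obtain es where cp: "char_poly (?c M) = (\<Prod>e\<leftarrow>es. [:-e, 1:])"
    using char_poly_factorized[OF Mc] by auto
  define us where "us = filter (\<lambda>z. 1 \<le> cmod z) es"
  define ss where "ss = filter (\<lambda>z. \<not> 1 \<le> cmod z) es"
  have mset_es: "mset es = mset (ss @ us)" unfolding us_def ss_def
    by (subst multiset_partition[of _ "\<lambda>z. 1 \<le> cmod z"]) (simp add: add.commute)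
  define \<gamma> where "\<gamma> = (\<Prod>l\<leftarrow>us. (cmod l)\<^sup>2)"
  have "unstable_eigenvalues M = mset us"
    unfolding unstable_eigenvalues_def cp proots_prod_linear us_def by simp
  then have \<gamma>: "(\<Prod>z\<in>#unstable_eigenvalues M. (cmod z)\<^sup>2) = \<gamma>"
    unfolding \<gamma>_def by (simp flip: prod_mset_prod_list)
  have us1: "\<forall>l \<in> set us. 1 \<le> cmod l" and ss1: "\<forall>l \<in> set ss. cmod l < 1"
    unfolding us_def ss_def by auto
  have "0 < \<gamma>" unfolding \<gamma>_def using us1 by (induction us) (auto intro!: mult_pos_pos)
  then have \<sigma>\<gamma>: "(1 - \<sigma>) * \<gamma> < 1" using \<sigma> unfolding \<gamma> by (simp add: field_simps)
  have prod_scale: "(\<Prod>l\<leftarrow>map ((*) (complex_of_real c)) xs. (cmod l)\<^sup>2) = (c\<^sup>2) ^ length xs * (\<Prod>l\<leftarrow>xs. (cmod l)\<^sup>2)"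
    for c xs by (induction xs) (auto simp: norm_mult power_mult_distrib)
  have "((\<lambda>c. (1 - \<sigma>) * ((c\<^sup>2) ^ length us * \<gamma>)) \<longlongrightarrow> (1 - \<sigma>) * ((1\<^sup>2) ^ length us * \<gamma>)) (at_right 1)"
    by (intro tendsto_intros)
  from order_tendstoD(2)[OF this, of 1]
  have ev1: "\<forall>\<^sub>F c in at_right 1. (1 - \<sigma>) * ((c\<^sup>2) ^ length us * \<gamma>) < 1" using \<sigma>\<gamma> by simp
  have "\<forall>\<^sub>F c in at_right 1. c * cmod l < 1" if "l \<in> set ss" for l
  proof -
    have "((\<lambda>c. c * cmod l) \<longlongrightarrow> 1 * cmod l) (at_right 1)" by (intro tendsto_intros)
    from order_tendstoD(2)[OF this, of 1] show ?thesis using ss1 that by simp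
  qed
  then have ev2: "\<forall>\<^sub>F c in at_right 1. \<forall>l\<in>set ss. c * cmod l < 1"
    by (simp add: eventually_ball_finite_distrib)
  have "\<forall>\<^sub>F c in at_right (1::real). 1 < c \<and> (1 - \<sigma>) * ((c\<^sup>2) ^ length us * \<gamma>) < 1 \<and> (\<forall>l\<in>set ss. c * cmod l < 1)"
    using eventually_at_right_less[of 1] ev1 ev2 by eventually_elim auto
  then obtain c where c: "1 < c" and c\<sigma>: "(1 - \<sigma>) * ((c\<^sup>2) ^ length us * \<gamma>) < 1"
    and css: "\<forall>l\<in>set ss. c * cmod l < 1"
    by (auto dest!: eventually_happens)
  have cMc: "?c (c \<cdot>\<^sub>m M) = complex_of_real c \<cdot>\<^sub>m ?c M" by (rule map_of_real_smult)
  let ?us = "map ((*) (complex_of_real c)) us" and ?ss = "map ((*) (complex_of_real c)) ss"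
  show ?thesis
  proof (rule riccati_solution_of_scaled_pair[OF M B B0 _ c])
    show "hautus n (?c (c \<cdot>\<^sub>m M)) (?c B)"
      unfolding cMc by (rule hautus_smult[OF pbh Mc]) (use c in simp)
    have "char_poly (?c (c \<cdot>\<^sub>m M)) = (\<Prod>e\<leftarrow>map ((*) (complex_of_real c)) es. [:-e, 1:])"
      unfolding cMc by (rule char_poly_smult_mat[OF Mc cp])
    \<comment> \<open>The factors are compared as multisets because \<open>es\<close> is only a
      permutation of \<open>ss @ us\<close>.\<close>
    also have "\<dots> = prod_mset (image_mset (\<lambda>e. [:- (complex_of_real c * e), 1:]) (mset es))"
      by (simp add: o_def flip: prod_mset_prod_list)
    also have "\<dots> = (\<Prod>e\<leftarrow>?ss @ ?us. [:-e, 1:])"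
      unfolding mset_es by (simp add: o_def flip: prod_mset_prod_list)
    finally show "char_poly (?c (c \<cdot>\<^sub>m M)) = (\<Prod>e\<leftarrow>?ss @ ?us. [:-e, 1:])" .
    show "\<forall>l\<in>set ?us. 1 < cmod l"
    proof
      fix l assume "l \<in> set ?us"
      then obtain u where u: "u \<in> set us" "l = complex_of_real c * u" by auto
      have "1 * 1 < c * cmod u" using c us1 u(1) by (intro mult_less_le_imp_less) auto
      then show "1 < cmod l" using c u(2) by (simp add: norm_mult)
    qed
    show "\<forall>l\<in>set ?ss. cmod l < 1" using css c by (auto simp: norm_mult)
    show "(1 - \<sigma>) * (\<Prod>l\<leftarrow>?us. (cmod l)\<^sup>2) < 1" unfolding prod_scale using c\<sigma> unfolding \<gamma>_def .
  qed
qed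

section \<open>Stability of the modes\<close>

text \<open>For a complex eigenvector \<open>x + i y\<close> the real span of \<open>x\<close> and
  \<open>y\<close> is invariant under \<open>A\<close>. In \<open>q (A x) + q (A y)\<close> the
  mixed terms occur with opposite signs and cancel, which leaves
  \<open>|z|^2 (q x + q y)\<close>.\<close>

lemma lyapunov_imp_schur_stable:
  fixes A P :: "real mat"
  assumes A: "A \<in> carrier_mat n n" and P: "P \<in> carrier_mat n n"
    and pos: "\<And>v. v \<in> carrier_vec n \<Longrightarrow> v \<noteq> 0\<^sub>v n \<Longrightarrow> 0 < v \<bullet> (P *\<^sub>v v)"
    and dec: "\<And>v. v \<in> carrier_vec n \<Longrightarrow> v \<noteq> 0\<^sub>v n \<Longrightarrow> (A *\<^sub>v v) \<bullet> (P *\<^sub>v (A *\<^sub>v v)) < v \<bullet> (P *\<^sub>v v)"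
  shows "schur_stable A"
  unfolding schur_stable_def
proof (intro allI impI)
  fix z assume "eigenvalue (map_mat complex_of_real A) z"
  then obtain v where v: "v \<in> carrier_vec n" "v \<noteq> 0\<^sub>v n"
    and ev: "map_mat complex_of_real A *\<^sub>v v = z \<cdot>\<^sub>v v"
    using A unfolding eigenvalue_def eigenvector_def by auto
  define x where "x = map_vec Re v"
  define y where "y = map_vec Im v"
  have x: "x \<in> carrier_vec n" and y: "y \<in> carrier_vec n" unfolding x_def y_def using v by auto
  have ev_i: "(\<Sum>j<n. complex_of_real (A $$ (i, j)) * v $ j) = z * v $ i" if "i < n" for i
  proof -
    have "(map_mat complex_of_real A *\<^sub>v v) $ i = (\<Sum>j<n. complex_of_real (A $$ (i, j)) * v $ j)"
      using A v that by (auto simp: scalar_prod_def lessThan_atLeast0 intro!: sum.cong)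
    then show ?thesis unfolding ev using v that by simp
  qed
  have A_i: "(A *\<^sub>v u) $ i = (\<Sum>j<n. A $$ (i, j) * u $ j)" if "i < n" "u \<in> carrier_vec n" for i u
    using A that by (auto simp: scalar_prod_def lessThan_atLeast0 intro!: sum.cong)
  have Ax: "A *\<^sub>v x = Re z \<cdot>\<^sub>v x + (- Im z) \<cdot>\<^sub>v y"
  proof (rule eq_vecI)
    fix i assume "i < dim_vec (Re z \<cdot>\<^sub>v x + (- Im z) \<cdot>\<^sub>v y)"
    then have i: "i < n" using y by simp
    show "(A *\<^sub>v x) $ i = (Re z \<cdot>\<^sub>v x + (- Im z) \<cdot>\<^sub>v y) $ i"
      using arg_cong[OF ev_i[OF i], of Re] i v x y unfolding A_i[OF i x] by (simp add: x_def y_def)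
  qed (use A y in auto)
  have Ay: "A *\<^sub>v y = Re z \<cdot>\<^sub>v y + Im z \<cdot>\<^sub>v x"
  proof (rule eq_vecI)
    fix i assume "i < dim_vec (Re z \<cdot>\<^sub>v y + Im z \<cdot>\<^sub>v x)"
    then have i: "i < n" using x by simp
    show "(A *\<^sub>v y) $ i = (Re z \<cdot>\<^sub>v y + Im z \<cdot>\<^sub>v x) $ i"
      using arg_cong[OF ev_i[OF i], of Im] i v x y unfolding A_i[OF i y] by (simp add: x_def y_def)
  qed (use A x in auto)
  define q where "q u = u \<bullet> (P *\<^sub>v u)" for u
  have form: "(r \<cdot>\<^sub>v u + s \<cdot>\<^sub>v w) \<bullet> (P *\<^sub>v (r \<cdot>\<^sub>v u + s \<cdot>\<^sub>v w))
      = r\<^sup>2 * q u + r * s * (u \<bullet> (P *\<^sub>v w) + w \<bullet> (P *\<^sub>v u)) + s\<^sup>2 * q w"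
    if "u \<in> carrier_vec n" "w \<in> carrier_vec n" for r s u w
  proof -
    have Pu: "P *\<^sub>v u \<in> carrier_vec n" and Pw: "P *\<^sub>v w \<in> carrier_vec n" using P that by auto
    have "P *\<^sub>v (r \<cdot>\<^sub>v u + s \<cdot>\<^sub>v w) = r \<cdot>\<^sub>v (P *\<^sub>v u) + s \<cdot>\<^sub>v (P *\<^sub>v w)"
      using P that by (simp add: mult_add_distrib_mat_vec[of _ n n] mult_mat_vec[of _ n n])
    then show ?thesis unfolding q_def using that Pu Pw
      by (simp add: scalar_prod_add_distrib[of _ n] add_scalar_prod_distrib[of _ n] algebra_simps power2_eq_square)
  qed
  have "q (A *\<^sub>v x) + q (A *\<^sub>v y) = (cmod z)\<^sup>2 * (q x + q y)"
    unfolding Ax Ay q_def[of "_ + _"] form[OF x y] form[OF y x] cmod_power2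
    by (simp add: algebra_simps)
  moreover have "x \<noteq> 0\<^sub>v n \<or> y \<noteq> 0\<^sub>v n"
  proof (rule ccontr)
    assume "\<not> (x \<noteq> 0\<^sub>v n \<or> y \<noteq> 0\<^sub>v n)"
    then have x0: "x $ i = 0" and y0: "y $ i = 0" if "i < n" for i using that by auto
    have "v $ i = 0" if "i < n" for i
      using x0[OF that] y0[OF that] that v unfolding x_def y_def by (simp add: complex_eq_iff)
    then have "v = 0\<^sub>v n" using v by (intro eq_vecI) auto
    then show False using v(2) by simp
  qed
  moreover have lt: "q (A *\<^sub>v u) < q u" "0 < q u" if "u \<in> carrier_vec n" "u \<noteq> 0\<^sub>v n" for u
    using pos[OF that] dec[OF that] unfolding q_def by auto
  \<comment> \<open>One of \<open>x\<close> and \<open>y\<close> may vanish, as for a real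
    eigenvector; the weak inequalities cover that summand.\<close>
  moreover have "q (A *\<^sub>v u) \<le> q u" "0 \<le> q u" if u: "u \<in> carrier_vec n" for u
  proof -
    have A0: "A *\<^sub>v 0\<^sub>v n = 0\<^sub>v n" using A by (intro eq_vecI) auto
    have "q (0\<^sub>v n) = 0" using P unfolding q_def by simp
    then show "q (A *\<^sub>v u) \<le> q u" "0 \<le> q u" using lt[OF u] A0 by (cases "u = 0\<^sub>v n"; simp)+
  qed
  note le = this[OF x] this[OF y]
  ultimately have "(cmod z)\<^sup>2 * (q x + q y) < q x + q y" "0 < q x + q y"
    using le lt[OF x] lt[OF y] by linarith+
  then have "(cmod z)\<^sup>2 < 1" by (simp add: mult_less_cancel_right1)
  then show "cmod z < 1" by (simp add: power_less_one_iff abs_square_less_1)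
qed

section \<open>From the Kalman rank condition to the Hautus test\<close>

lemma controllable_iff_det:
  "controllable n A B \<longleftrightarrow> det (mat_of_cols n (map (\<lambda>k. col (A ^\<^sub>m k * B) 0) [0..<n])) \<noteq> 0"
  unfolding controllable_def by (rule vec_space.det_rank_iff[symmetric]) (auto intro: carrier_matI)

text \<open>If \<open>w\<close> is a left eigenvector with \<open>w B = 0\<close>, then
  \<open>w A^k B = z^k w B = 0\<close> for all \<open>k\<close>, so \<open>w\<close> annihilates
  every column of the Kalman matrix, which is nonsingular.\<close>

lemma controllable_imp_hautus:
  fixes A B :: "real mat"
  assumes A: "A \<in> carrier_mat n n" and B: "B \<in> carrier_mat n 1" and ctrl: "controllable n A B"
  shows "hautus n (map_mat complex_of_real A) (map_mat complex_of_real B)"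
  unfolding hautus_def
proof (intro ballI allI impI, elim conjE)
  let ?c = "map_mat complex_of_real"
  fix w z assume w: "w \<in> carrier_mat 1 n" and ev: "w * ?c A = z \<cdot>\<^sub>m w" and wB: "w * ?c B = 0\<^sub>m 1 1"
  define C where "C = mat_of_cols n (map (\<lambda>k. col (A ^\<^sub>m k * B) 0) [0..<n])"
  have C: "C \<in> carrier_mat n n" unfolding C_def by (intro carrier_matI) auto
  have "det C \<noteq> 0" using ctrl unfolding controllable_iff_det C_def .
  then have det: "det (?c C)\<^sup>T \<noteq> 0" using C by (simp add: det_transpose)
  have wAk: "w * ?c (A ^\<^sub>m k * B) = 0\<^sub>m 1 1" for k
  proof -
    have Ak: "A ^\<^sub>m k \<in> carrier_mat n n" for k using A by simp
    have "w * ?c (A ^\<^sub>m k) = z ^ k \<cdot>\<^sub>m w"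
    proof (induction k)
      case 0
      have "?c (1\<^sub>m n) = 1\<^sub>m n" by (rule eq_matI) auto
      then show ?case using A w by auto
    next
      case (Suc k)
      have "w * ?c (A ^\<^sub>m Suc k) = (w * ?c (A ^\<^sub>m k)) * ?c A"
        using A w carrier_matD[OF Ak[of k]] by (simp add: map_of_real_mult mat_dim_simps)
      also have "\<dots> = z ^ k \<cdot>\<^sub>m (z \<cdot>\<^sub>m w)"
        unfolding Suc ev[symmetric] using w A by (simp add: mat_dim_simps)
      finally show ?case by (auto simp: mult_ac intro!: eq_matI)
    qed
    then have "w * ?c (A ^\<^sub>m k * B) = z ^ k \<cdot>\<^sub>m (w * ?c B)"
      using B w carrier_matD[OF Ak[of k]] by (simp add: map_of_real_mult mat_dim_simps flip: mult_mat_assoc_dim)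
    then show ?thesis unfolding wB by simp
  qed
  have "(?c C)\<^sup>T *\<^sub>v row w 0 = 0\<^sub>v n"
  proof (rule eq_vecI)
    fix k assume "k < dim_vec (0\<^sub>v n :: complex vec)"
    then have k: "k < n" by simp
    have col: "col (?c C) k = col (?c (A ^\<^sub>m k * B)) 0"
      using k A B by (intro eq_vecI) (auto simp: C_def mat_of_cols_index pow_mat_dim_square[OF A] simp del: index_mult_mat(1))
    have "((?c C)\<^sup>T *\<^sub>v row w 0) $ k = col (?c C) k \<bullet> row w 0" using C k by simp
    also have "\<dots> = row w 0 \<bullet> col (?c (A ^\<^sub>m k * B)) 0"
      unfolding col using w A
      by (intro comm_scalar_prod[of _ n]) (auto simp: pow_mat_dim_square[OF A] intro!: carrier_vecI)
    also have "\<dots> = (w * ?c (A ^\<^sub>m k * B)) $$ (0, 0)" using w B by simp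
    finally show "((?c C)\<^sup>T *\<^sub>v row w 0) $ k = 0\<^sub>v n $ k" unfolding wAk using k by simp
  qed (use C in auto)
  moreover have "row w 0 \<in> carrier_vec n" using w by auto
  ultimately have "row w 0 = 0\<^sub>v n"
    using det det_0_iff_vec_prod_zero_field[of "(?c C)\<^sup>T" n] C by auto
  then have w0: "row w 0 $ j = 0" if "j < n" for j using that by simp
  have "w $$ (0, j) = 0" if "j < n" for j using w0[OF that] w that by simp
  then show "w = 0\<^sub>m 1 n" using w by (intro eq_matI) auto
qed

text \<open>Guarantees \<open>b^T P b > 0\<close> for positive definite \<open>P\<close>. In
  dimension 0 the empty determinant is 1 and the claim would fail.\<close>

lemma controllable_imp_nonzero_input:
  fixes A B :: "real mat"
  assumes A: "A \<in> carrier_mat n n" and B: "B \<in> carrier_mat n 1" and ctrl: "controllable n A B"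
    and n: "0 < n"
  shows "col B 0 \<noteq> 0\<^sub>v n"
proof
  assume B0: "col B 0 = 0\<^sub>v n"
  define C where "C = mat_of_cols n (map (\<lambda>k. col (A ^\<^sub>m k * B) 0) [0..<n])"
  have C: "C \<in> carrier_mat n n" unfolding C_def by (intro carrier_matI) auto
  have "det C \<noteq> 0" using ctrl unfolding controllable_iff_det C_def .
  moreover have "B = 0\<^sub>m n 1"
  proof (rule eq_matI)
    fix i j assume "i < dim_row (0\<^sub>m n 1 :: real mat)" "j < dim_col (0\<^sub>m n 1 :: real mat)"
    then show "B $$ (i, j) = 0\<^sub>m n 1 $$ (i, j)"
      using arg_cong[OF B0, of "\<lambda>v. v $ i"] B by simp
  qed (use B in auto)
  then have "C = 0\<^sub>m n n"
    using A unfolding C_def by (auto simp: mat_of_cols_index pow_mat_dim_square[OF A] intro!: eq_matI)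
  ultimately show False using n by simp
qed

section \<open>Laplacians and modal coordinates\<close>

lemma neighbors_subset: "weighted_graph N E w \<Longrightarrow> neighbors E i \<subseteq> {..<N}"
  unfolding weighted_graph_def neighbors_def by auto

lemma laplacian_carrier [simp]: "laplacian N E w \<in> carrier_mat N N"
  unfolding laplacian_def adjacency_def by (simp add: minus_carrier_mat)

lemma sum_neighbors:
  fixes f :: "nat \<Rightarrow> real"
  assumes "weighted_graph N E w"
  shows "(\<Sum>l<N. if (i, l) \<in> E then f l else 0) = (\<Sum>l\<in>neighbors E i. f l)"
proof -
  have E: "{l \<in> {..<N}. (i, l) \<in> E} = neighbors E i"
    using neighbors_subset[OF assms, of i] unfolding neighbors_def by auto
  show ?thesis unfolding E[symmetric] by (rule sum.inter_filter[symmetric]) simp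
qed

text \<open>Translates the neighbour sums of the dynamics into the matrix that \<Phi>
  diagonalises.\<close>

lemma laplacian_apply:
  fixes y :: "nat \<Rightarrow> real"
  assumes G: "weighted_graph N E w" and i: "i < N"
  shows "(\<Sum>l<N. laplacian N E w $$ (i, l) * y l) = (\<Sum>l\<in>neighbors E i. w i l * (y i - y l))"
proof -
  have "(\<Sum>l<N. laplacian N E w $$ (i, l) * y l)
      = (\<Sum>l<N. (if l = i then (\<Sum>j\<in>neighbors E i. w i j) * y i else 0) - (if (i, l) \<in> E then w i l * y l else 0))"
    using i by (intro sum.cong) (auto simp: laplacian_def adjacency_def mat_diag_def algebra_simps)
  also have "\<dots> = (\<Sum>j\<in>neighbors E i. w i j) * y i - (\<Sum>l\<in>neighbors E i. w i l * y l)"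
    unfolding sum_subtractf sum_neighbors[OF G] using i by simp
  also have "\<dots> = (\<Sum>l\<in>neighbors E i. w i l * (y i - y l))"
    by (simp add: sum_distrib_right sum_subtractf right_diff_distrib)
  finally show ?thesis .
qed

lemma orthonormal_cols:
  assumes "diagonalizes_laplacians N \<Phi> Lp Lc lp lc" "i < N" "j < N"
  shows "(\<Sum>k<N. \<Phi> $$ (k, i) * \<Phi> $$ (k, j)) = (if i = j then 1 else 0)"
proof -
  have \<Phi>: "\<Phi> \<in> carrier_mat N N" "\<Phi>\<^sup>T * \<Phi> = 1\<^sub>m N"
    using assms(1) unfolding diagonalizes_laplacians_def by auto
  have "(\<Sum>k<N. \<Phi> $$ (k, i) * \<Phi> $$ (k, j)) = (\<Phi>\<^sup>T * \<Phi>) $$ (i, j)"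
    using \<Phi>(1) assms(2,3) by (auto simp: scalar_prod_def lessThan_atLeast0)
  then show ?thesis unfolding \<Phi>(2) using assms(2,3) by simp
qed

lemma orthonormal_rows:
  assumes "diagonalizes_laplacians N \<Phi> Lp Lc lp lc" "i < N" "j < N"
  shows "(\<Sum>k<N. \<Phi> $$ (i, k) * \<Phi> $$ (j, k)) = (if i = j then 1 else 0)"
proof -
  have \<Phi>: "\<Phi> \<in> carrier_mat N N" "\<Phi>\<^sup>T * \<Phi> = 1\<^sub>m N"
    using assms(1) unfolding diagonalizes_laplacians_def by auto
  have \<Phi>': "\<Phi> * \<Phi>\<^sup>T = 1\<^sub>m N" using mat_mult_left_right_inverse[OF _ \<Phi>(1) \<Phi>(2)] \<Phi>(1) by simp
  have "(\<Sum>k<N. \<Phi> $$ (i, k) * \<Phi> $$ (j, k)) = (\<Phi> * \<Phi>\<^sup>T) $$ (i, j)"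
    using \<Phi>(1) assms(2,3) by (auto simp: scalar_prod_def lessThan_atLeast0)
  then show ?thesis unfolding \<Phi>' using assms(2,3) by simp
qed

text \<open>As \<Phi> is square, its left inverse is two-sided, so
  \<open>\<Phi>^T L = diag l * \<Phi>^T\<close>. The function \<open>y\<close> is arbitrary: it will
  be one state component across all agents.\<close>

lemma modal_eigenvalue:
  fixes L \<Phi> :: "real mat" and y :: "nat \<Rightarrow> real"
  assumes \<Phi>: "\<Phi> \<in> carrier_mat N N" "\<Phi>\<^sup>T * \<Phi> = 1\<^sub>m N" and L: "L \<in> carrier_mat N N"
    and dg: "\<Phi>\<^sup>T * L * \<Phi> = mat_diag N l" and i: "i < N"
  shows "(\<Sum>j<N. \<Phi> $$ (j, i) * (\<Sum>k<N. L $$ (j, k) * y k)) = l i * (\<Sum>k<N. \<Phi> $$ (k, i) * y k)"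
proof -
  have \<Phi>': "\<Phi> * \<Phi>\<^sup>T = 1\<^sub>m N" using mat_mult_left_right_inverse[OF _ \<Phi>(1) \<Phi>(2)] \<Phi>(1) by simp
  have "\<Phi>\<^sup>T * L = (\<Phi>\<^sup>T * L) * (\<Phi> * \<Phi>\<^sup>T)" unfolding \<Phi>' using \<Phi>(1) L by simp
  also have "\<dots> = mat_diag N l * \<Phi>\<^sup>T"
    unfolding dg[symmetric] using \<Phi>(1) L by (simp add: mat_dim_simps)
  finally have eq: "\<Phi>\<^sup>T * L = mat_diag N l * \<Phi>\<^sup>T" .
  have "(\<Sum>j<N. \<Phi> $$ (j, i) * L $$ (j, k)) = l i * \<Phi> $$ (k, i)" if "k < N" for k
  proof -
    have "(\<Sum>j<N. \<Phi> $$ (j, i) * L $$ (j, k)) = (\<Phi>\<^sup>T * L) $$ (i, k)"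
      using \<Phi>(1) L i that by (auto simp: scalar_prod_def lessThan_atLeast0)
    also have "\<dots> = l i * \<Phi> $$ (k, i)" unfolding eq using \<Phi>(1) i that by (simp add: mat_diag_mult_left[of _ N N])
    finally show ?thesis .
  qed
  then have "(\<Sum>k<N. (\<Sum>j<N. \<Phi> $$ (j, i) * L $$ (j, k)) * y k) = (\<Sum>k<N. l i * \<Phi> $$ (k, i) * y k)"
    by (intro sum.cong) auto
  moreover have "(\<Sum>j<N. \<Phi> $$ (j, i) * (\<Sum>k<N. L $$ (j, k) * y k))
      = (\<Sum>k<N. (\<Sum>j<N. \<Phi> $$ (j, i) * L $$ (j, k)) * y k)"
    unfolding sum_distrib_left sum_distrib_right by (subst sum.swap) (simp add: mult.assoc)
  ultimately show ?thesis by (simp add: sum_distrib_left mult.assoc)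
qed

text \<open>Column \<open>j\<close> of \<Phi> is a unit vector on which the Laplacian form takes the
  value \<open>lc j\<close>, and twice this form is the weighted sum of squared differences along
  edges. If it is not positive, all these differences vanish, connectedness makes the column
  constant, and orthogonality to the constant column 0 forces it to be zero.\<close>

lemma connected_eigenvalue_pos:
  assumes G: "weighted_graph N E w" and conn: "connected_graph N E"
    and D: "diagonalizes_laplacians N \<Phi> Lp (laplacian N E w) lp lc" and j: "j \<in> {1..<N}"
  shows "0 < lc j"
proof (rule ccontr)
  assume neg: "\<not> 0 < lc j"
  have jN: "j < N" "0 < N" "j \<noteq> 0" using j by auto
  have \<Phi>: "\<Phi> \<in> carrier_mat N N" "\<Phi>\<^sup>T * \<Phi> = 1\<^sub>m N"
    and \<Phi>0: "col \<Phi> 0 = vec N (\<lambda>_. 1 / sqrt (real N))"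
    and dg: "\<Phi>\<^sup>T * laplacian N E w * \<Phi> = mat_diag N lc"
    using D unfolding diagonalizes_laplacians_def by auto
  define y where "y i = \<Phi> $$ (i, j)" for i
  \<comment> \<open>Weights carry meaning only on edges. The extension by 0 is symmetric and
    nonnegative everywhere, so the double sum may be taken over all pairs and swapped.\<close>
  define W where "W i l = (if (i, l) \<in> E then w i l else 0)" for i l
  have W_sym: "W i l = W l i" for i l
    using G unfolding W_def weighted_graph_def sym_def by auto
  have W_nonneg: "0 \<le> W i l" for i l
    using G unfolding W_def weighted_graph_def by (auto simp: less_imp_le)
  have y_norm: "(\<Sum>i<N. y i * y i) = 1"
    using orthonormal_cols[OF D jN(1) jN(1)] unfolding y_def by simp
  have nb: "(\<Sum>l\<in>neighbors E i. w i l * (y i - y l)) = (\<Sum>l<N. W i l * (y i - y l))" for i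
    unfolding sum_neighbors[OF G, symmetric] W_def by (intro sum.cong) auto
  define Q where "Q = (\<Sum>i<N. \<Sum>l<N. W i l * (y i * (y i - y l)))"
  have "lc j = lc j * (\<Sum>i<N. y i * y i)" unfolding y_norm by simp
  also have "\<dots> = (\<Sum>i<N. y i * (\<Sum>l<N. laplacian N E w $$ (i, l) * y l))"
    unfolding y_def by (rule modal_eigenvalue[OF \<Phi> _ dg jN(1), symmetric]) simp
  also have "\<dots> = Q" unfolding Q_def
  proof (intro sum.cong refl)
    fix i assume "i \<in> {..<N}"
    then have i: "i < N" by simp
    have "(\<Sum>l<N. laplacian N E w $$ (i, l) * y l) = (\<Sum>l<N. W i l * (y i - y l))"
      unfolding laplacian_apply[OF G i] by (rule nb)
    then have "y i * (\<Sum>l<N. laplacian N E w $$ (i, l) * y l) = y i * (\<Sum>l<N. W i l * (y i - y l))"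
      by (rule arg_cong)
    also have "\<dots> = (\<Sum>l<N. y i * (W i l * (y i - y l)))" by (rule sum_distrib_left)
    also have "\<dots> = (\<Sum>l<N. W i l * (y i * (y i - y l)))"
      by (rule sum.cong[OF refl], rule mult.left_commute)
    finally show "y i * (\<Sum>l<N. laplacian N E w $$ (i, l) * y l) = (\<Sum>l<N. W i l * (y i * (y i - y l)))" .
  qed
  finally have "Q \<le> 0" using neg by simp
  moreover have "Q + Q = (\<Sum>i<N. \<Sum>l<N. W i l * (y i - y l)\<^sup>2)"
  proof -
    have "Q = (\<Sum>i<N. \<Sum>l<N. W i l * (y l * (y l - y i)))"
      unfolding Q_def by (subst sum.swap) (simp add: W_sym)
    then have "Q + Q = (\<Sum>i<N. \<Sum>l<N. W i l * (y i * (y i - y l))) + (\<Sum>i<N. \<Sum>l<N. W i l * (y l * (y l - y i)))"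
      unfolding Q_def by simp
    also have "\<dots> = (\<Sum>i<N. \<Sum>l<N. W i l * (y i - y l)\<^sup>2)"
      unfolding sum.distrib[symmetric]
      by (intro sum.cong) (auto simp: power2_eq_square algebra_simps)
    finally show ?thesis .
  qed
  ultimately have le0: "(\<Sum>i<N. \<Sum>l<N. W i l * (y i - y l)\<^sup>2) \<le> 0" by simp
  have edge: "y i = y l" if il: "(i, l) \<in> E" for i l
  proof -
    have iN: "i < N" "l < N" and w: "0 < w i l" using il G unfolding weighted_graph_def by auto
    have "W i l * (y i - y l)\<^sup>2 \<le> (\<Sum>l<N. W i l * (y i - y l)\<^sup>2)"
      using iN W_nonneg by (intro member_le_sum[of l _ "\<lambda>l. W i l * (y i - y l)\<^sup>2"]) auto
    also have "\<dots> \<le> (\<Sum>i<N. \<Sum>l<N. W i l * (y i - y l)\<^sup>2)"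
      using iN W_nonneg by (intro member_le_sum[of i _ "\<lambda>i. \<Sum>l<N. W i l * (y i - y l)\<^sup>2"]) (auto intro!: sum_nonneg)
    finally have "w i l * (y i - y l)\<^sup>2 \<le> 0" using le0 il by (simp add: W_def)
    then have "(y i - y l)\<^sup>2 \<le> 0" using w by (simp add: mult_le_0_iff)
    then show ?thesis by simp
  qed
  have const: "y i = y 0" if "i < N" for i
  proof -
    have "(0, i) \<in> E\<^sup>*" using conn that jN unfolding connected_graph_def by auto
    then show ?thesis
    proof (induction rule: rtrancl_induct)
      case (step k l)
      then show ?case using edge[OF step(2)] by simp
    qed simp
  qed
  have \<Phi>_k0: "\<Phi> $$ (k, 0) = 1 / sqrt (real N)" if "k < N" for k
    using arg_cong[OF \<Phi>0, of "\<lambda>v. v $ k"] \<Phi>(1) that by simp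
  have "(\<Sum>k<N. 1 / sqrt (real N) * y 0) = (\<Sum>k<N. \<Phi> $$ (k, 0) * y k)"
    by (rule sum.cong[OF refl]) (metis \<Phi>_k0 const lessThan_iff)
  also have "\<dots> = 0" using orthonormal_cols[OF D jN(2,1)] jN(3) unfolding y_def by simp
  finally have y0: "y 0 = 0" using jN by simp
  have "(\<Sum>i<N. y i * y i) = 0"
    by (rule sum.neutral) (metis const y0 lessThan_iff mult_zero_left)
  then show False using y_norm by simp
qed

text \<open>The modal transformation mixes agents but not state components, so the dynamics is
  needed componentwise. The signs differ because the physical coupling uses \<open>x_j - x_i\<close>
  and the control \<open>x_i - x_j\<close>.\<close>

lemma trajectory_component:
  assumes tr: "trajectory N n Ep a Ec b A Ap B K x"
    and Gp: "weighted_graph N Ep a" and Gc: "weighted_graph N Ec b"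
    and A: "A \<in> carrier_mat n n" and Ap: "Ap \<in> carrier_mat n n" and B: "B \<in> carrier_mat n 1"
    and K: "K \<in> carrier_mat 1 n" and j: "j < N" and m: "m < n"
  shows "x (Suc t) j $ m = (\<Sum>k<n. A $$ (m, k) * x t j $ k)
      - (\<Sum>k<n. Ap $$ (m, k) * (\<Sum>l<N. laplacian N Ep a $$ (j, l) * x t l $ k))
      + (\<Sum>k<n. (B * K) $$ (m, k) * (\<Sum>l<N. laplacian N Ec b $$ (j, l) * x t l $ k))"
proof -
  have x: "x t i \<in> carrier_vec n" if "i < N" for i t using tr that unfolding trajectory_def by auto
  have fin: "finite (neighbors E i)" if "weighted_graph N E w" for E w i
    using neighbors_subset[OF that] finite_subset by blast
  define sp where "sp = finsum_vec TYPE(real) n (\<lambda>l. a j l \<cdot>\<^sub>v (x t l - x t j)) (neighbors Ep j)"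
  define sc where "sc = finsum_vec TYPE(real) n (\<lambda>l. b j l \<cdot>\<^sub>v (x t j - x t l)) (neighbors Ec j)"
  have vp: "(\<lambda>l. a j l \<cdot>\<^sub>v (x t l - x t j)) \<in> neighbors Ep j \<rightarrow> carrier_vec n"
    using x j neighbors_subset[OF Gp, of j] by auto
  have vc: "(\<lambda>l. b j l \<cdot>\<^sub>v (x t j - x t l)) \<in> neighbors Ec j \<rightarrow> carrier_vec n"
    using x j neighbors_subset[OF Gc, of j] by auto
  have sp: "sp \<in> carrier_vec n" unfolding sp_def by (rule finsum_vec_closed[OF vp])
  have sc: "sc \<in> carrier_vec n" unfolding sc_def by (rule finsum_vec_closed[OF vc])
  have sp_k: "sp $ k = - (\<Sum>l<N. laplacian N Ep a $$ (j, l) * x t l $ k)" if k: "k < n" for k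
  proof -
    have "sp $ k = (\<Sum>l\<in>neighbors Ep j. (a j l \<cdot>\<^sub>v (x t l - x t j)) $ k)"
      unfolding sp_def by (rule index_finsum_vec[OF fin[OF Gp] k vp])
    also have "\<dots> = (\<Sum>l\<in>neighbors Ep j. - (a j l * (x t j $ k - x t l $ k)))"
      using x[OF j] x neighbors_subset[OF Gp, of j] k
      by (intro sum.cong refl) (auto simp: carrier_vecD[OF x[OF j]] carrier_vecD[OF x] subset_eq algebra_simps)
    finally show ?thesis unfolding laplacian_apply[OF Gp j] by (simp add: sum_negf)
  qed
  have sc_k: "sc $ k = (\<Sum>l<N. laplacian N Ec b $$ (j, l) * x t l $ k)" if k: "k < n" for k
  proof -
    have "sc $ k = (\<Sum>l\<in>neighbors Ec j. (b j l \<cdot>\<^sub>v (x t j - x t l)) $ k)"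
      unfolding sc_def by (rule index_finsum_vec[OF fin[OF Gc] k vc])
    also have "\<dots> = (\<Sum>l\<in>neighbors Ec j. b j l * (x t j $ k - x t l $ k))"
      using x[OF j] x neighbors_subset[OF Gc, of j] k
      by (intro sum.cong refl) (auto simp: carrier_vecD[OF x[OF j]] carrier_vecD[OF x] subset_eq)
    finally show ?thesis unfolding laplacian_apply[OF Gc j] .
  qed
  have mv: "(X *\<^sub>v u) $ m = (\<Sum>k<n. X $$ (m, k) * u $ k)"
    if "X \<in> carrier_mat n n" "u \<in> carrier_vec n" for X :: "real mat" and u
    using that m by (auto simp: scalar_prod_def lessThan_atLeast0 intro!: sum.cong)
  have BK: "B * K \<in> carrier_mat n n" using B K by auto
  have "x (Suc t) j = A *\<^sub>v x t j + Ap *\<^sub>v sp + B *\<^sub>v (K *\<^sub>v sc)"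
    using tr j unfolding trajectory_def input_vec_def sp_def sc_def by blast
  also have "B *\<^sub>v (K *\<^sub>v sc) = (B * K) *\<^sub>v sc" using B K sc by (simp add: assoc_mult_mat_vec[of _ n 1 _ n])
  finally have "x (Suc t) j $ m = (A *\<^sub>v x t j) $ m + (Ap *\<^sub>v sp) $ m + ((B * K) *\<^sub>v sc) $ m"
    using A Ap B K x[OF j] sp sc m by (simp del: index_mult_mat_vec)
  then show ?thesis unfolding mv[OF A x[OF j]] mv[OF Ap sp] mv[OF BK sc]
    by (simp add: sp_k sc_k sum_negf)
qed

lemma pow_mat_commute:
  fixes F :: "'a :: comm_ring_1 mat"
  assumes F: "F \<in> carrier_mat n n"
  shows "F * F ^\<^sub>m t = F ^\<^sub>m t * F"
proof (induction t)
  case 0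
  show ?case using F by simp
next
  case (Suc t)
  have Ft: "F ^\<^sub>m t \<in> carrier_mat n n" using F by simp
  have "F * F ^\<^sub>m Suc t = (F * F ^\<^sub>m t) * F"
    unfolding pow_mat.simps by (rule assoc_mult_mat[OF F Ft F, symmetric])
  also have "\<dots> = F ^\<^sub>m Suc t * F" unfolding Suc by simp
  finally show ?case .
qed

text \<open>Mode 0 divided by \<open>sqrt N\<close> is the network average, and it serves as the
  moving consensus vector. The deviation of an agent from it is a fixed linear combination of the
  stable modes.\<close>

lemma modes_stable_imp_consensus:
  assumes Gp: "weighted_graph N Ep a" and Gc: "weighted_graph N Ec b"
    and A: "A \<in> carrier_mat n n" and Ap: "Ap \<in> carrier_mat n n" and B: "B \<in> carrier_mat n 1"
    and K: "K \<in> carrier_mat 1 n" and N: "0 < N"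
    and D: "diagonalizes_laplacians N \<Phi> (laplacian N Ep a) (laplacian N Ec b) lp lc"
    and st: "\<And>i. i \<in> {1..<N} \<Longrightarrow> schur_stable (A - lp i \<cdot>\<^sub>m Ap + lc i \<cdot>\<^sub>m (B * K))"
  shows "achieves_consensus N n Ep a Ec b A Ap B K"
  unfolding achieves_consensus_def
proof (intro conjI allI impI)
  show "K \<in> carrier_mat 1 n" by (rule K)
  fix x assume tr: "trajectory N n Ep a Ec b A Ap B K x"
  have x: "x t i \<in> carrier_vec n" if "i < N" for i t using tr that unfolding trajectory_def by auto
  have \<Phi>: "\<Phi> \<in> carrier_mat N N" "\<Phi>\<^sup>T * \<Phi> = 1\<^sub>m N"
    and \<Phi>0: "col \<Phi> 0 = vec N (\<lambda>_. 1 / sqrt (real N))"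
    and dp: "\<Phi>\<^sup>T * laplacian N Ep a * \<Phi> = mat_diag N lp"
    and dc: "\<Phi>\<^sup>T * laplacian N Ec b * \<Phi> = mat_diag N lc"
    using D unfolding diagonalizes_laplacians_def by auto
  define z where "z t i = vec n (\<lambda>m. \<Sum>j<N. \<Phi> $$ (j, i) * x t j $ m)" for t i
  define F where "F i = A - lp i \<cdot>\<^sub>m Ap + lc i \<cdot>\<^sub>m (B * K)" for i
  have BK: "B * K \<in> carrier_mat n n" using B K by auto
  have F: "F i \<in> carrier_mat n n" for i unfolding F_def using A Ap BK by auto
  have step: "z (Suc t) i = F i *\<^sub>v z t i" if i: "i < N" for t i
  proof (rule eq_vecI)
    fix m assume "m < dim_vec (F i *\<^sub>v z t i)"
    then have m: "m < n" using F[of i] by simp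
    have collect: "(\<Sum>j<N. \<Phi> $$ (j, i) * (\<Sum>k<n. X $$ (m, k) * Y j k))
        = (\<Sum>k<n. X $$ (m, k) * (\<Sum>j<N. \<Phi> $$ (j, i) * Y j k))" for X :: "real mat" and Y
      unfolding sum_distrib_left by (subst sum.swap) (simp add: mult_ac)
    have "z (Suc t) i $ m = (\<Sum>j<N. \<Phi> $$ (j, i) * x (Suc t) j $ m)" unfolding z_def using m by simp
    also have "\<dots> = (\<Sum>j<N. \<Phi> $$ (j, i) * (\<Sum>k<n. A $$ (m, k) * x t j $ k))
      - (\<Sum>j<N. \<Phi> $$ (j, i) * (\<Sum>k<n. Ap $$ (m, k) * (\<Sum>l<N. laplacian N Ep a $$ (j, l) * x t l $ k)))
      + (\<Sum>j<N. \<Phi> $$ (j, i) * (\<Sum>k<n. (B * K) $$ (m, k) * (\<Sum>l<N. laplacian N Ec b $$ (j, l) * x t l $ k)))"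
      unfolding sum.distrib[symmetric] sum_subtractf[symmetric] using m
      by (intro sum.cong) (auto simp: trajectory_component[OF tr Gp Gc A Ap B K] algebra_simps simp del: index_mult_mat(1))
    also have "\<dots> = (\<Sum>k<n. A $$ (m, k) * z t i $ k) - (\<Sum>k<n. Ap $$ (m, k) * (lp i * z t i $ k))
      + (\<Sum>k<n. (B * K) $$ (m, k) * (lc i * z t i $ k))"
      unfolding collect modal_eigenvalue[OF \<Phi> laplacian_carrier dp i] modal_eigenvalue[OF \<Phi> laplacian_carrier dc i]
      by (simp add: z_def del: index_mult_mat(1))
    also have "\<dots> = (\<Sum>k<n. F i $$ (m, k) * z t i $ k)"
      unfolding sum.distrib[symmetric] sum_subtractf[symmetric] using m A Ap B K
      by (intro sum.cong) (auto simp: F_def algebra_simps simp del: index_mult_mat(1))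
    also have "\<dots> = (F i *\<^sub>v z t i) $ m"
      using F[of i] m by (auto simp: scalar_prod_def lessThan_atLeast0 z_def intro!: sum.cong)
    finally show "z (Suc t) i $ m = (F i *\<^sub>v z t i) $ m" .
  qed (simp add: z_def carrier_matD(1)[OF F[of i]])
  have z: "z t i \<in> carrier_vec n" for t i unfolding z_def by simp
  have z_pow: "z t i = F i ^\<^sub>m t *\<^sub>v z 0 i" if i: "i < N" for t i
  proof (induction t)
    case 0
    show ?case using F[of i] z[of 0 i] by simp
  next
    case (Suc t)
    have "F i * F i ^\<^sub>m t = F i ^\<^sub>m t * F i" by (rule pow_mat_commute[OF F])
    moreover have "F i ^\<^sub>m t \<in> carrier_mat n n" using F by simp
    ultimately show ?case
      unfolding step[OF i] Suc assoc_mult_mat_vec[OF F \<open>F i ^\<^sub>m t \<in> carrier_mat n n\<close> z, symmetric] by simp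
  qed
  have z_lim: "(\<lambda>t. z t i $ m) \<longlonglongrightarrow> 0" if i: "i \<in> {1..<N}" and m: "m < n" for i m
  proof -
    have "z t i $ m = (\<Sum>k<n. (F i ^\<^sub>m t) $$ (m, k) * z 0 i $ k)" for t
    proof -
      have Ft: "F i ^\<^sub>m t \<in> carrier_mat n n" using F by simp
      have "z t i = F i ^\<^sub>m t *\<^sub>v z 0 i" by (rule z_pow) (use i in simp)
      then show ?thesis using m z[of 0 i] carrier_matD[OF Ft]
        by (auto simp: scalar_prod_def lessThan_atLeast0 intro!: sum.cong)
    qed
    moreover have "(\<lambda>t. \<Sum>k<n. (F i ^\<^sub>m t) $$ (m, k) * z 0 i $ k) \<longlonglongrightarrow> (\<Sum>k<n. 0 * z 0 i $ k)"
      using st[OF i] m F[of i] by (intro tendsto_intros schur_stable_pow_tendsto_0) (auto simp: F_def)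
    ultimately show ?thesis by simp
  qed
  define v where "v t = (1 / sqrt (real N)) \<cdot>\<^sub>v z t 0" for t
  have diff: "x t i $ m - v t $ m = (\<Sum>l\<in>{1..<N}. \<Phi> $$ (i, l) * z t l $ m)" if i: "i < N" and m: "m < n" for t i m
  proof -
    have "(\<Sum>l<N. \<Phi> $$ (i, l) * z t l $ m) = (\<Sum>l<N. \<Sum>j<N. \<Phi> $$ (i, l) * (\<Phi> $$ (j, l) * x t j $ m))"
      unfolding z_def using m by (simp add: sum_distrib_left)
    also have "\<dots> = (\<Sum>j<N. (\<Sum>l<N. \<Phi> $$ (i, l) * \<Phi> $$ (j, l)) * x t j $ m)"
      unfolding sum_distrib_right by (subst sum.swap) (simp add: mult_ac)
    also have "\<dots> = (\<Sum>j<N. if j = i then x t j $ m else 0)"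
      using i by (intro sum.cong) (auto simp: orthonormal_rows[OF D])
    also have "\<dots> = x t i $ m" using i by (simp add: sum.delta)
    finally have "x t i $ m = (\<Sum>l<N. \<Phi> $$ (i, l) * z t l $ m)" ..
    moreover have "{..<N} = insert 0 {1..<N}" using N by auto
    ultimately have "x t i $ m = \<Phi> $$ (i, 0) * z t 0 $ m + (\<Sum>l\<in>{1..<N}. \<Phi> $$ (i, l) * z t l $ m)"
      by simp
    moreover have "\<Phi> $$ (i, 0) = 1 / sqrt (real N)"
      using arg_cong[OF \<Phi>0, of "\<lambda>v. v $ i"] \<Phi>(1) i N by simp
    ultimately show ?thesis unfolding v_def using m z[of t 0] by simp
  qed
  have "(\<lambda>t. \<bar>x t i $ m - v t $ m\<bar>) \<longlonglongrightarrow> 0" if "i < N" "m < n" for i m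
  proof -
    have "(\<lambda>t. \<Sum>l\<in>{1..<N}. \<Phi> $$ (i, l) * z t l $ m) \<longlonglongrightarrow> (\<Sum>l\<in>{1..<N}. \<Phi> $$ (i, l) * 0)"
      using that by (intro tendsto_intros z_lim) auto
    then show ?thesis unfolding diff[OF that] by (intro tendsto_rabs_zero) simp
  qed
  then show "\<exists>v. (\<forall>t. v t \<in> carrier_vec n) \<and> (\<forall>i<N. \<forall>k<n. (\<lambda>t. \<bar>x t i $ k - v t $ k\<bar>) \<longlonglongrightarrow> 0)"
    using z by (intro exI[of _ v]) (auto simp: v_def)
qed

section \<open>The scaled modes and consensus by the Riccati gain\<close>

text \<open>Multiplication by \<open>c / d\<close> maps eigenvalues of \<open>d A\<close> to
  eigenvalues of \<open>c A\<close> without decreasing the modulus. For \<open>d = 0\<close> the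
  only possible eigenvalue is 0.\<close>

lemma schur_stable_scale:
  fixes A :: "real mat"
  assumes A: "A \<in> carrier_mat n n" and st: "schur_stable (c \<cdot>\<^sub>m A)" and le: "\<bar>d\<bar> \<le> \<bar>c\<bar>"
  shows "schur_stable (d \<cdot>\<^sub>m A)"
  unfolding schur_stable_def
proof (intro allI impI)
  let ?A = "map_mat complex_of_real A"
  fix z assume ev: "eigenvalue (map_mat complex_of_real (d \<cdot>\<^sub>m A)) z"
  have Ac: "?A \<in> carrier_mat n n" using A by simp
  obtain v where v: "v \<in> carrier_vec n" "v \<noteq> 0\<^sub>v n" and dv: "(complex_of_real d \<cdot>\<^sub>m ?A) *\<^sub>v v = z \<cdot>\<^sub>v v"
    using ev A unfolding map_of_real_smult eigenvalue_def eigenvector_def by auto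
  have dAv: "complex_of_real d \<cdot>\<^sub>v (?A *\<^sub>v v) = z \<cdot>\<^sub>v v"
    using dv v A by (simp add: smult_mat_mult_vec)
  show "cmod z < 1"
  proof (cases "d = 0")
    case True
    obtain i where i: "i < n" "v $ i \<noteq> 0"
    proof (rule ccontr)
      assume "\<not> thesis"
      then have "v = 0\<^sub>v n" using v(1) that by (intro eq_vecI) auto
      then show False using v(2) by simp
    qed
    have "z * v $ i = 0" using arg_cong[OF dAv, of "\<lambda>u. u $ i"] v(1) A i True by simp
    then show ?thesis using i by simp
  next
    case False
    define r where "r = complex_of_real (c / d)"
    have "(complex_of_real c \<cdot>\<^sub>m ?A) *\<^sub>v v = complex_of_real c \<cdot>\<^sub>v (?A *\<^sub>v v)"
      using v A by (simp add: smult_mat_mult_vec)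
    also have "\<dots> = r \<cdot>\<^sub>v (complex_of_real d \<cdot>\<^sub>v (?A *\<^sub>v v))"
      using False by (simp add: r_def smult_smult_assoc)
    also have "\<dots> = (r * z) \<cdot>\<^sub>v v" unfolding dAv by (simp add: smult_smult_assoc)
    finally have "eigenvalue (map_mat complex_of_real (c \<cdot>\<^sub>m A)) (r * z)"
      unfolding map_of_real_smult eigenvalue_def eigenvector_def using v A by auto
    then have "cmod (r * z) < 1" using st unfolding schur_stable_def by blast
    then have "cmod r * cmod z < 1" by (simp add: norm_mult)
    moreover have "1 \<le> cmod r" using le False unfolding r_def by (simp add: norm_divide)
    ultimately show ?thesis using mult_right_mono[of 1 "cmod r" "cmod z"] by simp
  qed
qed

text \<open>In the application \<open>s = \<alpha>\<^sub>i / \<alpha>\<^sub>m\<^sub>a\<^sub>x\<close> and \<open>e = \<lambda>\<^sub>c\<^sub>,\<^sub>i k\<^sup>* / \<alpha>\<^sub>m\<^sub>a\<^sub>x\<close>.\<close>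

lemma riccati_mode_schur_stable:
  fixes M B P :: "real mat"
  assumes M: "M \<in> carrier_mat n n" and B: "B \<in> carrier_mat n 1"
    and ric: "riccati_solution n M B \<sigma> P"
    and s: "s\<^sup>2 \<le> 1" and e: "\<sigma> \<le> 2 * s * e - e\<^sup>2"
  shows "schur_stable (s \<cdot>\<^sub>m M - e \<cdot>\<^sub>m (B * (inv_1x1 (B\<^sup>T * P * B) * B\<^sup>T * P * M)))"
proof -
  have pd: "positive_definite n P" using ric unfolding riccati_solution_def by simp
  note P = positive_definiteD(1,2)[OF pd] and pos = positive_definiteD(3)[OF pd]
    and nonneg = positive_definiteD(4)[OF pd]
  let ?b = "col B 0"
  have b: "?b \<in> carrier_vec n" using B by auto
  define K where "K = inv_1x1 (B\<^sup>T * P * B) * B\<^sup>T * P * M"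
  define \<beta> where "\<beta> = ?b \<bullet> (P *\<^sub>v ?b)"
  have J: "inv_1x1 X \<in> carrier_mat 1 1" for X unfolding inv_1x1_def by simp
  have K: "K \<in> carrier_mat 1 n" unfolding K_def using M B P J by (auto intro!: mult_carrier_mat)
  have \<beta>: "0 \<le> \<beta>" unfolding \<beta>_def by (rule nonneg[OF b])
  have Kv: "(K *\<^sub>v v) $ 0 = inverse \<beta> * ((M *\<^sub>v v) \<bullet> (P *\<^sub>v ?b))" if v: "v \<in> carrier_vec n" for v
  proof -
    let ?J = "inv_1x1 (B\<^sup>T * P * B)"
    have Mv: "M *\<^sub>v v \<in> carrier_vec n" using M v by simp
    have J00: "?J $$ (0, 0) = inverse \<beta>"
      unfolding \<beta>_def inv_1x1_def using congruence_col_index[OF P(1) B] by simp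
    have "K = ?J * (B\<^sup>T * P * M)" unfolding K_def using M B P J[of "B\<^sup>T * P * B"] by (simp add: mat_dim_simps)
    moreover have L: "B\<^sup>T * P * M \<in> carrier_mat 1 n" using M B P by (auto intro!: mult_carrier_mat)
    ultimately have Kv_eq: "K *\<^sub>v v = ?J *\<^sub>v ((B\<^sup>T * P * M) *\<^sub>v v)"
      using assoc_mult_mat_vec[OF J L v] by (simp only:)
    have mult_1x1: "(X *\<^sub>v u) $ 0 = X $$ (0, 0) * u $ 0"
      if "X \<in> carrier_mat 1 1" "u \<in> carrier_vec 1" for X :: "real mat" and u
      using that by (simp add: scalar_prod_def)
    have "(K *\<^sub>v v) $ 0 = ?J $$ (0, 0) * ((B\<^sup>T * P * M) *\<^sub>v v) $ 0"
      unfolding Kv_eq by (rule mult_1x1[OF J mult_mat_vec_carrier[OF L v]])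
    also have "(B\<^sup>T * P * M) *\<^sub>v v = B\<^sup>T *\<^sub>v (P *\<^sub>v (M *\<^sub>v v))"
      using M B P v Mv by (simp add: assoc_mult_mat_vec[of _ 1 n _ n])
    also have "(\<dots>) $ 0 = ?b \<bullet> (P *\<^sub>v (M *\<^sub>v v))" using B by simp
    also have "\<dots> = (M *\<^sub>v v) \<bullet> (P *\<^sub>v ?b)" by (rule sprod_symmetric[OF P b Mv])
    finally show ?thesis unfolding J00 .
  qed
  have sM: "s \<cdot>\<^sub>m M \<in> carrier_mat n n" and eK: "(- e) \<cdot>\<^sub>m K \<in> carrier_mat 1 n" using M K by auto
  have F_eq: "s \<cdot>\<^sub>m M - e \<cdot>\<^sub>m (B * K) = s \<cdot>\<^sub>m M + B * ((- e) \<cdot>\<^sub>m K)"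
    using M B K by (intro eq_matI) (auto simp: mat_dim_simps simp del: index_mult_mat(1))
  have F: "s \<cdot>\<^sub>m M + B * ((- e) \<cdot>\<^sub>m K) \<in> carrier_mat n n" using M B K by auto
  have "schur_stable (s \<cdot>\<^sub>m M + B * ((- e) \<cdot>\<^sub>m K))"
  proof (rule lyapunov_imp_schur_stable[OF F P(1) pos])
    fix v :: "real vec" assume v: "v \<in> carrier_vec n" "v \<noteq> 0\<^sub>v n"
    let ?F = "s \<cdot>\<^sub>m M + B * ((- e) \<cdot>\<^sub>m K)"
    define q where "q = (M *\<^sub>v v) \<bullet> (P *\<^sub>v (M *\<^sub>v v))"
    define g where "g = (M *\<^sub>v v) \<bullet> (P *\<^sub>v ?b)"
    have Mv: "M *\<^sub>v v \<in> carrier_vec n" using M v by simp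
    have PMv: "P *\<^sub>v (M *\<^sub>v v) \<in> carrier_vec n" and Pb: "P *\<^sub>v ?b \<in> carrier_vec n" using P Mv b by auto
    have "?F *\<^sub>v v = s \<cdot>\<^sub>v (M *\<^sub>v v) + (- e * (inverse \<beta> * g)) \<cdot>\<^sub>v ?b"
    proof -
      have "((- e) \<cdot>\<^sub>m K) *\<^sub>v v = (- e) \<cdot>\<^sub>v (K *\<^sub>v v)" using K v by (simp add: smult_mat_mult_vec)
      then have "(((- e) \<cdot>\<^sub>m K) *\<^sub>v v) $ 0 = - e * (inverse \<beta> * g)"
        unfolding g_def Kv[OF v(1), symmetric] using K v by (simp del: index_mult_mat_vec)
      moreover have "(s \<cdot>\<^sub>m M) *\<^sub>v v = s \<cdot>\<^sub>v (M *\<^sub>v v)" using M v by (simp add: smult_mat_mult_vec)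
      ultimately show ?thesis unfolding rank_one_feedback_mult_vec[OF sM B eK v(1)] by simp
    qed
    then have "(?F *\<^sub>v v) \<bullet> (P *\<^sub>v (?F *\<^sub>v v))
        = s\<^sup>2 * q + 2 * (- e * (inverse \<beta> * g)) * (s * g) + (- e * (inverse \<beta> * g))\<^sup>2 * \<beta>"
      using quadratic_form_add_smult[OF P, of "s \<cdot>\<^sub>v (M *\<^sub>v v)" ?b "- e * (inverse \<beta> * g)"] Mv b P PMv Pb
      unfolding q_def g_def \<beta>_def by (simp add: mult_mat_vec[of _ n n] power2_eq_square mult.assoc)
    \<comment> \<open>For \<open>B = 0\<close> one has \<open>\<beta> = 0\<close>; with
      \<open>inverse 0 = 0\<close> both sides are then \<open>s\<^sup>2 * q\<close>.\<close>
    also have "\<dots> = s\<^sup>2 * q - (2 * s * e - e\<^sup>2) * (g\<^sup>2 * inverse \<beta>)"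
      by (cases "\<beta> = 0") (simp_all add: field_simps power2_eq_square)
    also have "\<dots> \<le> q - \<sigma> * (g\<^sup>2 * inverse \<beta>)"
    proof -
      have "s\<^sup>2 * q \<le> 1 * q" using s nonneg[OF Mv] unfolding q_def by (intro mult_right_mono) auto
      moreover have "\<sigma> * (g\<^sup>2 * inverse \<beta>) \<le> (2 * s * e - e\<^sup>2) * (g\<^sup>2 * inverse \<beta>)"
        using e \<beta> by (intro mult_right_mono) auto
      ultimately show ?thesis by simp
    qed
    also have "\<dots> < v \<bullet> (P *\<^sub>v v)"
      using ric v unfolding riccati_solution_iff[OF M B] q_def g_def \<beta>_def by auto
    finally show "(?F *\<^sub>v v) \<bullet> (P *\<^sub>v (?F *\<^sub>v v)) < v \<bullet> (P *\<^sub>v v)" .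
  qed
  then show ?thesis unfolding K_def[symmetric] F_eq .
qed

theorem theorem3:
  fixes N n :: nat
    and Ep Ec :: "(nat \<times> nat) set"
    and a b :: "nat \<Rightarrow> nat \<Rightarrow> real"
    and A Ap B \<Phi> Abar :: "real mat"
    and lp lc al :: "nat \<Rightarrow> real"
    and \<alpha> al_max al_min lc_max r_max r_min k_star \<sigma>\<^sub>c \<sigma> :: real
  assumes "N \<ge> 2" and "n \<ge> 1"
    and "weighted_graph N Ep a"
    and "weighted_graph N Ec b" and "connected_graph N Ec"
    and "A \<in> carrier_mat n n" and "Ap \<in> carrier_mat n n" and "B \<in> carrier_mat n 1"
    and "laplacian N Ep a * laplacian N Ec b = laplacian N Ec b * laplacian N Ep a"
    and "diagonalizes_laplacians N \<Phi> (laplacian N Ep a) (laplacian N Ec b) lp lc"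
    and "\<forall>i \<in> {1..<N}. controllable n (A - lp i \<cdot>\<^sub>m Ap) B"
    and "Ap = \<alpha> \<cdot>\<^sub>m A"
  defines "al \<equiv> \<lambda>i. 1 - \<alpha> * lp i"
    and "al_max \<equiv> Max ((\<lambda>i. \<bar>al i\<bar>) ` {1..<N})"
    and "al_min \<equiv> Min ((\<lambda>i. \<bar>al i\<bar>) ` {1..<N})"
    and "lc_max \<equiv> Max (lc ` {1..<N})"
    and "Abar \<equiv> al_max \<cdot>\<^sub>m A"
    and "\<sigma>\<^sub>c \<equiv> 1 - 1 / (\<Prod>z\<in>#unstable_eigenvalues Abar. (cmod z)\<^sup>2)"
    and "r_max \<equiv> Max ((\<lambda>(i, j). al i / lc j) ` ({1..<N} \<times> {1..<N}))"
    and "r_min \<equiv> Min ((\<lambda>(i, j). al i / lc j) ` ({1..<N} \<times> {1..<N}))"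
    and "k_star \<equiv> (r_min + r_max) / 2"
    and "\<sigma> \<equiv> Min ((\<lambda>(i, j). (2 * al i * lc j * k_star - (lc j)\<^sup>2 * k_star\<^sup>2) / al_max\<^sup>2)
                    ` ({1..<N} \<times> {1..<N}))"
  shows "(schur_stable Abar \<longrightarrow> achieves_consensus N n Ep a Ec b A Ap B (0\<^sub>m 1 n)) \<and>
         (\<not> schur_stable Abar \<and>
          ((r_max - r_min) / 2)\<^sup>2 < (al_min\<^sup>2 - al_max\<^sup>2 * \<sigma>\<^sub>c) / lc_max\<^sup>2 \<longrightarrow>
            (\<exists>P. riccati_solution n Abar B \<sigma> P) \<and>
            (\<forall>P. riccati_solution n Abar B \<sigma> P \<longrightarrow>
               achieves_consensus N n Ep a Ec b A Ap B (riccati_gain k_star A B P)))"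
proof -
  note N = \<open>N \<ge> 2\<close> and n = \<open>n \<ge> 1\<close> and Gp = \<open>weighted_graph N Ep a\<close>
    and Gc = \<open>weighted_graph N Ec b\<close> and A = \<open>A \<in> carrier_mat n n\<close>
    and Ap = \<open>Ap \<in> carrier_mat n n\<close> and B = \<open>B \<in> carrier_mat n 1\<close>
    and D = \<open>diagonalizes_laplacians N \<Phi> (laplacian N Ep a) (laplacian N Ec b) lp lc\<close>
    and ctrl = \<open>\<forall>i \<in> {1..<N}. controllable n (A - lp i \<cdot>\<^sub>m Ap) B\<close>
  have N0: "0 < N" and I1: "1 \<in> {1..<N}" and n0: "0 < n" using N n by auto
  have mode: "A - lp i \<cdot>\<^sub>m Ap = al i \<cdot>\<^sub>m A" for i
    unfolding \<open>Ap = \<alpha> \<cdot>\<^sub>m A\<close> al_def using A by (intro eq_matI) (auto simp: algebra_simps)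
  have al_max_ge: "\<bar>al i\<bar> \<le> al_max" if "i \<in> {1..<N}" for i
    unfolding al_max_def using that by (intro Max_ge) auto
  have al_min_le: "al_min \<le> \<bar>al i\<bar>" if "i \<in> {1..<N}" for i
    unfolding al_min_def using that by (intro Min_le) auto
  have al_max_nonneg: "0 \<le> al_max" using al_max_ge[OF I1] by linarith
  have Abar: "Abar \<in> carrier_mat n n" unfolding Abar_def using A by simp
  show ?thesis
  proof (intro conjI impI)
    assume st: "schur_stable Abar"
    show "achieves_consensus N n Ep a Ec b A Ap B (0\<^sub>m 1 n)"
    proof (rule modes_stable_imp_consensus[OF Gp Gc A Ap B _ N0 D])
      fix i assume i: "i \<in> {1..<N}"
      have "schur_stable (al i \<cdot>\<^sub>m A)"
        by (rule schur_stable_scale[OF A st[unfolded Abar_def]])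
          (use al_max_ge[OF i] al_max_nonneg in simp)
      moreover have "al i \<cdot>\<^sub>m A + lc i \<cdot>\<^sub>m (B * 0\<^sub>m 1 n) = al i \<cdot>\<^sub>m A"
        using A B by (intro eq_matI) auto
      ultimately show "schur_stable (A - lp i \<cdot>\<^sub>m Ap + lc i \<cdot>\<^sub>m (B * 0\<^sub>m 1 n))"
        unfolding mode by simp
    qed simp
  next
    assume "\<not> schur_stable Abar \<and>
      ((r_max - r_min) / 2)\<^sup>2 < (al_min\<^sup>2 - al_max\<^sup>2 * \<sigma>\<^sub>c) / lc_max\<^sup>2"
    then have cond: "((r_max - r_min) / 2)\<^sup>2 < (al_min\<^sup>2 - al_max\<^sup>2 * \<sigma>\<^sub>c) / lc_max\<^sup>2" by simp
    have lc_pos: "0 < lc i" if "i \<in> {1..<N}" for i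
      by (rule connected_eigenvalue_pos[OF Gc \<open>connected_graph N Ec\<close> D that])
    have lc_le: "lc i \<le> lc_max" if "i \<in> {1..<N}" for i
      unfolding lc_max_def using that by (intro Max_ge) auto
    have lc_max: "0 < lc_max" using lc_pos[OF I1] lc_le[OF I1] by linarith
    have r: "r_min \<le> al i / lc j" "al i / lc j \<le> r_max" if "i \<in> {1..<N}" "j \<in> {1..<N}" for i j
      unfolding r_min_def r_max_def using that by (force intro!: Min_le Max_ge)+
    have cond': "al_max\<^sup>2 * \<sigma>\<^sub>c < al_min\<^sup>2 - lc_max\<^sup>2 * ((r_max - r_min) / 2)\<^sup>2"
      using cond lc_max by (simp add: field_simps)
    have "1 \<le> (\<Prod>z\<in>#unstable_eigenvalues Abar. (cmod z)\<^sup>2)"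
    proof -
      have "1 \<le> (\<Prod>z\<in>#X. (cmod z)\<^sup>2)" if "\<forall>z\<in>#X. 1 \<le> cmod z" for X
        using that
      proof (induction X)
        case (add z X)
        have "1 * 1 \<le> (cmod z)\<^sup>2 * (\<Prod>z\<in>#X. (cmod z)\<^sup>2)"
          using add by (intro mult_mono) auto
        then show ?case by simp
      qed simp
      then show ?thesis unfolding unstable_eigenvalues_def by auto
    qed
    then have \<sigma>\<^sub>c: "0 \<le> \<sigma>\<^sub>c" unfolding \<sigma>\<^sub>c_def by (simp add: divide_le_eq_1)
    have "0 \<le> al_max\<^sup>2 * \<sigma>\<^sub>c" "0 \<le> lc_max\<^sup>2 * ((r_max - r_min) / 2)\<^sup>2" using \<sigma>\<^sub>c by auto
    \<comment> \<open>Both \<open>\<sigma>\<^sub>c\<close> and the squared spread are nonnegative,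
      so the spread condition keeps every \<open>al i\<close> away from 0.\<close>
    then have "0 < al_min\<^sup>2" using cond' by linarith
    then have "al_min \<noteq> 0" by auto
    moreover have al_min_nonneg: "0 \<le> al_min" unfolding al_min_def using I1 by (subst Min_ge_iff) auto
    ultimately have al_min: "0 < al_min" by simp
    then have al_nz: "al i \<noteq> 0" if "i \<in> {1..<N}" for i using al_min_le[OF that] by auto
    have al_max: "0 < al_max" using al_min al_min_le[OF I1] al_max_ge[OF I1] by linarith
    have \<sigma>_gt: "\<sigma>\<^sub>c < \<sigma>"
    proof -
      have "\<sigma>\<^sub>c < (2 * al i * lc j * k_star - (lc j)\<^sup>2 * k_star\<^sup>2) / al_max\<^sup>2"
        if ij: "i \<in> {1..<N}" "j \<in> {1..<N}" for i j
      proof -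
        \<comment> \<open>\<open>k_star\<close> is the midpoint of the interval containing all
          ratios.\<close>
        have "\<bar>x - k_star\<bar> \<le> (r_max - r_min) / 2" if "r_min \<le> x" "x \<le> r_max" for x
          using that unfolding k_star_def by (auto simp: abs_le_iff field_simps)
        from this[OF r[OF ij]]
        have "(al i / lc j - k_star)\<^sup>2 \<le> ((r_max - r_min) / 2)\<^sup>2"
          using power_mono[of "\<bar>al i / lc j - k_star\<bar>" _ 2] by simp
        moreover have "(lc j)\<^sup>2 \<le> lc_max\<^sup>2"
          using lc_pos[OF ij(2)] lc_le[OF ij(2)] by (intro power_mono) auto
        ultimately have "(lc j)\<^sup>2 * (al i / lc j - k_star)\<^sup>2 \<le> lc_max\<^sup>2 * ((r_max - r_min) / 2)\<^sup>2"
          by (intro mult_mono) auto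
        moreover have "al_min\<^sup>2 \<le> (al i)\<^sup>2"
          using power_mono[OF al_min_le[OF ij(1)] al_min_nonneg, of 2] by simp
        moreover have "(lc j)\<^sup>2 * (al i / lc j - k_star)\<^sup>2 = (al i - lc j * k_star)\<^sup>2"
          using lc_pos[OF ij(2)] by (simp add: field_simps flip: power_mult_distrib)
        ultimately have "al_max\<^sup>2 * \<sigma>\<^sub>c < (al i)\<^sup>2 - (al i - lc j * k_star)\<^sup>2" using cond' by linarith
        also have "\<dots> = 2 * al i * lc j * k_star - (lc j)\<^sup>2 * k_star\<^sup>2"
          by (simp add: power2_eq_square algebra_simps)
        finally show ?thesis using al_max by (simp add: field_simps)
      qed
      then show ?thesis unfolding \<sigma>_def using I1 by (subst Min_gr_iff) auto
    qed
    \<comment> \<open>\<open>Abar\<close> is a nonzero multiple of this mode matrix, so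
      controllability passes to it through the Hautus test.\<close>
    have ctrl1: "controllable n (al 1 \<cdot>\<^sub>m A) B" using ctrl I1 unfolding mode by blast
    have A1: "al 1 \<cdot>\<^sub>m A \<in> carrier_mat n n" using A by simp
    have Abar_eq: "map_mat complex_of_real Abar
        = complex_of_real (al_max / al 1) \<cdot>\<^sub>m map_mat complex_of_real (al 1 \<cdot>\<^sub>m A)"
      unfolding Abar_def using al_nz[OF I1] by (intro eq_matI) auto
    have "hautus n (map_mat complex_of_real Abar) (map_mat complex_of_real B)"
      unfolding Abar_eq
      by (rule hautus_smult[OF controllable_imp_hautus[OF A1 B ctrl1]])
        (use A al_max al_nz[OF I1] in auto)
    then show "\<exists>P. riccati_solution n Abar B \<sigma> P"
      using riccati_solution_exists[OF Abar B controllable_imp_nonzero_input[OF A1 B ctrl1 n0]] \<sigma>_gt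
      unfolding \<sigma>\<^sub>c_def by blast
    show "\<forall>P. riccati_solution n Abar B \<sigma> P \<longrightarrow>
      achieves_consensus N n Ep a Ec b A Ap B (riccati_gain k_star A B P)"
    proof (intro allI impI)
      fix P assume ric: "riccati_solution n Abar B \<sigma> P"
      have P: "P \<in> carrier_mat n n"
        using ric unfolding riccati_solution_def positive_definite_def by simp
      have J: "inv_1x1 X \<in> carrier_mat 1 1" for X unfolding inv_1x1_def by simp
      let ?H = "inv_1x1 (B\<^sup>T * P * B) * B\<^sup>T * P"
      have H: "?H \<in> carrier_mat 1 n" using B P J by (auto intro!: mult_carrier_mat)
      show "achieves_consensus N n Ep a Ec b A Ap B (riccati_gain k_star A B P)"
      proof (rule modes_stable_imp_consensus[OF Gp Gc A Ap B _ N0 D])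
        show "riccati_gain k_star A B P \<in> carrier_mat 1 n"
          unfolding riccati_gain_def using H A by auto
        fix i assume i: "i \<in> {1..<N}"
        define s where "s = al i / al_max"
        define e where "e = lc i * k_star / al_max"
        have "schur_stable (s \<cdot>\<^sub>m Abar - e \<cdot>\<^sub>m (B * (?H * Abar)))"
        proof (rule riccati_mode_schur_stable[OF Abar B ric])
          have "\<bar>s\<bar> \<le> 1" unfolding s_def using al_max_ge[OF i] al_max by simp
          then show "s\<^sup>2 \<le> 1" by (simp add: abs_square_le_1)
          \<comment> \<open>Mode \<open>i\<close> corresponds to the diagonal pair
            \<open>(i, i)\<close>: both Laplacians have column \<open>i\<close> of \<Phi> as
            eigenvector.\<close>
          have "\<sigma> \<le> (2 * al i * lc i * k_star - (lc i)\<^sup>2 * k_star\<^sup>2) / al_max\<^sup>2"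
            unfolding \<sigma>_def using i by (intro Min_le) auto
          also have "\<dots> = 2 * s * e - e\<^sup>2"
            unfolding s_def e_def using al_max by (simp add: field_simps power2_eq_square)
          finally show "\<sigma> \<le> 2 * s * e - e\<^sup>2" .
        qed
        \<comment> \<open>The gain is built from \<open>A\<close> and the Riccati inequality from
          \<open>Abar\<close>; the factor \<open>al_max\<close> between them cancels the
          denominators of \<open>s\<close> and \<open>e\<close>.\<close>
        also have "s \<cdot>\<^sub>m Abar - e \<cdot>\<^sub>m (B * (?H * Abar))
            = al i \<cdot>\<^sub>m A + lc i \<cdot>\<^sub>m (B * riccati_gain k_star A B P)"
        proof -
          have "B * (X * Abar) = al_max \<cdot>\<^sub>m (B * (X * A))"
            "B * ((- k_star) \<cdot>\<^sub>m (X * A)) = (- k_star) \<cdot>\<^sub>m (B * (X * A))"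
            "B * (X * A) \<in> carrier_mat n n"
            if "X \<in> carrier_mat 1 n" for X
            unfolding Abar_def using that A B by (auto simp: mat_dim_simps intro!: mult_carrier_mat)
          note eqs = this[OF H]
          show ?thesis
            unfolding riccati_gain_def eqs(1,2) unfolding s_def e_def Abar_def
            using A carrier_matD[OF eqs(3)] al_max
            by (intro eq_matI) (auto simp del: index_mult_mat)
        qed
        finally show "schur_stable (A - lp i \<cdot>\<^sub>m Ap + lc i \<cdot>\<^sub>m (B * riccati_gain k_star A B P))"
          unfolding mode .
      qed
    qed
  qed
qed

end
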